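(* Let $\mathcal{A}=C^\infty(\mathbb{T}^2_\theta)$ be the smooth algebra of the noncommutative 2-torus with standard trace $\tau$ and basic derivations $\delta_1,\delta_2$, and let $h\in\mathcal{A}$ be positive and invertible with bounded inverse. Let $\Delta_h=h^{-1}\Delta h^{-1}$ with $\Delta=\sum_{a=1,2}\delta_a^2$ be the conformally rescaled Laplace operator on $\mathcal{H}=L^2(\mathbb{T}^2_\theta,\tau)$, and for $V^a,W^a\in\mathbb{C}$ let $V_h=\sum_{a=1,2}V^ah\,\delta_a h^{-1}$ and $W_h=\sum_{a=1,2}W^ah\,\delta_a h^{-1}$. Then the metric functional reads $$\mathcal{g}^{\Delta_h}(V_h,W_h)=\mathcal{W}\left(V_hW_h\Delta_h^{-2}\right)=\pi\,\tau(h^4)\,V^aW^b\delta_{ab},$$ whereas the spectral Einstein functional and its density vanish identically, $$\mathcal{G}^{\Delta_h}(V_h,W_h)=\mathcal{W}\left(V_hW_h\Delta_h^{-1}\right)=0.$$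
   Context: $\mathbb{T}^2_\theta$ has unitary generators $U_1,U_2$ with $U_1U_2=e^{2\pi i\theta}U_2U_1$; $\mathcal{A}$ consists of the series $\sum a_{\alpha}U_1^{\alpha_1}U_2^{\alpha_2}$ with rapidly decreasing coefficients, $\tau$ picks the coefficient at $\alpha=0$, and $\mathcal{H}$ is the GNS space of $\tau$. The derivations $\delta_a$, with $\delta_a(U_b)=\delta_{ab}U_b$, are implemented as densely defined selfadjoint operators on $\mathcal{H}$; expressions such as $h\,\delta_a h^{-1}$ and $h^{-1}\Delta h^{-1}$ denote compositions of operators, elements of $\mathcal{A}$ acting by left multiplication. In Connes' pseudodifferential calculus on $\mathbb{T}^n_\theta$ (here $n=2$), symbols are $\mathcal{A}$-valued functions of $\xi\in\mathbb{R}^n$, $\delta_a$ has symbol $\xi_a$, $b\in\mathcal{A}$ has symbol $b$, and $\sigma(PQ)=\sum_\beta\frac{1}{\beta!}\partial_\xi^\beta\sigma(P)\,\delta^\beta\sigma(Q)$. The Wodzicki residue is $\mathcal{W}(P)=\tau\big(\int_{\|\xi\|=1}\sigma_{-n}(P)(\xi)\,d\xi\big)$, where $\sigma_{-n}(P)$ is the homogeneous component of order $-n$ of the symbol and $d\xi$ is the standard measure on the unit sphere; the density of the functional is the $\mathcal{A}$-valued integral $\int_{\|\xi\|=1}\sigma_{-n}(P)(\xi)\,d\xi$. Inverses of Laplace operators are understood up to the finite-dimensional kernel. *)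

theory Defs
  imports "HOL-Analysis.Analysis"
begin

section \<open>The noncommutative 2-torus\<close>

text \<open>
  A series \<open>\<Sum>\<alpha>. a \<alpha> U\<^sub>1^(\<alpha>$1) U\<^sub>2^(\<alpha>$2)\<close> is represented by its coefficient function \<open>a\<close>. The GNS space
  of the trace is then \<open>\<ell>\<^sup>2(\<int>\<^sup>2)\<close>, the monomials \<open>U\<^sub>1^(\<alpha>$1) U\<^sub>2^(\<alpha>$2)\<close> being an orthonormal basis.
\<close>

type_synonym nct = "int^2 \<Rightarrow> complex"

definition lattice_pt :: "int^2 \<Rightarrow> real^2" where
  "lattice_pt \<alpha> = (\<chi> a. real_of_int (\<alpha> $ a))"

text \<open>\<open>seminorm_le k a C\<close>: the \<open>k\<close>-th of the seminorms defining the Frechet topology of the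
  smooth algebra is at most \<open>C\<close> at \<open>a\<close>.\<close>

definition seminorm_le :: "nat \<Rightarrow> nct \<Rightarrow> real \<Rightarrow> bool" where
  "seminorm_le k a C \<longleftrightarrow> (\<forall>\<alpha>. (1 + norm (lattice_pt \<alpha>)) ^ k * cmod (a \<alpha>) \<le> C)"

definition nct_smooth :: "nct set" where
  "nct_smooth = {a. \<forall>k. \<exists>C. seminorm_le k a C}"

definition nct_U :: "int^2 \<Rightarrow> nct" where
  "nct_U \<alpha> = (\<lambda>\<beta>. if \<beta> = \<alpha> then 1 else 0)"

text \<open>The phase comes from reordering \<open>U\<^sub>2^m U\<^sub>1^n = exp (- 2 \<pi> \<i> \<theta> m n) U\<^sub>1^n U\<^sub>2^m\<close>. The same formula
  gives the product in the smooth algebra and its left action on the Hilbert space.\<close>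

definition nct_mult :: "real \<Rightarrow> nct \<Rightarrow> nct \<Rightarrow> nct" where
  "nct_mult \<theta> a f = (\<lambda>\<gamma>. \<Sum>\<^sub>\<infinity>\<alpha>. a \<alpha> * f (\<gamma> - \<alpha>) *
     cis (- 2 * pi * \<theta> * real_of_int (\<alpha> $ 2) * real_of_int ((\<gamma> - \<alpha>) $ 1)))"

definition nct_tau :: "nct \<Rightarrow> complex" where
  "nct_tau a = a 0"

lemma nct_mult_U:
  "nct_mult \<theta> (nct_U \<alpha>) (nct_U \<beta>) =
     (\<lambda>\<gamma>. cis (- 2 * pi * \<theta> * real_of_int (\<alpha> $ 2) * real_of_int (\<beta> $ 1)) * nct_U (\<alpha> + \<beta>) \<gamma>)"
proof
  fix \<gamma>
  let ?g = "\<lambda>x. nct_U \<alpha> x * nct_U \<beta> (\<gamma> - x) *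
     cis (- 2 * pi * \<theta> * real_of_int (x $ 2) * real_of_int ((\<gamma> - x) $ 1))"
  have "nct_mult \<theta> (nct_U \<alpha>) (nct_U \<beta>) \<gamma> = infsum ?g UNIV"
    by (simp only: nct_mult_def)
  also have "\<dots> = infsum ?g {\<alpha>}"
    by (rule infsum_cong_neutral) (auto simp: nct_U_def)
  also have "\<dots> = ?g \<alpha>" by simp
  also have "\<dots> = cis (- 2 * pi * \<theta> * real_of_int (\<alpha> $ 2) * real_of_int (\<beta> $ 1)) * nct_U (\<alpha> + \<beta>) \<gamma>"
    by (auto simp: nct_U_def algebra_simps)
  finally show "nct_mult \<theta> (nct_U \<alpha>) (nct_U \<beta>) \<gamma> =
    cis (- 2 * pi * \<theta> * real_of_int (\<alpha> $ 2) * real_of_int (\<beta> $ 1)) * nct_U (\<alpha> + \<beta>) \<gamma>" .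
qed

lemma nct_commutation:
  "nct_mult \<theta> (nct_U (axis 1 1)) (nct_U (axis 2 1)) =
     (\<lambda>\<gamma>. cis (2 * pi * \<theta>) * nct_mult \<theta> (nct_U (axis 2 1)) (nct_U (axis 1 1)) \<gamma>)"
  by (simp add: nct_mult_U axis_def add.commute cis_mult flip: mult.assoc)

definition l2 :: "nct set" where
  "l2 = {f. (\<lambda>\<alpha>. (cmod (f \<alpha>))\<^sup>2) summable_on UNIV}"

definition l2_inner :: "nct \<Rightarrow> nct \<Rightarrow> complex" where
  "l2_inner f g = (\<Sum>\<^sub>\<infinity>\<alpha>. cnj (f \<alpha>) * g \<alpha>)"

definition l2_norm :: "nct \<Rightarrow> real" where
  "l2_norm f = sqrt (\<Sum>\<^sub>\<infinity>\<alpha>. (cmod (f \<alpha>))\<^sup>2)"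

definition nct_positive :: "real \<Rightarrow> nct \<Rightarrow> bool" where
  "nct_positive \<theta> h \<longleftrightarrow> (\<forall>f\<in>l2. l2_inner f (nct_mult \<theta> h f) \<in> \<real>\<^sub>\<ge>\<^sub>0)"

definition nct_boundedly_invertible :: "real \<Rightarrow> nct \<Rightarrow> bool" where
  "nct_boundedly_invertible \<theta> h \<longleftrightarrow> (\<exists>T C. \<forall>f\<in>l2. T f \<in> l2 \<and> nct_mult \<theta> h (T f) = f \<and>
     T (nct_mult \<theta> h f) = f \<and> l2_norm (T f) \<le> C * l2_norm f)"


section \<open>Unbounded operators on the Hilbert space\<close>

text \<open>An operator on \<open>l2\<close> is a partial map whose domain is its domain of definition, so that
  \<open>S \<circ>\<^sub>m T\<close> is the composition with its natural domain \<open>{f \<in> dom T. T f \<in> dom S}\<close>.\<close>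

type_synonym nct_op = "nct \<Rightarrow> nct option"

definition op_mult :: "real \<Rightarrow> nct \<Rightarrow> nct_op" where
  "op_mult \<theta> a f = (if f \<in> l2 then Some (nct_mult \<theta> a f) else None)"

definition op_mult_inv :: "real \<Rightarrow> nct \<Rightarrow> nct_op" where
  "op_mult_inv \<theta> h f =
     (if f \<in> l2 then Some (THE g. g \<in> l2 \<and> nct_mult \<theta> h g = f) else None)"

definition op_delta :: "2 \<Rightarrow> nct_op" where
  "op_delta a f =
     (let g = (\<lambda>\<alpha>. of_int (\<alpha> $ a) * f \<alpha>) in if f \<in> l2 \<and> g \<in> l2 then Some g else None)"

definition op_lincomb :: "(2 \<Rightarrow> complex) \<Rightarrow> (2 \<Rightarrow> nct_op) \<Rightarrow> nct_op" where
  "op_lincomb c T f = (if \<forall>a. f \<in> dom (T a)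
     then Some (\<lambda>\<alpha>. \<Sum>a\<in>UNIV. c a * the (T a f) \<alpha>) else None)"

definition op_ker :: "nct_op \<Rightarrow> nct set" where
  "op_ker T = {f. T f = Some (\<lambda>_. 0)}"

text \<open>For a selfadjoint \<open>L\<close> with closed range: the inverse of \<open>L\<close> on the orthogonal complement of
  its kernel, extended by zero on the kernel.\<close>

definition op_inverse_mod_kernel :: "nct_op \<Rightarrow> nct_op" where
  "op_inverse_mod_kernel L y =
     (let Q = (\<lambda>x. x \<in> dom L \<and> (\<forall>z\<in>op_ker L. l2_inner z x = 0) \<and>
                   (\<lambda>\<alpha>. y \<alpha> - the (L x) \<alpha>) \<in> op_ker L)
      in if \<exists>x. Q x then Some (THE x. Q x) else None)"

definition laplacian :: nct_op where
  "laplacian = op_lincomb (\<lambda>_. 1) (\<lambda>a. op_delta a \<circ>\<^sub>m op_delta a)"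

definition conformal_laplacian :: "real \<Rightarrow> nct \<Rightarrow> nct_op" where
  "conformal_laplacian \<theta> h = op_mult_inv \<theta> h \<circ>\<^sub>m laplacian \<circ>\<^sub>m op_mult_inv \<theta> h"

definition conformal_field :: "real \<Rightarrow> nct \<Rightarrow> complex^2 \<Rightarrow> nct_op" where
  "conformal_field \<theta> h V =
     op_lincomb (\<lambda>a. V $ a) (\<lambda>a. op_mult \<theta> h \<circ>\<^sub>m op_delta a \<circ>\<^sub>m op_mult_inv \<theta> h)"


section \<open>Pseudodifferential calculus\<close>

text \<open>\<open>smooth_derivs S F\<close>: \<open>F 0\<close> is a smooth map from the open set \<open>S\<close> to the Frechet space
  \<open>nct_smooth\<close>, and \<open>F \<beta>\<close> is its partial derivative of multi-index \<open>\<beta>\<close>.\<close>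

definition smooth_derivs :: "(real^2) set \<Rightarrow> (nat^2 \<Rightarrow> real^2 \<Rightarrow> nct) \<Rightarrow> bool" where
  "smooth_derivs S F \<longleftrightarrow> (\<forall>\<beta>. \<forall>\<xi>\<in>S. F \<beta> \<xi> \<in> nct_smooth \<and>
     (\<forall>k. \<forall>\<epsilon>>0. \<forall>\<^sub>F \<eta> in at \<xi>. seminorm_le k
        (\<lambda>\<alpha>. F \<beta> \<eta> \<alpha> - F \<beta> \<xi> \<alpha> - (\<Sum>a\<in>UNIV. of_real ((\<eta> - \<xi>) $ a) * F (\<beta> + axis a 1) \<xi> \<alpha>))
        (\<epsilon> * norm (\<eta> - \<xi>))))"

text \<open>\<open>classical_symbol m \<sigma> s\<close>: \<open>\<sigma>\<close> is a classical symbol of order \<open>m\<close> whose homogeneous component of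
  order \<open>k\<close> is \<open>s k\<close> (with no condition on \<open>s k 0\<close>). The case \<open>N = 0\<close> of the last clause is the
  symbol estimate of order \<open>m\<close> outside the unit disc; inside, it follows from smoothness.\<close>

definition classical_symbol ::
    "int \<Rightarrow> (real^2 \<Rightarrow> nct) \<Rightarrow> (int \<Rightarrow> real^2 \<Rightarrow> nct) \<Rightarrow> bool" where
  "classical_symbol m \<sigma> s \<longleftrightarrow> (\<exists>F G.
     F 0 = \<sigma> \<and> smooth_derivs UNIV F \<and>
     (\<forall>k. G k 0 = s k \<and> smooth_derivs (- {0}) (G k)) \<and>
     (\<forall>k t \<xi> \<alpha>. t > 0 \<longrightarrow> \<xi> \<noteq> 0 \<longrightarrow> s k (t *\<^sub>R \<xi>) \<alpha> = of_real (t powi k) * s k \<xi> \<alpha>) \<and>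
     (\<forall>k \<xi>. k > m \<longrightarrow> \<xi> \<noteq> 0 \<longrightarrow> s k \<xi> = (\<lambda>_. 0)) \<and>
     (\<forall>N \<beta> q. \<exists>C. \<forall>\<xi>. norm \<xi> \<ge> 1 \<longrightarrow>
        seminorm_le q (\<lambda>\<alpha>. F \<beta> \<xi> \<alpha> - (\<Sum>j<N. G (m - int j) \<beta> \<xi> \<alpha>))
          (C * norm \<xi> powi (m - int N - int (\<Sum>a\<in>UNIV. \<beta> $ a)))))"

text \<open>Connes' operator \<open>P\<^sub>\<sigma> a = (2 \<pi>)\<^sup>-\<^sup>2 \<integral>\<integral> exp (- \<i> s \<bullet> \<xi>) \<sigma>(\<xi>) \<alpha>\<^sub>s(a) ds d\<xi>\<close>, where \<open>\<alpha>\<^sub>s\<close> is the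
  action of the torus. As \<open>\<alpha>\<^sub>s(U^\<alpha>) = exp (\<i> s \<bullet> \<alpha>) U^\<alpha>\<close>, it maps \<open>U^\<alpha>\<close> to \<open>\<sigma>(\<alpha>) U^\<alpha>\<close>.\<close>

definition quantize :: "real \<Rightarrow> (real^2 \<Rightarrow> nct) \<Rightarrow> nct \<Rightarrow> nct" where
  "quantize \<theta> \<sigma> a =
     (\<lambda>\<gamma>. \<Sum>\<^sub>\<infinity>\<alpha>. a \<alpha> * nct_mult \<theta> (\<sigma> (lattice_pt \<alpha>)) (nct_U \<alpha>) \<gamma>)"

definition has_homogeneous_components ::
    "real \<Rightarrow> nct_op \<Rightarrow> (int \<Rightarrow> real^2 \<Rightarrow> nct) \<Rightarrow> bool" where
  "has_homogeneous_components \<theta> P s \<longleftrightarrow>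
     (\<exists>m \<sigma>. classical_symbol m \<sigma> s \<and> (\<forall>a\<in>nct_smooth. P a = Some (quantize \<theta> \<sigma> a)))"

text \<open>The operator determines its symbol only at lattice points, but this determines the
  homogeneous components away from the origin: rational directions are dense. So the choice is
  immaterial there.\<close>

definition homogeneous_component :: "real \<Rightarrow> nct_op \<Rightarrow> int \<Rightarrow> real^2 \<Rightarrow> nct" where
  "homogeneous_component \<theta> P = (SOME s. has_homogeneous_components \<theta> P s)"

text \<open>The integral is over the unit circle with respect to arc length, taken coefficientwise.\<close>

definition residue_density :: "real \<Rightarrow> nct_op \<Rightarrow> nct" where
  "residue_density \<theta> P =
     (\<lambda>\<alpha>. integral {0..2*pi} (\<lambda>t. homogeneous_component \<theta> P (-2) (vector [cos t, sin t]) \<alpha>))"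

definition wodzicki_residue :: "real \<Rightarrow> nct_op \<Rightarrow> complex" where
  "wodzicki_residue \<theta> P = nct_tau (residue_density \<theta> P)"

definition metric_functional :: "real \<Rightarrow> nct_op \<Rightarrow> nct_op \<Rightarrow> nct_op \<Rightarrow> complex" where
  "metric_functional \<theta> L V W = wodzicki_residue \<theta>
     (V \<circ>\<^sub>m W \<circ>\<^sub>m op_inverse_mod_kernel L \<circ>\<^sub>m op_inverse_mod_kernel L)"

definition einstein_functional :: "real \<Rightarrow> nct_op \<Rightarrow> nct_op \<Rightarrow> nct_op \<Rightarrow> complex" where
  "einstein_functional \<theta> L V W = wodzicki_residue \<theta> (V \<circ>\<^sub>m W \<circ>\<^sub>m op_inverse_mod_kernel L)"

definition einstein_density :: "real \<Rightarrow> nct_op \<Rightarrow> nct_op \<Rightarrow> nct_op \<Rightarrow> nct" where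
  "einstein_density \<theta> L V W = residue_density \<theta> (V \<circ>\<^sub>m W \<circ>\<^sub>m op_inverse_mod_kernel L)"

end

theory Submission
  imports Defs
begin

text \<open>Formally, \<open>\<Delta>\<^sub>h\<inverse> = h \<Delta>\<inverse> h\<close> and \<open>V\<^sub>h W\<^sub>h = h (V \<bullet> \<delta>) (W \<bullet> \<delta>) h\<inverse>\<close>, so that the inner factors cancel:
  \<open>V\<^sub>h W\<^sub>h \<Delta>\<^sub>h\<inverse> = h m(D) h\<close> and \<open>V\<^sub>h W\<^sub>h \<Delta>\<^sub>h\<^sup>-\<^sup>2 = h m(D) h\<^sup>2 \<Delta>\<inverse> h\<close>, where \<open>m(D)\<close> is the Fourier multiplier
  by \<open>m(\<xi>) = (V \<bullet> \<xi>) (W \<bullet> \<xi>) / \<parallel>\<xi>\<parallel>\<^sup>2\<close>, a function of degree zero. The second operator has order \<open>- 2\<close>, so its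
  residue only sees the product \<open>m(\<xi>) h\<^sup>4 / \<parallel>\<xi>\<parallel>\<^sup>2\<close> of the leading parts, and the integral of \<open>m\<close> over the
  unit circle is \<open>\<pi>\<close> times \<open>V \<bullet> W\<close>. The first operator has order zero, and its component of order \<open>- 2\<close> is
  \<open>h\<close> times the sum of \<open>\<partial>^\<beta> m(\<xi>) \<delta>^\<beta> h / \<beta>!\<close> over the multi-indices \<open>\<beta>\<close> of length two. The second derivatives of
  \<open>m\<close> are first derivatives of functions of degree \<open>- 1\<close>, and in dimension two such derivatives integrate
  to zero over the unit circle (lemma \<open>circle_integral_derivative\<close>); hence the density vanishes before
  any trace is taken.

  Two points make this rigorous. The first is the kernel of \<open>\<Delta>\<^sub>h\<close>, which is spanned by \<open>h\<close>. The inverse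
  modulo this kernel differs from \<open>h \<Delta>\<inverse> h\<close> by operators of the form \<open>y \<mapsto> \<tau>(b y) c\<close>. The projection onto the
  zero mode is the Fourier multiplier by a cutoff function \<open>\<psi>\<close> that is \<open>1\<close> at the origin and \<open>0\<close> at all other
  lattice points, so these corrections are again words in left multiplications and Fourier
  multipliers (lemma \<open>op_inverse_smooth\<close>), and since \<open>\<psi>\<close> has compact support they do not contribute to any
  homogeneous component. When the operators are applied to smooth elements, the factor \<open>h\<inverse>\<close> only meets
  elements of the form \<open>h u\<close> with \<open>u\<close> smooth, where it gives back \<open>u\<close>.

  The second point is the symbol calculus for such words. A left multiplication acts on symbols by left
  multiplication. A Fourier multiplier \<open>p\<close> acts on them exactly, by multiplying the coefficient at the
  mode \<open>\<gamma>\<close> with \<open>p (\<xi> + \<gamma>)\<close>; the Taylor expansion in \<open>\<gamma>\<close> then gives the asymptotic expansion, with errors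
  that grow polynomially in \<open>\<gamma>\<close> and are absorbed by the rapid decay of the coefficients
  (lemmas \<open>tempered_taylor_rest\<close> and \<open>expansion_fourier\<close>). Finally, the homogeneous components do not
  depend on the symbol chosen for the operator (lemma \<open>homogeneous_components_unique\<close>), so the residue may
  be read off from the symbols computed in this way.\<close>

section \<open>The smooth algebra\<close>

text \<open>The seminorms of the smooth algebra weigh the coefficient at \<open>\<alpha>\<close> with the powers of this
  number. It is submultiplicative (lemma \<open>weight_le_mult\<close>), which is why products of smooth elements
  are smooth.\<close>

definition weight :: "int^2 \<Rightarrow> real" where
  "weight \<alpha> = 1 + norm (lattice_pt \<alpha>)"

lemma lattice_pt_add: "lattice_pt (\<alpha> + \<beta>) = lattice_pt \<alpha> + lattice_pt \<beta>"
  by (simp add: lattice_pt_def vec_eq_iff)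

lemma lattice_pt_zero [simp]: "lattice_pt 0 = 0"
  by (simp add: lattice_pt_def vec_eq_iff)

lemma lattice_pt_nth [simp]: "lattice_pt \<alpha> $ a = real_of_int (\<alpha> $ a)"
  by (simp add: lattice_pt_def)

lemma norm_lattice_pt_ge_1:
  assumes "\<alpha> \<noteq> 0"
  shows "norm (lattice_pt \<alpha>) \<ge> 1"
proof -
  obtain a where "\<alpha> $ a \<noteq> 0"
    using assms by (auto simp: vec_eq_iff)
  then have "1 \<le> \<bar>lattice_pt \<alpha> $ a\<bar>" by simp
  also have "\<dots> \<le> norm (lattice_pt \<alpha>)" by (rule component_le_norm_cart)
  finally show ?thesis .
qed

lemma weight_ge_1: "weight \<alpha> \<ge> 1"
  by (simp add: weight_def)

lemma weight_pos [simp]: "weight \<alpha> > 0"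
  using weight_ge_1[of \<alpha>] by linarith

lemma weight_nonzero [simp]: "weight \<alpha> \<noteq> 0"
  using weight_pos[of \<alpha>] by linarith

lemma weight_le_mult: "weight \<gamma> \<le> weight \<alpha> * weight (\<gamma> - \<alpha>)"
proof -
  have "norm (lattice_pt \<gamma>) \<le> norm (lattice_pt \<alpha>) + norm (lattice_pt (\<gamma> - \<alpha>))"
    using lattice_pt_add[of \<alpha> "\<gamma> - \<alpha>"] norm_triangle_ineq[of "lattice_pt \<alpha>" "lattice_pt (\<gamma> - \<alpha>)"] by simp
  then show ?thesis
    unfolding weight_def by (smt (verit) mult_nonneg_nonneg norm_ge_zero ring_class.ring_distribs(2) distrib_left mult_cancel_left2 mult_cancel_right2)
qed

lemma summable_on_int_inverse_square: "(\<lambda>n::int. 1 / (1 + \<bar>real_of_int n\<bar>)\<^sup>2) summable_on UNIV"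
proof -
  let ?u = "\<lambda>n::int. 1 / (1 + \<bar>real_of_int n\<bar>)\<^sup>2"
  have "summable (\<lambda>n. inverse (real (Suc n) ^ 2))"
    by (subst summable_Suc_iff) (rule inverse_power_summable, simp)
  then have nat: "(\<lambda>n. ?u (int n)) summable_on UNIV" "(\<lambda>n. ?u (- int n)) summable_on UNIV"
    by (intro norm_summable_imp_summable_on; simp add: inverse_eq_divide)+
  have "?u summable_on range int" "?u summable_on range (\<lambda>n. - int n)"
    using nat by (subst summable_on_reindex; auto simp: inj_on_def o_def)+
  moreover have "(UNIV :: int set) = range int \<union> range (\<lambda>n. - int n)"
    by (metis (no_types, lifting) UNIV_I UnCI int_cases2 rangeI subsetI subset_antisym top_greatest)
  ultimately show ?thesis
    by (metis summable_on_union)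
qed

lemma summable_on_weight: "(\<lambda>\<alpha>. 1 / weight \<alpha> ^ 4) summable_on UNIV"
proof -
  let ?u = "\<lambda>n::int. 1 / (1 + \<bar>real_of_int n\<bar>)\<^sup>2"
  have "(\<lambda>(m, n). ?u m * ?u n) summable_on (UNIV \<times> UNIV)"
  proof (rule summable_on_SigmaI)
    fix m
    show "((\<lambda>n. case (m, n) of (m, n) \<Rightarrow> ?u m * ?u n) has_sum ?u m * infsum ?u UNIV) UNIV"
      unfolding prod.case by (intro has_sum_cmult_right has_sum_infsum summable_on_int_inverse_square)
  next
    show "(\<lambda>m. ?u m * infsum ?u UNIV) summable_on UNIV"
      by (intro summable_on_cmult_left summable_on_int_inverse_square)
  qed auto
  moreover have "bij_betw (\<lambda>\<alpha>::int^2. (\<alpha> $ 1, \<alpha> $ 2)) UNIV (UNIV \<times> UNIV)"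
    by (rule bij_betw_byWitness[where f' = "\<lambda>(m, n). vector [m, n]"])
       (auto simp: vec_eq_iff forall_2)
  ultimately have s: "(\<lambda>\<alpha>. ?u (\<alpha> $ 1) * ?u (\<alpha> $ 2)) summable_on (UNIV :: (int^2) set)"
    using summable_on_reindex_bij_betw[of "\<lambda>\<alpha>::int^2. (\<alpha> $ 1, \<alpha> $ 2)" UNIV "UNIV \<times> UNIV" "\<lambda>(m, n). ?u m * ?u n"]
    by simp
  show ?thesis
  proof (rule summable_on_comparison_test[OF s])
    fix \<alpha>
    have le: "1 + \<bar>real_of_int (\<alpha> $ a)\<bar> \<le> weight \<alpha>" for a
      using component_le_norm_cart[of "lattice_pt \<alpha>" a] by (simp add: weight_def)
    have "(1 + \<bar>real_of_int (\<alpha> $ 1)\<bar>)\<^sup>2 * (1 + \<bar>real_of_int (\<alpha> $ 2)\<bar>)\<^sup>2 \<le> (weight \<alpha>)\<^sup>2 * (weight \<alpha>)\<^sup>2"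
      by (intro mult_mono power_mono le) auto
    then show "1 / weight \<alpha> ^ 4 \<le> ?u (\<alpha> $ 1) * ?u (\<alpha> $ 2)"
      unfolding times_divide_times_eq mult_1_right
      by (intro divide_left_mono mult_pos_pos zero_less_power) (simp_all add: power_add[symmetric] add_pos_nonneg)
  qed simp
qed

lemma seminorm_le_weight: "seminorm_le k a C \<longleftrightarrow> (\<forall>\<alpha>. weight \<alpha> ^ k * cmod (a \<alpha>) \<le> C)"
  by (simp add: seminorm_le_def weight_def)

lemma seminorm_le_iff: "seminorm_le k a C \<longleftrightarrow> (\<forall>\<alpha>. cmod (a \<alpha>) \<le> C / weight \<alpha> ^ k)"
  by (simp add: seminorm_le_weight pos_le_divide_eq mult.commute)

lemma seminorm_le_mono: "seminorm_le k a C \<Longrightarrow> C \<le> D \<Longrightarrow> seminorm_le k a D"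
  unfolding seminorm_le_def using order_trans by blast

lemma seminorm_le_nonneg:
  assumes "seminorm_le k a C"
  shows "C \<ge> 0"
proof -
  have "0 \<le> weight 0 ^ k * cmod (a 0)" by (simp add: less_imp_le)
  also have "\<dots> \<le> C" using assms by (simp add: seminorm_le_weight)
  finally show ?thesis .
qed

lemma seminorm_le_add:
  "seminorm_le k a C \<Longrightarrow> seminorm_le k b D \<Longrightarrow> seminorm_le k (\<lambda>\<alpha>. a \<alpha> + b \<alpha>) (C + D)"
  unfolding seminorm_le_iff add_divide_distrib by (meson add_mono norm_triangle_ineq order_trans)

lemma seminorm_le_scale: "seminorm_le k a C \<Longrightarrow> seminorm_le k (\<lambda>\<alpha>. c * a \<alpha>) (cmod c * C)"
  unfolding seminorm_le_iff by (simp add: norm_mult) (metis mult_left_mono norm_ge_zero times_divide_eq_right)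

lemma seminorm_le_zero [simp]: "seminorm_le k (\<lambda>_. 0) C \<longleftrightarrow> C \<ge> 0"
  by (simp add: seminorm_le_def)

lemma nct_smooth_zero [simp]: "(\<lambda>_. 0) \<in> nct_smooth"
  by (auto simp: nct_smooth_def)

lemma nct_smooth_scale: "a \<in> nct_smooth \<Longrightarrow> (\<lambda>\<alpha>. c * a \<alpha>) \<in> nct_smooth"
  unfolding nct_smooth_def using seminorm_le_scale by blast

lemma nct_smooth_add:
  "a \<in> nct_smooth \<Longrightarrow> b \<in> nct_smooth \<Longrightarrow> (\<lambda>\<alpha>. a \<alpha> + b \<alpha>) \<in> nct_smooth"
  unfolding nct_smooth_def using seminorm_le_add by blast

lemma nct_smooth_diff:
  "a \<in> nct_smooth \<Longrightarrow> b \<in> nct_smooth \<Longrightarrow> (\<lambda>\<alpha>. a \<alpha> - b \<alpha>) \<in> nct_smooth"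
  using nct_smooth_add[of a "\<lambda>\<alpha>. - 1 * b \<alpha>"] nct_smooth_scale[of b "-1"] by simp

lemma nct_smooth_sum:
  "(\<And>i. i \<in> I \<Longrightarrow> f i \<in> nct_smooth) \<Longrightarrow> (\<lambda>\<alpha>. \<Sum>i\<in>I. f i \<alpha>) \<in> nct_smooth"
  by (induction I rule: infinite_finite_induct) (auto intro: nct_smooth_add)

text \<open>Fourier multipliers of polynomial growth preserve smoothness. This covers the derivations as well
  as the bounded multipliers.\<close>

lemma nct_smooth_pointwise_mult:
  assumes "a \<in> nct_smooth" and "\<And>\<alpha>. cmod (p \<alpha>) \<le> C * weight \<alpha> ^ n"
  shows "(\<lambda>\<alpha>. p \<alpha> * a \<alpha>) \<in> nct_smooth"
proof -
  have "\<exists>E. seminorm_le k (\<lambda>\<alpha>. p \<alpha> * a \<alpha>) E" for k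
  proof -
    obtain D where D: "seminorm_le (k + n) a D" using assms(1) by (auto simp: nct_smooth_def)
    have C: "C \<ge> 0" using assms(2)[of 0] by (smt (verit) norm_ge_zero lattice_pt_zero mult_cancel_left2 norm_zero power_one weight_def)
    have "seminorm_le k (\<lambda>\<alpha>. p \<alpha> * a \<alpha>) (C * D)"
      unfolding seminorm_le_weight
    proof
      fix \<alpha>
      have "weight \<alpha> ^ k * cmod (p \<alpha> * a \<alpha>) \<le> weight \<alpha> ^ k * ((C * weight \<alpha> ^ n) * cmod (a \<alpha>))"
        unfolding norm_mult by (intro mult_left_mono mult_right_mono assms(2)) (auto simp: less_imp_le)
      also have "\<dots> = C * (weight \<alpha> ^ (k + n) * cmod (a \<alpha>))" by (simp add: power_add)
      also have "\<dots> \<le> C * D" using D C by (intro mult_left_mono) (auto simp: seminorm_le_weight)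
      finally show "weight \<alpha> ^ k * cmod (p \<alpha> * a \<alpha>) \<le> C * D" .
    qed
    then show ?thesis ..
  qed
  then show ?thesis by (simp add: nct_smooth_def)
qed

lemma nct_smooth_U [simp]: "nct_U \<alpha> \<in> nct_smooth"
proof -
  have "seminorm_le k (nct_U \<alpha>) (weight \<alpha> ^ k)" for k
    by (auto simp: seminorm_le_weight nct_U_def less_imp_le)
  then show ?thesis by (auto simp: nct_smooth_def)
qed

lemma nct_smooth_weighted_summable:
  assumes "a \<in> nct_smooth"
  shows "(\<lambda>\<alpha>. weight \<alpha> ^ k * cmod (a \<alpha>)) summable_on UNIV"
proof -
  obtain C where C: "seminorm_le (k + 4) a C" using assms by (auto simp: nct_smooth_def)
  have s: "(\<lambda>\<alpha>. C * (1 / weight \<alpha> ^ 4)) summable_on UNIV"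
    by (intro summable_on_cmult_right summable_on_weight)
  show ?thesis
  proof (rule summable_on_comparison_test[OF s])
    fix \<alpha> show "weight \<alpha> ^ k * cmod (a \<alpha>) \<le> C * (1 / weight \<alpha> ^ 4)"
      using C[unfolded seminorm_le_weight, rule_format, of \<alpha>]
      unfolding times_divide_eq_right by (subst pos_le_divide_eq) (simp_all add: power_add mult_ac)
  qed (simp add: less_imp_le)
qed

lemma nct_smooth_abs_summable:
  assumes "a \<in> nct_smooth"
  shows "(\<lambda>\<alpha>. cmod (a \<alpha>)) summable_on UNIV"
  using nct_smooth_weighted_summable[OF assms, of 0] by simp

lemma nct_smooth_bounded: "a \<in> nct_smooth \<Longrightarrow> \<exists>C. \<forall>\<alpha>. cmod (a \<alpha>) \<le> C"
  unfolding nct_smooth_def mem_Collect_eq seminorm_le_def by (drule spec[of _ 0]) simp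

lemma nct_smooth_l2: "a \<in> nct_smooth \<Longrightarrow> a \<in> l2"
proof -
  assume a: "a \<in> nct_smooth"
  obtain C where C: "\<And>\<alpha>. cmod (a \<alpha>) \<le> C" using nct_smooth_bounded[OF a] by blast
  have "(\<lambda>\<alpha>. C * cmod (a \<alpha>)) summable_on UNIV"
    by (intro summable_on_cmult_right nct_smooth_abs_summable a)
  then show "a \<in> l2" unfolding l2_def mem_Collect_eq
    by (rule summable_on_comparison_test) (auto simp: power2_eq_square intro: mult_right_mono C)
qed

lemma l2_bounded:
  assumes "f \<in> l2"
  shows "\<exists>C. \<forall>\<alpha>. cmod (f \<alpha>) \<le> C"
proof -
  let ?S = "\<Sum>\<^sub>\<infinity>\<alpha>. (cmod (f \<alpha>))\<^sup>2"
  have "(cmod (f \<alpha>))\<^sup>2 \<le> ?S" for \<alpha>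
    using infsum_mono2[of "\<lambda>\<alpha>. (cmod (f \<alpha>))\<^sup>2" "{\<alpha>}" UNIV] assms by (simp add: l2_def)
  then have "cmod (f \<alpha>) \<le> sqrt ?S" for \<alpha> by (simp add: real_le_rsqrt)
  then show ?thesis by blast
qed

lemma nct_mult_abs_summable:
  assumes "b \<in> nct_smooth" "\<exists>C. \<forall>\<alpha>. cmod (f \<alpha>) \<le> C"
  shows "(\<lambda>\<alpha>. norm (b \<alpha> * f (\<gamma> - \<alpha>) * cis (c \<alpha>))) summable_on UNIV"
proof -
  obtain C where C: "\<And>\<alpha>. cmod (f \<alpha>) \<le> C" using assms(2) by blast
  have "(\<lambda>\<alpha>. C * cmod (b \<alpha>)) summable_on UNIV"
    by (intro summable_on_cmult_right nct_smooth_abs_summable assms)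
  then show ?thesis
    by (rule summable_on_comparison_test)
       (auto simp: norm_mult mult.commute[of "cmod (b _)"] intro: mult_right_mono C)
qed

lemma nct_mult_summable:
  assumes "b \<in> nct_smooth" "\<exists>C. \<forall>\<alpha>. cmod (f \<alpha>) \<le> C"
  shows "(\<lambda>\<alpha>. b \<alpha> * f (\<gamma> - \<alpha>) * cis (c \<alpha>)) summable_on UNIV"
  using abs_summable_summable[OF nct_mult_abs_summable[OF assms]] .

text \<open>Left multiplication by a smooth element is continuous for each seminorm separately: the weight at
  \<open>\<gamma>\<close> is at most the product of the weights at \<open>\<alpha>\<close> and \<open>\<gamma> - \<alpha>\<close>, and \<open>b\<close> is absolutely summable even after
  the first of them has been absorbed. So every estimate on a symbol passes to its left multiples.\<close>

lemma nct_mult_seminorm: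
  assumes "b \<in> nct_smooth"
  shows "\<exists>C\<ge>0. \<forall>a D. seminorm_le k a D \<longrightarrow> seminorm_le k (nct_mult \<theta> b a) (C * D)"
proof -
  let ?C = "\<Sum>\<^sub>\<infinity>\<alpha>. weight \<alpha> ^ k * cmod (b \<alpha>)"
  have "seminorm_le k (nct_mult \<theta> b a) (?C * D)" if D: "seminorm_le k a D" for a D
    unfolding seminorm_le_weight
  proof
    fix \<gamma>
    let ?t = "\<lambda>\<alpha>. b \<alpha> * a (\<gamma> - \<alpha>) * cis (- 2 * pi * \<theta> * real_of_int (\<alpha> $ 2) * real_of_int ((\<gamma> - \<alpha>) $ 1))"
    have "\<exists>C. \<forall>\<alpha>. cmod (a \<alpha>) \<le> C"
    proof (intro exI allI)
      fix \<alpha>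
      have "cmod (a \<alpha>) \<le> D / weight \<alpha> ^ k" using D by (simp add: seminorm_le_iff)
      also have "\<dots> \<le> D / 1" using weight_ge_1[of \<alpha>]
        by (intro divide_left_mono seminorm_le_nonneg[OF D] one_le_power) auto
      finally show "cmod (a \<alpha>) \<le> D" by simp
    qed
    then have s: "(\<lambda>\<alpha>. norm (?t \<alpha>)) summable_on UNIV"
      by (rule nct_mult_abs_summable[OF assms])
    have "weight \<gamma> ^ k * cmod (nct_mult \<theta> b a \<gamma>) \<le> weight \<gamma> ^ k * (\<Sum>\<^sub>\<infinity>\<alpha>. norm (?t \<alpha>))"
      unfolding nct_mult_def by (intro mult_left_mono norm_infsum_bound s) (simp add: less_imp_le)
    also have "\<dots> = (\<Sum>\<^sub>\<infinity>\<alpha>. weight \<gamma> ^ k * norm (?t \<alpha>))"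
      by (simp add: infsum_cmult_right')
    also have "\<dots> \<le> (\<Sum>\<^sub>\<infinity>\<alpha>. (weight \<alpha> ^ k * cmod (b \<alpha>)) * D)"
    proof (rule infsum_mono)
      show "(\<lambda>\<alpha>. weight \<gamma> ^ k * norm (?t \<alpha>)) summable_on UNIV"
        by (intro summable_on_cmult_right s)
      show "(\<lambda>\<alpha>. (weight \<alpha> ^ k * cmod (b \<alpha>)) * D) summable_on UNIV"
        by (intro summable_on_cmult_left nct_smooth_weighted_summable assms)
      fix \<alpha>
      have "weight \<gamma> ^ k * norm (?t \<alpha>) = weight \<gamma> ^ k * (cmod (b \<alpha>) * cmod (a (\<gamma> - \<alpha>)))"
        by (simp add: norm_mult)
      also have "\<dots> \<le> (weight \<alpha> * weight (\<gamma> - \<alpha>)) ^ k * (cmod (b \<alpha>) * cmod (a (\<gamma> - \<alpha>)))"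
        by (intro mult_right_mono power_mono weight_le_mult) (auto simp: less_imp_le)
      also have "\<dots> = (weight \<alpha> ^ k * cmod (b \<alpha>)) * (weight (\<gamma> - \<alpha>) ^ k * cmod (a (\<gamma> - \<alpha>)))"
        by (simp add: power_mult_distrib)
      also have "\<dots> \<le> (weight \<alpha> ^ k * cmod (b \<alpha>)) * D"
        using D by (intro mult_left_mono) (auto simp: seminorm_le_weight less_imp_le)
      finally show "weight \<gamma> ^ k * norm (?t \<alpha>) \<le> (weight \<alpha> ^ k * cmod (b \<alpha>)) * D" .
    qed
    also have "\<dots> = ?C * D" by (simp add: infsum_cmult_left')
    finally show "weight \<gamma> ^ k * cmod (nct_mult \<theta> b a \<gamma>) \<le> ?C * D" .
  qed
  moreover have "?C \<ge> 0" by (intro infsum_nonneg) (simp add: less_imp_le)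
  ultimately show ?thesis by blast
qed

lemma nct_smooth_mult: "b \<in> nct_smooth \<Longrightarrow> a \<in> nct_smooth \<Longrightarrow> nct_mult \<theta> b a \<in> nct_smooth"
proof -
  assume b: "b \<in> nct_smooth" and a: "a \<in> nct_smooth"
  show ?thesis unfolding nct_smooth_def
  proof (intro CollectI allI)
    fix k
    obtain D where "seminorm_le k a D" using a by (auto simp: nct_smooth_def)
    then show "\<exists>C. seminorm_le k (nct_mult \<theta> b a) C"
      using nct_mult_seminorm[OF b, of k \<theta>] by blast
  qed
qed

lemma nct_mult_lincomb:
  assumes "b \<in> nct_smooth" "\<exists>C. \<forall>\<alpha>. cmod (f \<alpha>) \<le> C" "\<exists>C. \<forall>\<alpha>. cmod (g \<alpha>) \<le> C"
  shows "nct_mult \<theta> b (\<lambda>\<alpha>. c * f \<alpha> + d * g \<alpha>) = (\<lambda>\<gamma>. c * nct_mult \<theta> b f \<gamma> + d * nct_mult \<theta> b g \<gamma>)"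
proof
  fix \<gamma> :: "int^2"
  let ?e = "\<lambda>\<alpha>. cis (- 2 * pi * \<theta> * real_of_int (\<alpha> $ 2) * real_of_int ((\<gamma> - \<alpha>) $ 1))"
  have "nct_mult \<theta> b (\<lambda>\<alpha>. c * f \<alpha> + d * g \<alpha>) \<gamma> =
      (\<Sum>\<^sub>\<infinity>\<alpha>. c * (b \<alpha> * f (\<gamma> - \<alpha>) * ?e \<alpha>) + d * (b \<alpha> * g (\<gamma> - \<alpha>) * ?e \<alpha>))"
    unfolding nct_mult_def by (intro infsum_cong) (simp add: algebra_simps)
  also have "\<dots> = c * nct_mult \<theta> b f \<gamma> + d * nct_mult \<theta> b g \<gamma>"
    unfolding nct_mult_def infsum_cmult_right'[symmetric]
    by (intro infsum_add summable_on_cmult_right nct_mult_summable assms)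
  finally show "nct_mult \<theta> b (\<lambda>\<alpha>. c * f \<alpha> + d * g \<alpha>) \<gamma> = c * nct_mult \<theta> b f \<gamma> + d * nct_mult \<theta> b g \<gamma>" .
qed

lemma nct_mult_scale: "nct_mult \<theta> b (\<lambda>\<alpha>. c * f \<alpha>) = (\<lambda>\<gamma>. c * nct_mult \<theta> b f \<gamma>)"
  unfolding nct_mult_def by (simp add: infsum_cmult_right'[symmetric] mult_ac)

lemma nct_mult_sum:
  assumes "b \<in> nct_smooth" "\<And>i. i \<in> I \<Longrightarrow> f i \<in> nct_smooth"
  shows "nct_mult \<theta> b (\<lambda>\<alpha>. \<Sum>i\<in>I. c i * f i \<alpha>) = (\<lambda>\<gamma>. \<Sum>i\<in>I. c i * nct_mult \<theta> b (f i) \<gamma>)"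
  using assms(2)
proof (induction I rule: infinite_finite_induct)
  case (insert i I)
  have "nct_mult \<theta> b (\<lambda>\<alpha>. c i * f i \<alpha> + 1 * (\<Sum>i\<in>I. c i * f i \<alpha>)) =
      (\<lambda>\<gamma>. c i * nct_mult \<theta> b (f i) \<gamma> + 1 * nct_mult \<theta> b (\<lambda>\<alpha>. \<Sum>i\<in>I. c i * f i \<alpha>) \<gamma>)"
    using insert by (intro nct_mult_lincomb assms(1) nct_smooth_bounded nct_smooth_sum nct_smooth_scale) auto
  then show ?case using insert by simp
qed (simp_all add: nct_mult_def)

text \<open>Right multiplication by a monomial only shifts the coefficients and multiplies them by phases.
  Hence an operator is recovered from its values on monomials, and symbols are compared coefficient
  by coefficient.\<close>

lemma nct_mult_U_right:
  "nct_mult \<theta> b (nct_U \<alpha>) \<gamma> = b (\<gamma> - \<alpha>) * cis (- 2 * pi * \<theta> * real_of_int ((\<gamma> - \<alpha>) $ 2) * real_of_int (\<alpha> $ 1))"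
proof -
  let ?g = "\<lambda>x. b x * nct_U \<alpha> (\<gamma> - x) * cis (- 2 * pi * \<theta> * real_of_int (x $ 2) * real_of_int ((\<gamma> - x) $ 1))"
  have "nct_mult \<theta> b (nct_U \<alpha>) \<gamma> = infsum ?g {\<gamma> - \<alpha>}"
    unfolding nct_mult_def by (rule infsum_cong_neutral) (auto simp: nct_U_def algebra_simps)
  also have "\<dots> = ?g (\<gamma> - \<alpha>)" by simp
  finally show ?thesis by (simp add: nct_U_def)
qed

lemma nct_mult_one_right [simp]: "nct_mult \<theta> b (nct_U 0) = b"
  by (rule ext) (simp add: nct_mult_U_right)

text \<open>This case of associativity suffices for the symbol calculus, because a symbol is only ever
  multiplied from the right by monomials.\<close>

lemma nct_mult_assoc_U:
  "nct_mult \<theta> b (nct_mult \<theta> x (nct_U \<alpha>)) = nct_mult \<theta> (nct_mult \<theta> b x) (nct_U \<alpha>)"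
proof
  fix \<gamma>
  show "nct_mult \<theta> b (nct_mult \<theta> x (nct_U \<alpha>)) \<gamma> = nct_mult \<theta> (nct_mult \<theta> b x) (nct_U \<alpha>) \<gamma>"
    unfolding nct_mult_U_right unfolding nct_mult_def nct_mult_U_right
    by (subst infsum_cmult_left'[symmetric], rule infsum_cong)
       (simp add: mult.assoc cis_mult algebra_simps diff_diff_eq add.commute)
qed

section \<open>Jets of functions on the plane\<close>

text \<open>The unit vectors \<open>axis a 1\<close> of the multi-indices are matched syntactically below, so the numeral
  \<open>1\<close> has to stay as it is.\<close>

declare One_nat_def [simp del]

text \<open>A jet is a function of \<open>\<xi>\<close> together with a candidate for each of its partial derivatives. Carrying
  the derivatives along makes smoothness a pointwise statement, and differentiation the shift of the
  multi-index.\<close>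

type_synonym jet = "nat^2 \<Rightarrow> real^2 \<Rightarrow> complex"

definition derivs_on :: "(real^2) set \<Rightarrow> jet \<Rightarrow> bool" where
  "derivs_on S f \<longleftrightarrow> (\<forall>\<beta>. \<forall>\<xi>\<in>S.
     (f \<beta> has_derivative (\<lambda>v. \<Sum>a\<in>UNIV. of_real (v $ a) * f (\<beta> + axis a 1) \<xi>)) (at \<xi>))"

definition shift :: "2 \<Rightarrow> jet \<Rightarrow> jet" where
  "shift a f = (\<lambda>\<beta>. f (\<beta> + axis a 1))"

definition mdeg :: "nat^2 \<Rightarrow> nat" where
  "mdeg \<beta> = (\<Sum>a\<in>UNIV. \<beta> $ a)"

lemma mdeg_0 [simp]: "mdeg 0 = 0"
  by (simp add: mdeg_def)

lemma mdeg_add_axis [simp]: "mdeg (\<beta> + axis a 1) = Suc (mdeg \<beta>)"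
  using exhaust_2[of a] by (auto simp: mdeg_def sum_2 axis_def)

lemma shift_commute: "shift a (shift b f) = shift b (shift a f)"
  by (simp add: shift_def add_ac)

lemma derivs_onD:
  "derivs_on S f \<Longrightarrow> \<xi> \<in> S \<Longrightarrow>
    (f \<beta> has_derivative (\<lambda>v. \<Sum>a\<in>UNIV. of_real (v $ a) * f (\<beta> + axis a 1) \<xi>)) (at \<xi>)"
  by (simp add: derivs_on_def)

lemma derivs_on_subset: "derivs_on S f \<Longrightarrow> T \<subseteq> S \<Longrightarrow> derivs_on T f"
  by (auto simp: derivs_on_def)

lemma derivs_on_shift: "derivs_on S f \<Longrightarrow> derivs_on S (shift a f)"
proof -
  have "\<beta> + axis b 1 + axis a 1 = \<beta> + axis a 1 + axis b 1" for \<beta> :: "nat^2" and b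
    by (simp add: add_ac)
  then show "derivs_on S f \<Longrightarrow> derivs_on S (shift a f)"
    by (simp add: derivs_on_def shift_def)
qed

lemma derivs_on_zero: "derivs_on S (\<lambda>_ _. 0)"
  by (simp add: derivs_on_def)

lemma derivs_on_add:
  "derivs_on S f \<Longrightarrow> derivs_on S g \<Longrightarrow> derivs_on S (\<lambda>\<beta> \<xi>. f \<beta> \<xi> + g \<beta> \<xi>)"
  unfolding derivs_on_def
  by (auto simp: distrib_left sum.distrib intro!: has_derivative_add)

lemma derivs_on_scale: "derivs_on S f \<Longrightarrow> derivs_on S (\<lambda>\<beta> \<xi>. c * f \<beta> \<xi>)"
  unfolding derivs_on_def
  by (auto intro!: has_derivative_eq_rhs[OF has_derivative_mult_right] simp: sum_distrib_left mult_ac)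

lemma derivs_on_diff:
  "derivs_on S f \<Longrightarrow> derivs_on S g \<Longrightarrow> derivs_on S (\<lambda>\<beta> \<xi>. f \<beta> \<xi> - g \<beta> \<xi>)"
  using derivs_on_add[of S f "\<lambda>\<beta> \<xi>. - 1 * g \<beta> \<xi>"] derivs_on_scale[of S g "-1"] by simp

lemma derivs_on_sum:
  "(\<And>i. i \<in> I \<Longrightarrow> derivs_on S (f i)) \<Longrightarrow> derivs_on S (\<lambda>\<beta> \<xi>. \<Sum>i\<in>I. f i \<beta> \<xi>)"
  by (induction I rule: infinite_finite_induct) (auto intro: derivs_on_zero derivs_on_add)

lemma derivs_on_translate:
  assumes "derivs_on UNIV f"
  shows "derivs_on S (\<lambda>\<beta> \<xi>. f \<beta> (\<xi> + v))"
  unfolding derivs_on_def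
proof (intro allI ballI)
  fix \<beta> \<xi>
  show "((\<lambda>\<xi>. f \<beta> (\<xi> + v)) has_derivative
      (\<lambda>u. \<Sum>a\<in>UNIV. of_real (u $ a) * f (\<beta> + axis a 1) (\<xi> + v))) (at \<xi>)"
    by (rule has_derivative_compose[of "\<lambda>\<xi>. \<xi> + v" "\<lambda>u. u", OF _ derivs_onD[OF assms]])
       (auto intro!: derivative_eq_intros)
qed

lemma derivs_on_continuous:
  assumes "derivs_on S f"
  shows "continuous_on S (f \<beta>)"
  by (intro continuous_at_imp_continuous_on ballI has_derivative_continuous[OF derivs_onD[OF assms]])

text \<open>The derivative of multi-index \<open>(i, j)\<close> of a product, unfolded one derivative at a time. As
  differentiation is a shift, this recursion replaces the Leibniz formula with its binomial
  coefficients, and any property that is additive and compatible with shifts passes to products by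
  induction.\<close>

fun leib :: "nat \<Rightarrow> nat \<Rightarrow> jet \<Rightarrow> jet \<Rightarrow> real^2 \<Rightarrow> complex" where
  "leib 0 0 f g \<xi> = f 0 \<xi> * g 0 \<xi>"
| "leib 0 (Suc j) f g \<xi> = leib 0 j (shift 2 f) g \<xi> + leib 0 j f (shift 2 g) \<xi>"
| "leib (Suc i) j f g \<xi> = leib i j (shift 1 f) g \<xi> + leib i j f (shift 1 g) \<xi>"

definition jet_mult :: "jet \<Rightarrow> jet \<Rightarrow> jet" where
  "jet_mult f g = (\<lambda>\<beta>. leib (\<beta> $ 1) (\<beta> $ 2) f g)"

text \<open>The recursion removes derivatives in the first direction before those in the second; since shifts
  commute, the order does not matter.\<close>

lemma leib_Suc_right:
  "leib i (Suc j) f g \<xi> = leib i j (shift 2 f) g \<xi> + leib i j f (shift 2 g) \<xi>"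
  by (induction i arbitrary: f g) (simp_all add: shift_commute[of 2 1])

lemma jet_mult_add_axis:
  "jet_mult f g (\<beta> + axis a 1) \<xi> = jet_mult (shift a f) g \<beta> \<xi> + jet_mult f (shift a g) \<beta> \<xi>"
  using exhaust_2[of a] by (auto simp: jet_mult_def axis_def leib_Suc_right Suc_eq_plus1[symmetric])

lemma jet_mult_0 [simp]: "jet_mult f g 0 \<xi> = f 0 \<xi> * g 0 \<xi>"
  by (simp add: jet_mult_def)

lemma jet_induct [case_names zero axis]:
  assumes "P 0" and "\<And>\<beta> a. P \<beta> \<Longrightarrow> P (\<beta> + axis a 1)"
  shows "P (\<beta> :: nat^2)"
proof (induction "mdeg \<beta>" arbitrary: \<beta>)
  case 0
  then have "\<beta> = 0" by (auto simp: vec_eq_iff mdeg_def)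
  then show ?case using assms(1) by simp
next
  case (Suc n)
  then obtain a where a: "\<beta> $ a \<noteq> 0" unfolding mdeg_def by (metis Zero_not_Suc sum.neutral)
  define \<beta>' where "\<beta>' = \<beta> - axis a 1"
  have eq: "\<beta> = \<beta>' + axis a 1"
    using a by (auto simp: \<beta>'_def vec_eq_iff axis_def)
  with Suc(2) have "mdeg \<beta>' = n" by simp
  then show ?case using Suc(1) assms(2) eq by simp
qed

lemma derivs_on_jet_mult:
  assumes "derivs_on S f" "derivs_on S g"
  shows "derivs_on S (jet_mult f g)"
proof -
  have "(jet_mult f g \<beta> has_derivative (\<lambda>v. \<Sum>a\<in>UNIV. of_real (v $ a) * jet_mult f g (\<beta> + axis a 1) \<xi>)) (at \<xi>)"
    if \<xi>: "\<xi> \<in> S" for \<xi> \<beta>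
    using assms
  proof (induction \<beta> arbitrary: f g rule: jet_induct)
    case zero
    have "((\<lambda>\<xi>. f 0 \<xi> * g 0 \<xi>) has_derivative
      (\<lambda>v. \<Sum>a\<in>UNIV. of_real (v $ a) * (f (axis a 1) \<xi> * g 0 \<xi> + f 0 \<xi> * g (axis a 1) \<xi>))) (at \<xi>)"
      using has_derivative_mult[OF derivs_onD[OF zero(1) \<xi>] derivs_onD[OF zero(2) \<xi>], of 0 0]
      by (rule has_derivative_eq_rhs)
         (simp add: fun_eq_iff sum_distrib_left sum_distrib_right sum.distrib algebra_simps)
    then show ?case unfolding jet_mult_add_axis by (simp add: shift_def)
  next
    case (axis \<beta> b)
    have "((\<lambda>\<xi>. jet_mult (shift b f) g \<beta> \<xi> + jet_mult f (shift b g) \<beta> \<xi>) has_derivative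
      (\<lambda>v. (\<Sum>a\<in>UNIV. of_real (v $ a) * jet_mult (shift b f) g (\<beta> + axis a 1) \<xi>)
         + (\<Sum>a\<in>UNIV. of_real (v $ a) * jet_mult f (shift b g) (\<beta> + axis a 1) \<xi>))) (at \<xi>)"
      by (intro has_derivative_add axis derivs_on_shift)
    then show ?case
      unfolding jet_mult_add_axis[symmetric, abs_def] sum.distrib[symmetric] distrib_left[symmetric]
      by (simp add: jet_mult_add_axis[symmetric] add_ac)
  qed
  then show ?thesis by (simp add: derivs_on_def)
qed

lemma jet_mult_cong:
  assumes "\<And>\<beta>. f \<beta> \<xi> = f' \<beta> \<xi>" "\<And>\<beta>. g \<beta> \<xi> = g' \<beta> \<xi>"
  shows "jet_mult f g \<beta> \<xi> = jet_mult f' g' \<beta> \<xi>"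
  using assms
proof (induction \<beta> arbitrary: f g f' g' rule: jet_induct)
  case (axis \<beta> a)
  have "jet_mult (shift a f) g \<beta> \<xi> = jet_mult (shift a f') g' \<beta> \<xi>"
       "jet_mult f (shift a g) \<beta> \<xi> = jet_mult f' (shift a g') \<beta> \<xi>"
    by (rule axis; simp add: shift_def axis)+
  then show ?case by (simp add: jet_mult_add_axis)
qed simp

lemma jet_mult_zero_left [simp]: "jet_mult (\<lambda>_ _. 0) g \<beta> \<xi> = 0"
proof (induction \<beta> arbitrary: g rule: jet_induct)
  case (axis \<beta> a)
  then show ?case by (simp add: jet_mult_add_axis shift_def)
qed simp

lemma jet_mult_add_right:
  "jet_mult f (\<lambda>\<beta> \<xi>. g \<beta> \<xi> + h \<beta> \<xi>) \<beta> \<xi> = jet_mult f g \<beta> \<xi> + jet_mult f h \<beta> \<xi>"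
proof (induction \<beta> arbitrary: f g h rule: jet_induct)
  case (axis \<beta> a)
  from axis[of "shift a f" g h] axis[of f "shift a g" "shift a h"]
  show ?case by (simp add: jet_mult_add_axis shift_def)
qed (simp add: distrib_left)

lemma jet_mult_add_left:
  "jet_mult (\<lambda>\<beta> \<xi>. g \<beta> \<xi> + h \<beta> \<xi>) f \<beta> \<xi> = jet_mult g f \<beta> \<xi> + jet_mult h f \<beta> \<xi>"
proof (induction \<beta> arbitrary: f g h rule: jet_induct)
  case (axis \<beta> a)
  from axis[of g h "shift a f"] axis[of "shift a g" "shift a h" f]
  show ?case by (simp add: jet_mult_add_axis shift_def)
qed (simp add: distrib_right)

lemma jet_mult_scale_right: "jet_mult f (\<lambda>\<beta> \<xi>. c * g \<beta> \<xi>) \<beta> \<xi> = c * jet_mult f g \<beta> \<xi>"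
proof (induction \<beta> arbitrary: f g rule: jet_induct)
  case (axis \<beta> a)
  from axis[of "shift a f" g] axis[of f "shift a g"]
  show ?case by (simp add: jet_mult_add_axis shift_def distrib_left)
qed simp

text \<open>The derivative of multi-index \<open>\<beta>\<close> is homogeneous of degree \<open>d\<close> minus the length of \<open>\<beta>\<close>.\<close>

definition homogeneous :: "int \<Rightarrow> jet \<Rightarrow> bool" where
  "homogeneous d f \<longleftrightarrow> (\<forall>\<beta> t \<xi>. t > 0 \<longrightarrow> \<xi> \<noteq> 0 \<longrightarrow>
     f \<beta> (t *\<^sub>R \<xi>) = of_real (t powi (d - int (mdeg \<beta>))) * f \<beta> \<xi>)"

lemma homogeneous_shift: "homogeneous d f \<Longrightarrow> homogeneous (d - 1) (shift a f)"
  unfolding homogeneous_def shift_def by (simp add: algebra_simps)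

lemma homogeneous_jet_mult:
  assumes "homogeneous d f" "homogeneous e g"
  shows "homogeneous (d + e) (jet_mult f g)"
proof -
  have "jet_mult f g \<beta> (t *\<^sub>R \<xi>) = of_real (t powi (d + e - int (mdeg \<beta>))) * jet_mult f g \<beta> \<xi>"
    if t: "t > 0" "\<xi> \<noteq> 0" for \<beta> t \<xi>
    using assms
  proof (induction \<beta> arbitrary: f g d e rule: jet_induct)
    case zero
    then show ?case using t by (simp add: homogeneous_def power_int_add)
  next
    case (axis \<beta> a)
    have "jet_mult (shift a f) g \<beta> (t *\<^sub>R \<xi>) = of_real (t powi (d - 1 + e - int (mdeg \<beta>))) * jet_mult (shift a f) g \<beta> \<xi>"
         "jet_mult f (shift a g) \<beta> (t *\<^sub>R \<xi>) = of_real (t powi (d + (e - 1) - int (mdeg \<beta>))) * jet_mult f (shift a g) \<beta> \<xi>"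
      by (intro axis homogeneous_shift)+
    moreover have "d - 1 + e - int (mdeg \<beta>) = d + e - int (mdeg (\<beta> + axis a 1))"
      "d + (e - 1) - int (mdeg \<beta>) = d + e - int (mdeg (\<beta> + axis a 1))" by simp_all
    ultimately show ?case unfolding jet_mult_add_axis by (simp only: distrib_left)
  qed
  then show ?thesis by (simp add: homogeneous_def)
qed

text \<open>Bounds for families of jets indexed by the Fourier mode \<open>\<gamma>\<close>. The coefficients of a symbol are rapid,
  those of a translated multiplier \<open>p (\<xi> + \<gamma>)\<close> are tempered. With \<open>w\<close> the norm on the complement of the
  unit disc these are symbol estimates of order \<open>d\<close>; with \<open>w = 1\<close> on a compact set they are local
  bounds, and one product rule serves both purposes.\<close>

definition rapid :: "(real^2) set \<Rightarrow> (real^2 \<Rightarrow> real) \<Rightarrow> int \<Rightarrow> (int^2 \<Rightarrow> jet) \<Rightarrow> bool" where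
  "rapid X w d f \<longleftrightarrow> (\<forall>\<beta> q. \<exists>C. \<forall>\<xi>\<in>X.
     seminorm_le q (\<lambda>\<gamma>. f \<gamma> \<beta> \<xi>) (C * w \<xi> powi (d - int (mdeg \<beta>))))"

definition tempered :: "(real^2) set \<Rightarrow> (real^2 \<Rightarrow> real) \<Rightarrow> int \<Rightarrow> (int^2 \<Rightarrow> jet) \<Rightarrow> bool" where
  "tempered X w d f \<longleftrightarrow> (\<forall>\<beta>. \<exists>K C. \<forall>\<xi>\<in>X. \<forall>\<gamma>.
     cmod (f \<gamma> \<beta> \<xi>) \<le> C * weight \<gamma> ^ K * w \<xi> powi (d - int (mdeg \<beta>)))"

lemma rapid_shift: "rapid X w d f \<Longrightarrow> rapid X w (d - 1) (\<lambda>\<gamma>. shift a (f \<gamma>))"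
  unfolding rapid_def shift_def
proof (intro allI)
  fix \<beta> q assume "\<forall>\<beta> q. \<exists>C. \<forall>\<xi>\<in>X. seminorm_le q (\<lambda>\<gamma>. f \<gamma> \<beta> \<xi>) (C * w \<xi> powi (d - int (mdeg \<beta>)))"
  from spec[OF spec[OF this, of "\<beta> + axis a 1"], of q]
  show "\<exists>C. \<forall>\<xi>\<in>X. seminorm_le q (\<lambda>\<gamma>. f \<gamma> (\<beta> + axis a 1) \<xi>) (C * w \<xi> powi (d - 1 - int (mdeg \<beta>)))"
    by (simp add: algebra_simps)
qed

lemma tempered_shift: "tempered X w d f \<Longrightarrow> tempered X w (d - 1) (\<lambda>\<gamma>. shift a (f \<gamma>))"
  unfolding tempered_def shift_def
proof (intro allI)
  fix \<beta> assume "\<forall>\<beta>. \<exists>K C. \<forall>\<xi>\<in>X. \<forall>\<gamma>. cmod (f \<gamma> \<beta> \<xi>) \<le> C * weight \<gamma> ^ K * w \<xi> powi (d - int (mdeg \<beta>))"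
  from spec[OF this, of "\<beta> + axis a 1"]
  show "\<exists>K C. \<forall>\<xi>\<in>X. \<forall>\<gamma>. cmod (f \<gamma> (\<beta> + axis a 1) \<xi>) \<le> C * weight \<gamma> ^ K * w \<xi> powi (d - 1 - int (mdeg \<beta>))"
    by (simp add: algebra_simps)
qed

lemma rapid_add:
  assumes "rapid X w d f" "rapid X w d g"
  shows "rapid X w d (\<lambda>\<gamma> \<beta> \<xi>. f \<gamma> \<beta> \<xi> + g \<gamma> \<beta> \<xi>)"
  unfolding rapid_def
proof (intro allI)
  fix \<beta> q
  obtain C D where "\<forall>\<xi>\<in>X. seminorm_le q (\<lambda>\<gamma>. f \<gamma> \<beta> \<xi>) (C * w \<xi> powi (d - int (mdeg \<beta>)))"
    "\<forall>\<xi>\<in>X. seminorm_le q (\<lambda>\<gamma>. g \<gamma> \<beta> \<xi>) (D * w \<xi> powi (d - int (mdeg \<beta>)))"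
    using assms unfolding rapid_def by meson
  then show "\<exists>C. \<forall>\<xi>\<in>X. seminorm_le q (\<lambda>\<gamma>. f \<gamma> \<beta> \<xi> + g \<gamma> \<beta> \<xi>) (C * w \<xi> powi (d - int (mdeg \<beta>)))"
    using seminorm_le_add by (intro exI[of _ "C + D"]) (simp add: distrib_right)
qed

lemma rapid_scale: "rapid X w d f \<Longrightarrow> rapid X w d (\<lambda>\<gamma> \<beta> \<xi>. c * f \<gamma> \<beta> \<xi>)"
  unfolding rapid_def
proof (intro allI)
  fix \<beta> q assume "\<forall>\<beta> q. \<exists>C. \<forall>\<xi>\<in>X. seminorm_le q (\<lambda>\<gamma>. f \<gamma> \<beta> \<xi>) (C * w \<xi> powi (d - int (mdeg \<beta>)))"
  then obtain C where "\<forall>\<xi>\<in>X. seminorm_le q (\<lambda>\<gamma>. f \<gamma> \<beta> \<xi>) (C * w \<xi> powi (d - int (mdeg \<beta>)))"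
    by blast
  then show "\<exists>C. \<forall>\<xi>\<in>X. seminorm_le q (\<lambda>\<gamma>. c * f \<gamma> \<beta> \<xi>) (C * w \<xi> powi (d - int (mdeg \<beta>)))"
    using seminorm_le_scale by (intro exI[of _ "cmod c * C"]) (simp add: mult.assoc)
qed

lemma rapid_zero: "rapid X w d (\<lambda>_ _ _. 0)"
  unfolding rapid_def by (intro allI exI[of _ 0]) simp

lemma rapid_diff:
  "rapid X w d f \<Longrightarrow> rapid X w d g \<Longrightarrow> rapid X w d (\<lambda>\<gamma> \<beta> \<xi>. f \<gamma> \<beta> \<xi> - g \<gamma> \<beta> \<xi>)"
  using rapid_add[of X w d f "\<lambda>\<gamma> \<beta> \<xi>. - 1 * g \<gamma> \<beta> \<xi>"] rapid_scale[of X w d g "-1"] by simp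

lemma rapid_sum:
  "(\<And>i. i \<in> I \<Longrightarrow> rapid X w d (f i)) \<Longrightarrow> rapid X w d (\<lambda>\<gamma> \<beta> \<xi>. \<Sum>i\<in>I. f i \<gamma> \<beta> \<xi>)"
  by (induction I rule: infinite_finite_induct) (auto intro: rapid_zero rapid_add)

lemma rapid_cong:
  assumes "rapid X w d f" and "\<And>\<gamma> \<beta> \<xi>. \<xi> \<in> X \<Longrightarrow> f \<gamma> \<beta> \<xi> = g \<gamma> \<beta> \<xi>"
  shows "rapid X w d g"
  using assms by (simp add: rapid_def cong: ball_cong)

lemma rapid_mono:
  assumes "rapid X w d f" "d \<le> e" "\<And>\<xi>. \<xi> \<in> X \<Longrightarrow> w \<xi> \<ge> 1"
  shows "rapid X w e f"
  unfolding rapid_def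
proof (intro allI)
  fix \<beta> q
  obtain C where C: "\<And>\<xi>. \<xi> \<in> X \<Longrightarrow> seminorm_le q (\<lambda>\<gamma>. f \<gamma> \<beta> \<xi>) (C * w \<xi> powi (d - int (mdeg \<beta>)))"
    using assms(1) unfolding rapid_def by meson
  have "seminorm_le q (\<lambda>\<gamma>. f \<gamma> \<beta> \<xi>) (\<bar>C\<bar> * w \<xi> powi (e - int (mdeg \<beta>)))" if "\<xi> \<in> X" for \<xi>
  proof (rule seminorm_le_mono[OF C[OF that]])
    have "C * w \<xi> powi (d - int (mdeg \<beta>)) \<le> \<bar>C\<bar> * w \<xi> powi (d - int (mdeg \<beta>))"
      using assms(3)[OF that] by (intro mult_right_mono) auto
    also have "\<dots> \<le> \<bar>C\<bar> * w \<xi> powi (e - int (mdeg \<beta>))"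
      using assms(2) assms(3)[OF that] by (intro mult_left_mono power_int_increasing) auto
    finally show "C * w \<xi> powi (d - int (mdeg \<beta>)) \<le> \<bar>C\<bar> * w \<xi> powi (e - int (mdeg \<beta>))" .
  qed
  then show "\<exists>C. \<forall>\<xi>\<in>X. seminorm_le q (\<lambda>\<gamma>. f \<gamma> \<beta> \<xi>) (C * w \<xi> powi (e - int (mdeg \<beta>)))" by blast
qed

text \<open>Rapid decay in \<open>\<gamma>\<close> absorbs polynomial growth, and orders add. By the Leibniz recursion only the
  case without derivatives has to be estimated.\<close>

lemma rapid_jet_mult:
  assumes "tempered X w d f" "rapid X w e g" and w: "\<And>\<xi>. \<xi> \<in> X \<Longrightarrow> w \<xi> > 0"
  shows "rapid X w (d + e) (\<lambda>\<gamma>. jet_mult (f \<gamma>) (g \<gamma>))"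
proof -
  have "\<exists>C. \<forall>\<xi>\<in>X. seminorm_le q (\<lambda>\<gamma>. jet_mult (f \<gamma>) (g \<gamma>) \<beta> \<xi>) (C * w \<xi> powi (d + e - int (mdeg \<beta>)))"
    for \<beta> q
    using assms(1,2)
  proof (induction \<beta> arbitrary: f g d e rule: jet_induct)
    case zero
    obtain K C where C: "\<And>\<xi> \<gamma>. \<xi> \<in> X \<Longrightarrow> cmod (f \<gamma> 0 \<xi>) \<le> C * weight \<gamma> ^ K * w \<xi> powi d"
      using zero(1)[unfolded tempered_def, rule_format, of 0] by auto
    obtain D where D: "\<And>\<xi>. \<xi> \<in> X \<Longrightarrow> seminorm_le (K + q) (\<lambda>\<gamma>. g \<gamma> 0 \<xi>) (D * w \<xi> powi e)"
      using zero(2)[unfolded rapid_def, rule_format, of "K + q" 0] by auto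
    have "seminorm_le q (\<lambda>\<gamma>. f \<gamma> 0 \<xi> * g \<gamma> 0 \<xi>) (\<bar>C\<bar> * D * w \<xi> powi (d + e))" if \<xi>: "\<xi> \<in> X" for \<xi>
      unfolding seminorm_le_weight
    proof
      fix \<gamma>
      have "cmod (f \<gamma> 0 \<xi>) \<le> \<bar>C\<bar> * weight \<gamma> ^ K * w \<xi> powi d"
        by (rule order_trans[OF C[OF \<xi>]]) (intro mult_right_mono, auto simp: less_imp_le w \<xi>)
      then have "weight \<gamma> ^ q * cmod (f \<gamma> 0 \<xi> * g \<gamma> 0 \<xi>)
          \<le> weight \<gamma> ^ q * ((\<bar>C\<bar> * weight \<gamma> ^ K * w \<xi> powi d) * cmod (g \<gamma> 0 \<xi>))"
        unfolding norm_mult by (intro mult_left_mono mult_right_mono) (auto simp: less_imp_le)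
      also have "\<dots> = \<bar>C\<bar> * w \<xi> powi d * (weight \<gamma> ^ (K + q) * cmod (g \<gamma> 0 \<xi>))"
        by (simp add: power_add)
      also have "\<dots> \<le> \<bar>C\<bar> * w \<xi> powi d * (D * w \<xi> powi e)"
        using D[OF \<xi>] w[OF \<xi>] by (intro mult_left_mono) (auto simp: seminorm_le_weight less_imp_le)
      also have "\<dots> = \<bar>C\<bar> * D * w \<xi> powi (d + e)"
        using w[OF \<xi>] by (simp add: power_int_add)
      finally show "weight \<gamma> ^ q * cmod (f \<gamma> 0 \<xi> * g \<gamma> 0 \<xi>) \<le> \<bar>C\<bar> * D * w \<xi> powi (d + e)" .
    qed
    then show ?case by auto
  next
    case (axis \<beta> a)
    have eq: "d - 1 + e - int (mdeg \<beta>) = d + e - int (mdeg (\<beta> + axis a 1))"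
      "d + (e - 1) - int (mdeg \<beta>) = d + e - int (mdeg (\<beta> + axis a 1))" by simp_all
    obtain C D where
      "\<forall>\<xi>\<in>X. seminorm_le q (\<lambda>\<gamma>. jet_mult (shift a (f \<gamma>)) (g \<gamma>) \<beta> \<xi>) (C * w \<xi> powi (d - 1 + e - int (mdeg \<beta>)))"
      "\<forall>\<xi>\<in>X. seminorm_le q (\<lambda>\<gamma>. jet_mult (f \<gamma>) (shift a (g \<gamma>)) \<beta> \<xi>) (D * w \<xi> powi (d + (e - 1) - int (mdeg \<beta>)))"
      using axis(1)[OF tempered_shift[OF axis(2)] axis(3), of a]
        axis(1)[OF axis(2) rapid_shift[OF axis(3)], of a] by blast
    then show ?case
      unfolding jet_mult_add_axis eq
      by (intro exI[of _ "C + D"]) (auto simp only: distrib_right intro!: seminorm_le_add)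
  qed
  then show ?thesis by (simp add: rapid_def)
qed

lemma bounded_linear_jet: "bounded_linear (\<lambda>v::real^2. \<Sum>a\<in>UNIV. of_real (v $ a) * (c a :: complex))"
  by (intro bounded_linear_sum bounded_linear_mult_left[THEN bounded_linear_compose]
        bounded_linear_of_real[THEN bounded_linear_compose] bounded_linear_vec_nth)

lemma norm_jet_le:
  "cmod (\<Sum>a\<in>UNIV. of_real ((v::real^2) $ a) * c a) \<le> (\<Sum>a\<in>UNIV. cmod (c a)) * norm v"
proof -
  have "cmod (\<Sum>a\<in>UNIV. of_real (v $ a) * c a) \<le> (\<Sum>a\<in>UNIV. cmod (of_real (v $ a) * c a))"
    by (rule norm_sum)
  also have "\<dots> \<le> (\<Sum>a\<in>UNIV. cmod (c a) * norm v)"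
    by (intro sum_mono) (simp add: norm_mult mult.commute[of "cmod _"] mult_right_mono component_le_norm_cart)
  finally show ?thesis by (simp add: sum_distrib_right)
qed

lemma smooth_derivs_derivs_on:
  assumes "smooth_derivs S F"
  shows "derivs_on S (\<lambda>\<beta> \<xi>. F \<beta> \<xi> \<gamma>)"
  unfolding derivs_on_def
proof (intro allI ballI)
  fix \<beta> \<xi> assume \<xi>: "\<xi> \<in> S"
  show "((\<lambda>\<xi>. F \<beta> \<xi> \<gamma>) has_derivative (\<lambda>v. \<Sum>a\<in>UNIV. of_real (v $ a) * F (\<beta> + axis a 1) \<xi> \<gamma>)) (at \<xi>)"
    unfolding has_derivative_at_alt
  proof (intro conjI bounded_linear_jet allI impI)
    fix e :: real assume "e > 0"
    then have "\<forall>\<^sub>F \<eta> in at \<xi>. seminorm_le 0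
        (\<lambda>\<alpha>. F \<beta> \<eta> \<alpha> - F \<beta> \<xi> \<alpha> - (\<Sum>a\<in>UNIV. of_real ((\<eta> - \<xi>) $ a) * F (\<beta> + axis a 1) \<xi> \<alpha>))
        (e * norm (\<eta> - \<xi>))"
      using assms \<xi> unfolding smooth_derivs_def by blast
    then obtain d where "d > 0" and d: "\<And>\<eta>. \<eta> \<noteq> \<xi> \<Longrightarrow> dist \<eta> \<xi> < d \<Longrightarrow> seminorm_le 0
        (\<lambda>\<alpha>. F \<beta> \<eta> \<alpha> - F \<beta> \<xi> \<alpha> - (\<Sum>a\<in>UNIV. of_real ((\<eta> - \<xi>) $ a) * F (\<beta> + axis a 1) \<xi> \<alpha>))
        (e * norm (\<eta> - \<xi>))"
      unfolding eventually_at by auto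
    have "norm (F \<beta> \<eta> \<gamma> - F \<beta> \<xi> \<gamma> - (\<Sum>a\<in>UNIV. of_real ((\<eta> - \<xi>) $ a) * F (\<beta> + axis a 1) \<xi> \<gamma>)) \<le> e * norm (\<eta> - \<xi>)"
      if "norm (\<eta> - \<xi>) < d" for \<eta>
      using d[of \<eta>] that by (cases "\<eta> = \<xi>") (auto simp: dist_norm seminorm_le_def)
    then show "\<exists>d>0. \<forall>y. norm (y - \<xi>) < d \<longrightarrow>
      norm (F \<beta> y \<gamma> - F \<beta> \<xi> \<gamma> - (\<Sum>a\<in>UNIV. of_real ((y - \<xi>) $ a) * F (\<beta> + axis a 1) \<xi> \<gamma>)) \<le> e * norm (y - \<xi>)"
      using \<open>d > 0\<close> by blast
  qed
qed

text \<open>The difference quotient at \<open>\<xi>\<close> is controlled in each seminorm, so the seminorm is bounded near \<open>\<xi>\<close>.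
  Compactness then turns this into the uniform bounds of lemma \<open>smooth_derivs_rapid\<close>.\<close>

lemma smooth_derivs_locally_bounded:
  assumes F: "smooth_derivs S F" and \<xi>: "\<xi> \<in> S"
  shows "\<exists>r>0. \<exists>C. \<forall>\<eta>\<in>ball \<xi> r. seminorm_le k (F \<beta> \<eta>) C"
proof -
  have sm: "F \<beta> \<xi> \<in> nct_smooth" for \<beta> using F \<xi> by (simp add: smooth_derivs_def)
  obtain D where D: "seminorm_le k (F \<beta> \<xi>) D" using sm[of \<beta>] by (auto simp: nct_smooth_def)
  have "\<forall>a. \<exists>E. seminorm_le k (F (\<beta> + axis a 1) \<xi>) E" using sm by (auto simp: nct_smooth_def)
  then obtain E where E: "\<And>a. seminorm_le k (F (\<beta> + axis a 1) \<xi>) (E a)" by metis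
  have E0: "E a \<ge> 0" for a using seminorm_le_nonneg[OF E] .
  have "\<forall>\<^sub>F \<eta> in at \<xi>. seminorm_le k
        (\<lambda>\<alpha>. F \<beta> \<eta> \<alpha> - F \<beta> \<xi> \<alpha> - (\<Sum>a\<in>UNIV. of_real ((\<eta> - \<xi>) $ a) * F (\<beta> + axis a 1) \<xi> \<alpha>))
        (1 * norm (\<eta> - \<xi>))"
    using F \<xi> unfolding smooth_derivs_def by (meson zero_less_one)
  then obtain d where "d > 0" and d: "\<And>\<eta>. \<eta> \<noteq> \<xi> \<Longrightarrow> dist \<eta> \<xi> < d \<Longrightarrow> seminorm_le k
        (\<lambda>\<alpha>. F \<beta> \<eta> \<alpha> - F \<beta> \<xi> \<alpha> - (\<Sum>a\<in>UNIV. of_real ((\<eta> - \<xi>) $ a) * F (\<beta> + axis a 1) \<xi> \<alpha>))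
        (1 * norm (\<eta> - \<xi>))"
    unfolding eventually_at by auto
  have "seminorm_le k (F \<beta> \<eta>) (1 + D + (E 1 + E 2))" if \<eta>: "\<eta> \<in> ball \<xi> (min d 1)" for \<eta>
  proof (cases "\<eta> = \<xi>")
    case True
    then show ?thesis using D E0[of 1] E0[of 2] by (auto elim!: seminorm_le_mono)
  next
    case False
    have n: "norm (\<eta> - \<xi>) < d" "norm (\<eta> - \<xi>) < 1"
      using \<eta> by (auto simp: dist_norm norm_minus_commute)
    have part: "seminorm_le k (\<lambda>\<alpha>. of_real ((\<eta> - \<xi>) $ a) * F (\<beta> + axis a 1) \<xi> \<alpha>) (E a)" for a
    proof (rule seminorm_le_mono[OF seminorm_le_scale[OF E]])
      have "\<bar>(\<eta> - \<xi>) $ a\<bar> \<le> 1" using component_le_norm_cart[of "\<eta> - \<xi>" a] n by linarith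
      then show "cmod (of_real ((\<eta> - \<xi>) $ a)) * E a \<le> E a"
        unfolding norm_of_real using E0[of a] by (rule mult_left_le_one_le[rotated 2]) auto
    qed
    have "seminorm_le k
        (\<lambda>\<alpha>. (F \<beta> \<eta> \<alpha> - F \<beta> \<xi> \<alpha> - (\<Sum>a\<in>UNIV. of_real ((\<eta> - \<xi>) $ a) * F (\<beta> + axis a 1) \<xi> \<alpha>)) + F \<beta> \<xi> \<alpha>
          + (of_real ((\<eta> - \<xi>) $ 1) * F (\<beta> + axis 1 1) \<xi> \<alpha> + of_real ((\<eta> - \<xi>) $ 2) * F (\<beta> + axis 2 1) \<xi> \<alpha>))
        (1 + D + (E 1 + E 2))"
      using False n by (intro seminorm_le_add part D seminorm_le_mono[OF d]) (auto simp: dist_norm)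
    then show ?thesis by (simp add: sum_2)
  qed
  moreover have "min d 1 > 0" using \<open>d > 0\<close> by simp
  ultimately show ?thesis by blast
qed

lemma smooth_derivs_rapid:
  assumes F: "smooth_derivs S F" and K: "compact K" "K \<subseteq> S"
  shows "rapid K (\<lambda>_. 1) d (\<lambda>\<gamma> \<beta> \<xi>. F \<beta> \<xi> \<gamma>)"
  unfolding rapid_def
proof (intro allI)
  fix \<beta> q
  have "\<forall>\<xi>\<in>K. \<exists>r>0. \<exists>C. \<forall>\<eta>\<in>ball \<xi> r. seminorm_le q (F \<beta> \<eta>) C"
    using smooth_derivs_locally_bounded[OF F] K(2) by blast
  then obtain r C where r: "\<And>\<xi>. \<xi> \<in> K \<Longrightarrow> r \<xi> > 0"
    and C: "\<And>\<xi> \<eta>. \<xi> \<in> K \<Longrightarrow> \<eta> \<in> ball \<xi> (r \<xi>) \<Longrightarrow> seminorm_le q (F \<beta> \<eta>) (C \<xi>)"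
    by metis
  have "K \<subseteq> (\<Union>\<xi>\<in>K. ball \<xi> (r \<xi>))" using r by force
  then obtain T where T: "T \<subseteq> K" "finite T" "K \<subseteq> (\<Union>\<xi>\<in>T. ball \<xi> (r \<xi>))"
    using compactE_image[OF K(1), of K "\<lambda>\<xi>. ball \<xi> (r \<xi>)"] by auto
  have "seminorm_le q (F \<beta> \<eta>) (\<Sum>\<xi>\<in>T. \<bar>C \<xi>\<bar>)" if \<eta>: "\<eta> \<in> K" for \<eta>
  proof -
    obtain \<xi> where \<xi>: "\<xi> \<in> T" "\<eta> \<in> ball \<xi> (r \<xi>)" using subsetD[OF T(3) \<eta>] by blast
    then have "C \<xi> \<le> (\<Sum>\<xi>\<in>T. \<bar>C \<xi>\<bar>)"
      by (meson T(2) abs_ge_self abs_ge_zero member_le_sum order_trans)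
    then show ?thesis using C[of \<xi> \<eta>] \<xi> T(1) seminorm_le_mono by blast
  qed
  then show "\<exists>C. \<forall>\<xi>\<in>K. seminorm_le q (\<lambda>\<gamma>. F \<beta> \<xi> \<gamma>) (C * 1 powi (d - int (mdeg \<beta>)))"
    by auto
qed

text \<open>The mean value inequality applied twice. The constant is not sharp; what matters is that it is
  linear in the bound \<open>M\<close> for the second derivatives, so that the weights of the seminorms go through.\<close>

lemma second_order_remainder:
  assumes f: "derivs_on (cball \<xi> r) f"
    and M: "\<And>a b \<eta>. \<eta> \<in> cball \<xi> r \<Longrightarrow> cmod (f (\<beta> + axis a 1 + axis b 1) \<eta>) \<le> M"
    and \<eta>: "\<eta> \<in> cball \<xi> r"
  shows "cmod (f \<beta> \<eta> - f \<beta> \<xi> - (\<Sum>a\<in>UNIV. of_real ((\<eta> - \<xi>) $ a) * f (\<beta> + axis a 1) \<xi>))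
    \<le> 4 * M * norm (\<eta> - \<xi>) * norm (\<eta> - \<xi>)"
proof -
  let ?B = "cball \<xi> (norm (\<eta> - \<xi>))"
  have sub: "?B \<subseteq> cball \<xi> r" using \<eta> by (auto simp: dist_norm norm_minus_commute)
  have der: "(f \<beta> has_derivative (\<lambda>v. \<Sum>a\<in>UNIV. of_real (v $ a) * f (\<beta> + axis a 1) x)) (at x within ?B)"
    if "x \<in> ?B" for x \<beta>
    using derivs_onD[OF f] sub that by (blast intro: has_derivative_at_withinI)
  have first: "cmod (f (\<beta> + axis a 1) x - f (\<beta> + axis a 1) \<xi>) \<le> 2 * M * norm (\<eta> - \<xi>)" if x: "x \<in> ?B" for x a
  proof -
    have "cmod (f (\<beta> + axis a 1) x - f (\<beta> + axis a 1) \<xi>) \<le> 2 * M * norm (x - \<xi>)"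
    proof (rule differentiable_bound[OF convex_cball der])
      fix y assume y: "y \<in> ?B"
      show "onorm (\<lambda>v. \<Sum>b\<in>UNIV. of_real (v $ b) * f (\<beta> + axis a 1 + axis b 1) y) \<le> 2 * M"
      proof (rule onorm_le, rule order_trans[OF norm_jet_le])
        fix v :: "real^2"
        have "(\<Sum>b\<in>UNIV. cmod (f (\<beta> + axis a 1 + axis b 1) y)) \<le> (\<Sum>b\<in>(UNIV::2 set). M)"
          using sub y by (intro sum_mono M) auto
        then show "(\<Sum>b\<in>UNIV. cmod (f (\<beta> + axis a 1 + axis b 1) y)) * norm v \<le> 2 * M * norm v"
          by (intro mult_right_mono) auto
      qed
    qed (use x in auto)
    also have "\<dots> \<le> 2 * M * norm (\<eta> - \<xi>)"
    proof (rule mult_left_mono)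
      show "norm (x - \<xi>) \<le> norm (\<eta> - \<xi>)" using x by (simp add: dist_norm norm_minus_commute)
      show "0 \<le> 2 * M" using order_trans[OF norm_ge_zero M[OF \<eta>]] by simp
    qed
    finally show ?thesis .
  qed
  have "norm (f \<beta> \<eta> - f \<beta> \<xi> - (\<lambda>x v. \<Sum>a\<in>UNIV. of_real (v $ a) * f (\<beta> + axis a 1) x) \<xi> (\<eta> - \<xi>))
      \<le> norm (\<eta> - \<xi>) * (4 * M * norm (\<eta> - \<xi>))"
  proof (rule differentiable_bound_linearization[where S = ?B])
    fix t :: real assume "t \<in> {0..1}"
    then show "\<xi> + t *\<^sub>R (\<eta> - \<xi>) \<in> ?B"
      by (simp add: dist_norm mult_left_le_one_le)
  next
    fix x assume x: "x \<in> ?B"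
    show "onorm ((\<lambda>v. \<Sum>a\<in>UNIV. of_real (v $ a) * f (\<beta> + axis a 1) x) -
          (\<lambda>v. \<Sum>a\<in>UNIV. of_real (v $ a) * f (\<beta> + axis a 1) \<xi>)) \<le> 4 * M * norm (\<eta> - \<xi>)"
    proof (rule onorm_le)
      fix v :: "real^2"
      have "norm (((\<lambda>v. \<Sum>a\<in>UNIV. of_real (v $ a) * f (\<beta> + axis a 1) x) -
          (\<lambda>v. \<Sum>a\<in>UNIV. of_real (v $ a) * f (\<beta> + axis a 1) \<xi>)) v) =
          cmod (\<Sum>a\<in>UNIV. of_real (v $ a) * (f (\<beta> + axis a 1) x - f (\<beta> + axis a 1) \<xi>))"
        by (simp add: right_diff_distrib sum_subtractf)
      also have "\<dots> \<le> (\<Sum>a\<in>UNIV. cmod (f (\<beta> + axis a 1) x - f (\<beta> + axis a 1) \<xi>)) * norm v"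
        by (rule norm_jet_le)
      also have "\<dots> \<le> (\<Sum>a\<in>(UNIV::2 set). 2 * M * norm (\<eta> - \<xi>)) * norm v"
        by (intro mult_right_mono sum_mono first x) auto
      finally show "norm (((\<lambda>v. \<Sum>a\<in>UNIV. of_real (v $ a) * f (\<beta> + axis a 1) x) -
          (\<lambda>v. \<Sum>a\<in>UNIV. of_real (v $ a) * f (\<beta> + axis a 1) \<xi>)) v) \<le> 4 * M * norm (\<eta> - \<xi>) * norm v"
        by simp
    qed
  qed (use der in auto)
  then show ?thesis by (simp add: mult_ac)
qed

text \<open>The criterion that makes the Frechet space disappear from the rest of the argument: a map into the
  smooth algebra is smooth as soon as each coefficient is, with derivatives that are bounded in every
  seminorm on compact sets. The bounds on the second derivatives make the coefficientwise difference
  quotients converge uniformly with respect to the weights.\<close>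

lemma smooth_derivsI:
  assumes S: "open S" and F: "\<And>\<gamma>. derivs_on S (\<lambda>\<beta> \<xi>. F \<beta> \<xi> \<gamma>)"
    and bd: "\<And>K. compact K \<Longrightarrow> K \<subseteq> S \<Longrightarrow> rapid K (\<lambda>_. 1) 0 (\<lambda>\<gamma> \<beta> \<xi>. F \<beta> \<xi> \<gamma>)"
  shows "smooth_derivs S F"
  unfolding smooth_derivs_def
proof (intro allI ballI conjI impI)
  fix \<beta> \<xi> assume \<xi>: "\<xi> \<in> S"
  show "F \<beta> \<xi> \<in> nct_smooth"
    using bd[of "{\<xi>}"] \<xi> by (auto simp: rapid_def nct_smooth_def)
  fix k and \<epsilon> :: real assume \<epsilon>: "\<epsilon> > 0"
  obtain r where r: "r > 0" "cball \<xi> r \<subseteq> S" using S \<xi> open_contains_cball by blast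
  have "\<forall>a b. \<exists>C. \<forall>\<eta>\<in>cball \<xi> r. seminorm_le k (F (\<beta> + axis a 1 + axis b 1) \<eta>) C"
    using bd[OF compact_cball r(2)] unfolding rapid_def power_int_1_left mult_1_right by blast
  then obtain C where C: "\<And>a b \<eta>. \<eta> \<in> cball \<xi> r \<Longrightarrow> seminorm_le k (F (\<beta> + axis a 1 + axis b 1) \<eta>) (C a b)"
    by metis
  define M where "M = 1 + (\<Sum>a\<in>UNIV. \<Sum>b\<in>UNIV. \<bar>C a b\<bar>)"
  have "C a b \<le> M" for a b
  proof -
    have "C a b \<le> (\<Sum>b\<in>UNIV. \<bar>C a b\<bar>)"
      using member_le_sum[of b UNIV "\<lambda>b. \<bar>C a b\<bar>"] by simp
    also have "\<dots> \<le> (\<Sum>a\<in>UNIV. \<Sum>b\<in>UNIV. \<bar>C a b\<bar>)"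
      using member_le_sum[of a UNIV "\<lambda>a. \<Sum>b\<in>UNIV. \<bar>C a b\<bar>"] by (simp add: sum_nonneg)
    finally show ?thesis by (simp add: M_def)
  qed
  then have M: "seminorm_le k (F (\<beta> + axis a 1 + axis b 1) \<eta>) M" if "\<eta> \<in> cball \<xi> r" for a b \<eta>
    using C[OF that] seminorm_le_mono by blast
  have "M > 0" unfolding M_def by (intro add_pos_nonneg sum_nonneg) auto
  define \<delta> where "\<delta> = min r (\<epsilon> / (4 * M))"
  have "\<delta> > 0" using r \<epsilon> \<open>M > 0\<close> by (simp add: \<delta>_def)
  show "\<forall>\<^sub>F \<eta> in at \<xi>. seminorm_le k
        (\<lambda>\<alpha>. F \<beta> \<eta> \<alpha> - F \<beta> \<xi> \<alpha> - (\<Sum>a\<in>UNIV. of_real ((\<eta> - \<xi>) $ a) * F (\<beta> + axis a 1) \<xi> \<alpha>))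
        (\<epsilon> * norm (\<eta> - \<xi>))"
    unfolding eventually_at
  proof (intro exI[of _ \<delta>] conjI ballI impI \<open>\<delta> > 0\<close>)
    fix \<eta> assume \<eta>: "\<eta> \<noteq> \<xi> \<and> dist \<eta> \<xi> < \<delta>"
    then have \<eta>r: "\<eta> \<in> cball \<xi> r" by (simp add: \<delta>_def dist_commute)
    have small: "4 * M * norm (\<eta> - \<xi>) \<le> \<epsilon>"
      using \<eta> \<open>M > 0\<close> by (simp add: \<delta>_def dist_norm pos_less_divide_eq mult_ac)
    show "seminorm_le k
        (\<lambda>\<alpha>. F \<beta> \<eta> \<alpha> - F \<beta> \<xi> \<alpha> - (\<Sum>a\<in>UNIV. of_real ((\<eta> - \<xi>) $ a) * F (\<beta> + axis a 1) \<xi> \<alpha>))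
        (\<epsilon> * norm (\<eta> - \<xi>))"
      unfolding seminorm_le_iff
    proof
      fix \<gamma>
      have "cmod (F \<beta> \<eta> \<gamma> - F \<beta> \<xi> \<gamma> - (\<Sum>a\<in>UNIV. of_real ((\<eta> - \<xi>) $ a) * F (\<beta> + axis a 1) \<xi> \<gamma>))
          \<le> 4 * (M / weight \<gamma> ^ k) * norm (\<eta> - \<xi>) * norm (\<eta> - \<xi>)"
        by (rule second_order_remainder[OF derivs_on_subset[OF F r(2)] _ \<eta>r])
           (use M in \<open>auto simp: seminorm_le_iff\<close>)
      also have "\<dots> = (4 * M * norm (\<eta> - \<xi>)) * norm (\<eta> - \<xi>) / weight \<gamma> ^ k" by simp
      also have "\<dots> \<le> \<epsilon> * norm (\<eta> - \<xi>) / weight \<gamma> ^ k"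
        by (intro divide_right_mono mult_right_mono small) (auto simp: less_imp_le)
      finally show "cmod (F \<beta> \<eta> \<gamma> - F \<beta> \<xi> \<gamma> - (\<Sum>a\<in>UNIV. of_real ((\<eta> - \<xi>) $ a) * F (\<beta> + axis a 1) \<xi> \<gamma>))
          \<le> \<epsilon> * norm (\<eta> - \<xi>) / weight \<gamma> ^ k" .
    qed
  qed
qed

section \<open>Taylor expansion of Fourier multipliers\<close>

definition dir_deriv :: "real^2 \<Rightarrow> jet \<Rightarrow> jet" where
  "dir_deriv v f = (\<lambda>\<beta> \<xi>. \<Sum>a\<in>UNIV. of_real (v $ a) * f (\<beta> + axis a 1) \<xi>)"

text \<open>The term of degree \<open>i\<close> of the Taylor expansion of \<open>f\<close> in the direction \<open>v\<close>, as a jet in the base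
  point. Summing over a multi-index \<open>\<kappa>\<close> of length \<open>i\<close>, it is \<open>\<Sum> v^\<kappa> \<partial>^\<kappa> f / \<kappa>!\<close>; for \<open>v = \<gamma>\<close> the factor
  \<open>v^\<kappa>\<close> is how the derivation \<open>\<delta>^\<kappa>\<close> acts on the mode \<open>\<gamma>\<close>, which is Connes' composition formula.\<close>

definition taylor_term :: "nat \<Rightarrow> real^2 \<Rightarrow> jet \<Rightarrow> jet" where
  "taylor_term i v f = (\<lambda>\<beta> \<xi>. inverse (fact i) * (dir_deriv v ^^ i) f \<beta> \<xi>)"

lemma derivs_on_dir_deriv: "derivs_on S f \<Longrightarrow> derivs_on S ((dir_deriv v ^^ i) f)"
proof (induction i)
  case (Suc i)
  then show ?case
    using derivs_on_shift[of S "(dir_deriv v ^^ i) f"]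
    by (auto simp: dir_deriv_def[of v "(dir_deriv v ^^ i) f"] shift_def intro!: derivs_on_sum derivs_on_scale)
qed simp

lemma derivs_on_taylor_term: "derivs_on S f \<Longrightarrow> derivs_on S (taylor_term i v f)"
  unfolding taylor_term_def by (intro derivs_on_scale derivs_on_dir_deriv)

lemma homogeneous_sum_scale:
  "(\<And>a. a \<in> A \<Longrightarrow> homogeneous d (f a)) \<Longrightarrow> homogeneous d (\<lambda>\<beta> \<xi>. \<Sum>a\<in>A. c a * f a \<beta> \<xi>)"
  by (simp add: homogeneous_def sum_distrib_left mult_ac)

lemma homogeneous_dir_deriv: "homogeneous d f \<Longrightarrow> homogeneous (d - int i) ((dir_deriv v ^^ i) f)"
proof (induction i)
  case (Suc i)
  have "homogeneous (d - int i - 1) (\<lambda>\<beta> \<xi>. \<Sum>a\<in>UNIV. of_real (v $ a) * shift a ((dir_deriv v ^^ i) f) \<beta> \<xi>)"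
    by (intro homogeneous_sum_scale homogeneous_shift Suc)
  then show ?case by (simp add: dir_deriv_def[of v "(dir_deriv v ^^ i) f"] shift_def algebra_simps)
qed simp

lemma homogeneous_taylor_term: "homogeneous d f \<Longrightarrow> homogeneous (d - int i) (taylor_term i v f)"
  using homogeneous_dir_deriv[of d f i v] by (simp add: homogeneous_def taylor_term_def mult_ac)

lemma tempered_add:
  assumes "tempered X w d f" "tempered X w d g" "\<And>\<xi>. \<xi> \<in> X \<Longrightarrow> w \<xi> > 0"
  shows "tempered X w d (\<lambda>\<gamma> \<beta> \<xi>. f \<gamma> \<beta> \<xi> + g \<gamma> \<beta> \<xi>)"
  unfolding tempered_def
proof (intro allI)
  fix \<beta>
  obtain K C where C: "\<forall>\<xi>\<in>X. \<forall>\<gamma>. cmod (f \<gamma> \<beta> \<xi>) \<le> C * weight \<gamma> ^ K * w \<xi> powi (d - int (mdeg \<beta>))"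
    using assms(1) unfolding tempered_def by blast
  obtain L D where D: "\<forall>\<xi>\<in>X. \<forall>\<gamma>. cmod (g \<gamma> \<beta> \<xi>) \<le> D * weight \<gamma> ^ L * w \<xi> powi (d - int (mdeg \<beta>))"
    using assms(2) unfolding tempered_def by blast
  have "cmod (f \<gamma> \<beta> \<xi> + g \<gamma> \<beta> \<xi>) \<le> (\<bar>C\<bar> + \<bar>D\<bar>) * weight \<gamma> ^ (K + L) * w \<xi> powi (d - int (mdeg \<beta>))"
    if "\<xi> \<in> X" for \<xi> \<gamma>
  proof -
    let ?p = "w \<xi> powi (d - int (mdeg \<beta>))"
    have p: "?p \<ge> 0" using assms(3)[OF that] by (simp add: less_imp_le)
    have "weight \<gamma> ^ K \<le> weight \<gamma> ^ (K + L)" "weight \<gamma> ^ L \<le> weight \<gamma> ^ (K + L)"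
      using weight_ge_1[of \<gamma>] by (auto intro: power_increasing)
    then have "C * weight \<gamma> ^ K \<le> \<bar>C\<bar> * weight \<gamma> ^ (K + L)" "D * weight \<gamma> ^ L \<le> \<bar>D\<bar> * weight \<gamma> ^ (K + L)"
      by (auto intro!: mult_mono simp: less_imp_le)
    then have "C * weight \<gamma> ^ K * ?p + D * weight \<gamma> ^ L * ?p
       \<le> \<bar>C\<bar> * weight \<gamma> ^ (K + L) * ?p + \<bar>D\<bar> * weight \<gamma> ^ (K + L) * ?p"
      using p by (intro add_mono mult_right_mono)
    moreover have "cmod (f \<gamma> \<beta> \<xi> + g \<gamma> \<beta> \<xi>) \<le> cmod (f \<gamma> \<beta> \<xi>) + cmod (g \<gamma> \<beta> \<xi>)"
      by (rule norm_triangle_ineq)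
    moreover have "cmod (f \<gamma> \<beta> \<xi>) \<le> C * weight \<gamma> ^ K * ?p" "cmod (g \<gamma> \<beta> \<xi>) \<le> D * weight \<gamma> ^ L * ?p"
      using C D that by auto
    ultimately show ?thesis by (simp add: distrib_right)
  qed
  then show "\<exists>K C. \<forall>\<xi>\<in>X. \<forall>\<gamma>. cmod (f \<gamma> \<beta> \<xi> + g \<gamma> \<beta> \<xi>) \<le> C * weight \<gamma> ^ K * w \<xi> powi (d - int (mdeg \<beta>))"
    by blast
qed

lemma tempered_mult_coordinate:
  assumes "tempered X w d f" "\<And>\<xi>. \<xi> \<in> X \<Longrightarrow> w \<xi> > 0"
  shows "tempered X w d (\<lambda>\<gamma> \<beta> \<xi>. of_real (lattice_pt \<gamma> $ a) * f \<gamma> \<beta> \<xi>)"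
  unfolding tempered_def
proof (intro allI)
  fix \<beta>
  obtain K C where C: "\<And>\<xi> \<gamma>. \<xi> \<in> X \<Longrightarrow> cmod (f \<gamma> \<beta> \<xi>) \<le> C * weight \<gamma> ^ K * w \<xi> powi (d - int (mdeg \<beta>))"
    using assms(1) unfolding tempered_def by blast
  have "cmod (of_real (lattice_pt \<gamma> $ a) * f \<gamma> \<beta> \<xi>) \<le> C * weight \<gamma> ^ Suc K * w \<xi> powi (d - int (mdeg \<beta>))"
    if "\<xi> \<in> X" for \<xi> \<gamma>
  proof -
    have "\<bar>lattice_pt \<gamma> $ a\<bar> \<le> weight \<gamma>"
      using component_le_norm_cart[of "lattice_pt \<gamma>" a] by (simp add: weight_def)
    then have "cmod (of_real (lattice_pt \<gamma> $ a) * f \<gamma> \<beta> \<xi>) \<le> weight \<gamma> * (C * weight \<gamma> ^ K * w \<xi> powi (d - int (mdeg \<beta>)))"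
      unfolding norm_mult norm_of_real by (intro mult_mono C that) (auto simp: less_imp_le)
    then show ?thesis by (simp add: mult_ac)
  qed
  then show "\<exists>K C. \<forall>\<xi>\<in>X. \<forall>\<gamma>. cmod (of_real (lattice_pt \<gamma> $ a) * f \<gamma> \<beta> \<xi>) \<le> C * weight \<gamma> ^ K * w \<xi> powi (d - int (mdeg \<beta>))"
    by blast
qed

lemma tempered_scale:
  assumes "tempered X w d f"
  shows "tempered X w d (\<lambda>\<gamma> \<beta> \<xi>. c * f \<gamma> \<beta> \<xi>)"
  unfolding tempered_def
proof (intro allI)
  fix \<beta>
  obtain K C where C: "\<And>\<xi> \<gamma>. \<xi> \<in> X \<Longrightarrow> cmod (f \<gamma> \<beta> \<xi>) \<le> C * weight \<gamma> ^ K * w \<xi> powi (d - int (mdeg \<beta>))"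
    using assms(1) unfolding tempered_def by blast
  have "\<forall>\<xi>\<in>X. \<forall>\<gamma>. cmod (c * f \<gamma> \<beta> \<xi>) \<le> (cmod c * C) * weight \<gamma> ^ K * w \<xi> powi (d - int (mdeg \<beta>))"
    using C by (auto simp: norm_mult mult.assoc intro!: mult_left_mono)
  then show "\<exists>K C. \<forall>\<xi>\<in>X. \<forall>\<gamma>. cmod (c * f \<gamma> \<beta> \<xi>) \<le> C * weight \<gamma> ^ K * w \<xi> powi (d - int (mdeg \<beta>))"
    by blast
qed

lemma tempered_dir_deriv:
  assumes "tempered X w d f" "\<And>\<xi>. \<xi> \<in> X \<Longrightarrow> w \<xi> > 0"
  shows "tempered X w (d - int i) (\<lambda>\<gamma>. (dir_deriv (lattice_pt \<gamma>) ^^ i) (f \<gamma>))"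
proof (induction i)
  case (Suc i)
  have "tempered X w (d - int i - 1) (\<lambda>\<gamma> \<beta> \<xi>.
      of_real (lattice_pt \<gamma> $ 1) * shift 1 ((dir_deriv (lattice_pt \<gamma>) ^^ i) (f \<gamma>)) \<beta> \<xi> +
      of_real (lattice_pt \<gamma> $ 2) * shift 2 ((dir_deriv (lattice_pt \<gamma>) ^^ i) (f \<gamma>)) \<beta> \<xi>)"
    by (intro tempered_add tempered_mult_coordinate tempered_shift Suc assms(2))
  then show ?case
    by (simp add: dir_deriv_def[of _ "(dir_deriv _ ^^ i) _"] sum_2 shift_def algebra_simps)
qed (use assms in simp)

lemma tempered_taylor_term:
  assumes "tempered X w d f" "\<And>\<xi>. \<xi> \<in> X \<Longrightarrow> w \<xi> > 0"
  shows "tempered X w (d - int i) (\<lambda>\<gamma>. taylor_term i (lattice_pt \<gamma>) (f \<gamma>))"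
  unfolding taylor_term_def by (intro tempered_scale tempered_dir_deriv assms)

lemma has_vector_derivative_ray:
  assumes "derivs_on S f" "\<xi> + t *\<^sub>R v \<in> S"
  shows "((\<lambda>t. f \<beta> (\<xi> + t *\<^sub>R v)) has_vector_derivative dir_deriv v f \<beta> (\<xi> + t *\<^sub>R v)) (at t within T)"
proof -
  have "((\<lambda>t. f \<beta> (\<xi> + t *\<^sub>R v)) has_derivative
      (\<lambda>s. \<Sum>a\<in>UNIV. of_real ((s *\<^sub>R v) $ a) * f (\<beta> + axis a 1) (\<xi> + t *\<^sub>R v))) (at t within T)"
    by (rule has_derivative_compose[of "\<lambda>t. \<xi> + t *\<^sub>R v" "\<lambda>s. s *\<^sub>R v", OF _ derivs_onD[OF assms]])
       (auto intro!: derivative_eq_intros)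
  then show ?thesis
    unfolding has_vector_derivative_def
    by (rule has_derivative_eq_rhs)
       (simp add: fun_eq_iff dir_deriv_def scaleR_conv_of_real[where 'a = complex] sum_distrib_left mult.assoc)
qed

lemma norm_le_of_vector_derivative_bound:
  fixes e :: "real \<Rightarrow> complex"
  assumes "e 0 = 0" "t \<in> {0..1}"
    and der: "\<And>s. s \<in> {0..1} \<Longrightarrow> (e has_vector_derivative e' s) (at s within {0..1})"
    and le: "\<And>s. s \<in> {0..1} \<Longrightarrow> cmod (e' s) \<le> B"
  shows "cmod (e t) \<le> B"
proof -
  have "cmod (e t - e 0) \<le> B * norm (t - 0)"
  proof (rule differentiable_bound[where S = "{0..1}" and f' = "\<lambda>s x. x *\<^sub>R e' s"])
    fix s :: real assume s: "s \<in> {0..1}"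
    show "onorm (\<lambda>x. x *\<^sub>R e' s) \<le> B"
      by (rule onorm_le) (simp add: mult.commute[of B] mult_left_mono le[OF s])
  qed (use assms in \<open>auto simp: has_vector_derivative_def\<close>)
  also have "\<dots> \<le> B"
    using assms(2) order_trans[OF norm_ge_zero le[OF assms(2)]] by (simp add: mult_left_le)
  finally show ?thesis using assms(1) by simp
qed

text \<open>The derivative of the remainder of order \<open>n\<close> along the segment is the remainder of order \<open>n - 1\<close>
  of the directional derivative, so the bound follows by induction.\<close>

lemma taylor_remainder:
  assumes f: "derivs_on S f" and seg: "\<And>t. t \<in> {0..1} \<Longrightarrow> \<xi> + t *\<^sub>R v \<in> S"
    and B: "\<And>t. t \<in> {0..1} \<Longrightarrow> cmod ((dir_deriv v ^^ n) f \<beta> (\<xi> + t *\<^sub>R v)) \<le> B"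
  shows "cmod (f \<beta> (\<xi> + v) - (\<Sum>i<n. taylor_term i v f \<beta> \<xi>)) \<le> B"
proof -
  have "cmod (f \<beta> (\<xi> + t *\<^sub>R v) - (\<Sum>i<n. (t ^ i / fact i) *\<^sub>R (dir_deriv v ^^ i) f \<beta> \<xi>)) \<le> B"
    if t: "t \<in> {0..1}" for t
    using f B t
  proof (induction n arbitrary: f t)
    case 0
    then show ?case by simp
  next
    case (Suc n)
    let ?g = "dir_deriv v f"
    let ?e = "\<lambda>t. f \<beta> (\<xi> + t *\<^sub>R v) - (\<Sum>i<Suc n. (t ^ i / fact i) *\<^sub>R (dir_deriv v ^^ i) f \<beta> \<xi>)"
    let ?e' = "\<lambda>t. ?g \<beta> (\<xi> + t *\<^sub>R v) - (\<Sum>i<n. (t ^ i / fact i) *\<^sub>R (dir_deriv v ^^ i) ?g \<beta> \<xi>)"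
    have "derivs_on S ?g" using derivs_on_dir_deriv[OF Suc(2), where i = "Suc 0" and v = v] by simp
    then have le: "cmod (?e' s) \<le> B" if "s \<in> {0..1}" for s
      using Suc(1)[of ?g s] Suc(3) that by (simp add: funpow_swap1)
    show ?case
    proof (rule norm_le_of_vector_derivative_bound[where e = ?e and e' = ?e'])
      show "?e 0 = 0" by (simp add: lessThan_Suc_eq_insert_0 sum.reindex zero_power)
      fix s :: real assume s: "s \<in> {0..1}"
      have d: "((\<lambda>t. (t ^ Suc i / fact (Suc i)) *\<^sub>R c) has_vector_derivative (s ^ i / fact i) *\<^sub>R c) (at s within {0..1})"
        for i and c :: complex
      proof (rule has_vector_derivative_scaleR[OF _ has_vector_derivative_const, THEN has_vector_derivative_eq_rhs])
        have "((\<lambda>t. t ^ Suc i / fact (Suc i)) has_field_derivative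
            (real (Suc i) * s ^ i) / fact (Suc i)) (at s within {0..1})"
          using DERIV_cdivide[OF DERIV_pow[of "Suc i" s "{0..1}"], of "fact (Suc i)"]
          by (simp only: diff_Suc_Suc diff_zero)
        moreover have "real (Suc i) * s ^ i / fact (Suc i) = s ^ i / fact i"
          by (simp add: fact_Suc del: of_nat_Suc)
        ultimately show "((\<lambda>t. t ^ Suc i / fact (Suc i)) has_field_derivative s ^ i / fact i) (at s within {0..1})"
          by (simp only:)
      qed simp
      have "((\<lambda>t. f \<beta> (\<xi> + t *\<^sub>R v) - (f \<beta> \<xi> + (\<Sum>i<n. (t ^ Suc i / fact (Suc i)) *\<^sub>R (dir_deriv v ^^ Suc i) f \<beta> \<xi>)))
         has_vector_derivative ?g \<beta> (\<xi> + s *\<^sub>R v) - (0 + (\<Sum>i<n. (s ^ i / fact i) *\<^sub>R (dir_deriv v ^^ Suc i) f \<beta> \<xi>)))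
         (at s within {0..1})"
        by (intro has_vector_derivative_diff has_vector_derivative_add has_vector_derivative_sum
            has_vector_derivative_ray[OF Suc(2) seg[OF s]] has_vector_derivative_const d)
      then show "(?e has_vector_derivative ?e' s) (at s within {0..1})"
        by (simp add: sum.lessThan_Suc_shift funpow_swap1 del: sum.lessThan_Suc fact_Suc power_Suc)
    qed (use le Suc in auto)
  qed
  from this[of 1] show ?thesis by (simp add: taylor_term_def scaleR_conv_of_real inverse_eq_divide)
qed

text \<open>A homogeneous function is determined by its values on the unit circle, which is compact.\<close>

lemma homogeneous_bound:
  assumes "derivs_on (-{0}) q" "homogeneous d q"
  shows "\<exists>C\<ge>0. \<forall>\<xi>. \<xi> \<noteq> 0 \<longrightarrow> cmod (q \<beta> \<xi>) \<le> C * norm \<xi> powi (d - int (mdeg \<beta>))"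
proof -
  have "continuous_on (sphere 0 1) (q \<beta>)"
    by (rule continuous_on_subset[OF derivs_on_continuous[OF assms(1)]]) auto
  then have "bounded (q \<beta> ` sphere 0 1)"
    by (intro compact_imp_bounded compact_continuous_image) auto
  then obtain C where C: "C > 0" "\<And>\<xi>. norm \<xi> = 1 \<Longrightarrow> cmod (q \<beta> \<xi>) \<le> C"
    unfolding bounded_pos by auto
  have "cmod (q \<beta> \<xi>) \<le> C * norm \<xi> powi (d - int (mdeg \<beta>))" if "\<xi> \<noteq> 0" for \<xi>
  proof -
    have "q \<beta> (norm \<xi> *\<^sub>R (\<xi> /\<^sub>R norm \<xi>)) =
        of_real (norm \<xi> powi (d - int (mdeg \<beta>))) * q \<beta> (\<xi> /\<^sub>R norm \<xi>)"
      using assms(2)[unfolded homogeneous_def, rule_format, of "norm \<xi>" "\<xi> /\<^sub>R norm \<xi>" \<beta>] that by simp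
    then have "cmod (q \<beta> \<xi>) = norm \<xi> powi (d - int (mdeg \<beta>)) * cmod (q \<beta> (\<xi> /\<^sub>R norm \<xi>))"
      using that by (simp add: norm_mult norm_power_int)
    also have "\<dots> \<le> norm \<xi> powi (d - int (mdeg \<beta>)) * C"
      using that by (intro mult_left_mono C(2)) auto
    finally show ?thesis by (simp add: mult.commute)
  qed
  then show ?thesis using C(1) by (intro exI[of _ C]) (auto simp: less_imp_le)
qed

lemma homogeneous_tempered:
  assumes "derivs_on (-{0}) q" "homogeneous d q" "0 \<notin> X"
  shows "tempered X norm d (\<lambda>_. q)"
  unfolding tempered_def
proof (intro allI)
  fix \<beta>
  obtain C where C: "\<And>\<xi>. \<xi> \<noteq> 0 \<Longrightarrow> cmod (q \<beta> \<xi>) \<le> C * norm \<xi> powi (d - int (mdeg \<beta>))"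
    using homogeneous_bound[OF assms(1,2)] by blast
  then have "\<forall>\<xi>\<in>X. \<forall>\<gamma>. cmod (q \<beta> \<xi>) \<le> C * weight \<gamma> ^ 0 * norm \<xi> powi (d - int (mdeg \<beta>))"
    using assms(3) by (auto intro!: C)
  then show "\<exists>K C. \<forall>\<xi>\<in>X. \<forall>\<gamma>. cmod (q \<beta> \<xi>) \<le> C * weight \<gamma> ^ K * norm \<xi> powi (d - int (mdeg \<beta>))"
    by blast
qed

lemma tempered_compact:
  assumes "derivs_on S q" "compact K" "K \<subseteq> S"
  shows "tempered K (\<lambda>_. 1) d (\<lambda>_. q)"
  unfolding tempered_def
proof (intro allI)
  fix \<beta>
  have "continuous_on K (q \<beta>)"
    by (rule continuous_on_subset[OF derivs_on_continuous[OF assms(1)] assms(3)])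
  then have "bounded (q \<beta> ` K)"
    by (intro compact_imp_bounded compact_continuous_image assms(2))
  then obtain C where "\<forall>\<xi>\<in>K. cmod (q \<beta> \<xi>) \<le> C"
    unfolding bounded_pos by auto
  then show "\<exists>L C. \<forall>\<xi>\<in>K. \<forall>\<gamma>. cmod (q \<beta> \<xi>) \<le> C * weight \<gamma> ^ L * 1 powi (d - int (mdeg \<beta>))"
    by (intro exI[of _ 0] exI[of _ C]) simp
qed

text \<open>A scalar symbol \<open>p\<close> that coincides with its homogeneous leading part \<open>q\<close>, of order \<open>- k\<close>, away from
  the disc of radius one half. All nonzero lattice points lie in that region, so \<open>p\<close> differs from \<open>q\<close>
  at no lattice point other than the origin; and outside the unit disc the expansion of \<open>p\<close> is exact.\<close>

definition fourier_symbol :: "nat \<Rightarrow> jet \<Rightarrow> jet \<Rightarrow> bool" where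
  "fourier_symbol k p q \<longleftrightarrow> derivs_on UNIV p \<and> derivs_on (- {0}) q \<and> homogeneous (- int k) q \<and>
     (\<forall>\<beta> \<xi>. norm \<xi> \<ge> 1/2 \<longrightarrow> p \<beta> \<xi> = q \<beta> \<xi>)"

lemma fourier_symbol_bounded:
  assumes "fourier_symbol k p q"
  shows "\<exists>C\<ge>0. \<forall>\<xi>. cmod (p \<beta> \<xi>) \<le> C"
proof -
  have p: "derivs_on UNIV p" and q: "derivs_on (-{0}) q" "homogeneous (- int k) q"
    and eq: "\<And>\<xi>. norm \<xi> \<ge> 1/2 \<Longrightarrow> p \<beta> \<xi> = q \<beta> \<xi>"
    using assms by (auto simp: fourier_symbol_def)
  obtain C where C: "C \<ge> 0" "\<And>\<xi>. \<xi> \<noteq> 0 \<Longrightarrow> cmod (q \<beta> \<xi>) \<le> C * norm \<xi> powi (- int k - int (mdeg \<beta>))"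
    using homogeneous_bound[OF q] by blast
  have "bounded (p \<beta> ` cball 0 1)"
    by (intro compact_imp_bounded compact_continuous_image continuous_on_subset[OF derivs_on_continuous[OF p]]) auto
  then obtain D where D: "D > 0" "\<And>\<xi>. norm \<xi> \<le> 1 \<Longrightarrow> cmod (p \<beta> \<xi>) \<le> D"
    unfolding bounded_pos by auto
  have "cmod (p \<beta> \<xi>) \<le> C + D" for \<xi>
  proof (cases "norm \<xi> \<le> 1")
    case True
    then show ?thesis using C(1) D(2)[of \<xi>] by linarith
  next
    case False
    then have "norm \<xi> powi (- int k - int (mdeg \<beta>)) \<le> norm \<xi> powi 0"
      by (intro power_int_increasing) auto
    then have "C * norm \<xi> powi (- int k - int (mdeg \<beta>)) \<le> C * 1"
      using C(1) by (intro mult_left_mono) auto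
    moreover have "\<xi> \<noteq> 0" "norm \<xi> \<ge> 1/2" using False by auto
    ultimately show ?thesis using C(2)[of \<xi>] D(1) eq[of \<xi>] by force
  qed
  then show ?thesis using C(1) D(1) by (intro exI[of _ "C + D"]) auto
qed

text \<open>The error of the Taylor expansion in \<open>\<gamma>\<close> of the translate \<open>p (\<xi> + \<gamma>)\<close>. For \<open>n = 0\<close> it is the
  translate itself, so that the following estimate also bounds the latter.\<close>

definition taylor_rest :: "nat \<Rightarrow> jet \<Rightarrow> jet \<Rightarrow> int^2 \<Rightarrow> jet" where
  "taylor_rest n p q \<gamma> = (\<lambda>\<beta> \<xi>. p \<beta> (\<xi> + lattice_pt \<gamma>) - (\<Sum>i<n. taylor_term i (lattice_pt \<gamma>) q \<beta> \<xi>))"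

text \<open>Each further Taylor term gains one order in \<open>\<xi>\<close> at the price of a power of \<open>\<gamma>\<close>. If \<open>\<gamma>\<close> is small
  compared with \<open>\<xi>\<close>, the segment from \<open>\<xi>\<close> to \<open>\<xi> + \<gamma>\<close> stays in the region where \<open>p = q\<close> and has size
  comparable to \<open>\<xi>\<close>, and Taylor's formula applies. Otherwise \<open>\<xi>\<close> is at most twice the weight of \<open>\<gamma>\<close>,
  and a power of the weight compensates for any power of \<open>\<xi>\<close>.\<close>

lemma tempered_taylor_rest:
  assumes "fourier_symbol k p q"
  shows "tempered {\<xi>. norm \<xi> \<ge> 1} norm (- int k - int n) (taylor_rest n p q)"
  unfolding tempered_def
proof (intro allI)
  fix \<beta>
  have q: "derivs_on (-{0}) q" "homogeneous (- int k) q"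
    and eq: "\<And>\<xi>. norm \<xi> \<ge> 1/2 \<Longrightarrow> p \<beta> \<xi> = q \<beta> \<xi>"
    using assms by (auto simp: fourier_symbol_def)
  define X :: "(real^2) set" where "X = {\<xi>. norm \<xi> \<ge> 1/2}"
  \<comment> \<open>the total gain in \<open>\<xi>\<close>, written as a natural number\<close>
  define m where "m = k + n + mdeg \<beta>"
  have pw: "(x::real) powi (- int k - int n - int (mdeg \<beta>)) = inverse (x ^ m)" for x
  proof -
    have "- int k - int n - int (mdeg \<beta>) = - int m" by (simp add: m_def)
    then show ?thesis by (simp only: power_int_minus power_int_of_nat)
  qed
  have X: "norm \<xi> > 0" if "\<xi> \<in> X" for \<xi> using that by (auto simp: X_def)
  have qt: "tempered X norm (- int k) (\<lambda>_. q)"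
    by (rule homogeneous_tempered[OF q]) (auto simp: X_def)
  obtain L C where C: "\<And>\<xi> \<gamma>. \<xi> \<in> X \<Longrightarrow> cmod ((dir_deriv (lattice_pt \<gamma>) ^^ n) q \<beta> \<xi>) \<le> C * weight \<gamma> ^ L * inverse (norm \<xi> ^ m)"
    using tempered_dir_deriv[OF qt X, of n] unfolding tempered_def pw[symmetric] by blast
  obtain P where P: "P \<ge> 0" "\<And>\<xi>. cmod (p \<beta> \<xi>) \<le> P" using fourier_symbol_bounded[OF assms] by blast
  have "\<forall>i. \<exists>K D. \<forall>\<xi>\<in>X. \<forall>\<gamma>. cmod (taylor_term i (lattice_pt \<gamma>) q \<beta> \<xi>) \<le> D * weight \<gamma> ^ K * norm \<xi> powi (- int k - int i - int (mdeg \<beta>))"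
    using tempered_taylor_term[OF qt X] unfolding tempered_def by blast
  then obtain K D where D: "\<And>i \<xi> \<gamma>. \<xi> \<in> X \<Longrightarrow>
      cmod (taylor_term i (lattice_pt \<gamma>) q \<beta> \<xi>) \<le> D i * weight \<gamma> ^ K i * norm \<xi> powi (- int k - int i - int (mdeg \<beta>))"
    by metis
  define M where "M = L + (\<Sum>i<n. K i) + m"
  define E where "E = (\<bar>C\<bar> + P + (\<Sum>i<n. \<bar>D i\<bar>)) * 2 ^ m"
  have "cmod (taylor_rest n p q \<gamma> \<beta> \<xi>) \<le> E * weight \<gamma> ^ M * inverse (norm \<xi> ^ m)"
    if \<xi>: "norm \<xi> \<ge> 1" for \<xi> \<gamma>
  proof (cases "norm (lattice_pt \<gamma>) \<le> norm \<xi> / 2")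
    case True
    have far: "norm \<xi> / 2 \<le> norm (\<xi> + t *\<^sub>R lattice_pt \<gamma>)" if "t \<in> {0..1}" for t
    proof -
      have "norm (t *\<^sub>R lattice_pt \<gamma>) \<le> norm (lattice_pt \<gamma>)"
        using that by (simp add: mult_left_le_one_le)
      moreover have "norm \<xi> - norm (t *\<^sub>R lattice_pt \<gamma>) \<le> norm (\<xi> + t *\<^sub>R lattice_pt \<gamma>)"
        by (rule norm_diff_ineq)
      ultimately show ?thesis using True by linarith
    qed
    then have inX: "\<xi> + t *\<^sub>R lattice_pt \<gamma> \<in> X" if "t \<in> {0..1}" for t
      using \<xi> that by (fastforce simp: X_def)
    have "cmod (q \<beta> (\<xi> + lattice_pt \<gamma>) - (\<Sum>i<n. taylor_term i (lattice_pt \<gamma>) q \<beta> \<xi>))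
        \<le> \<bar>C\<bar> * weight \<gamma> ^ L * (2 ^ m * inverse (norm \<xi> ^ m))"
    proof (rule taylor_remainder[OF q(1)])
      fix t :: real assume t: "t \<in> {0..1}"
      show "\<xi> + t *\<^sub>R lattice_pt \<gamma> \<in> - {0}" using X[OF inX[OF t]] by auto
      have "(norm \<xi> / 2) ^ m \<le> norm (\<xi> + t *\<^sub>R lattice_pt \<gamma>) ^ m"
        by (rule power_mono[OF far[OF t]]) simp
      then have "inverse (norm (\<xi> + t *\<^sub>R lattice_pt \<gamma>) ^ m) \<le> inverse ((norm \<xi> / 2) ^ m)"
        using \<xi> by (intro le_imp_inverse_le) (auto intro!: zero_less_power)
      also have "\<dots> = 2 ^ m * inverse (norm \<xi> ^ m)" by (simp add: field_simps)
      finally have "\<bar>C\<bar> * weight \<gamma> ^ L * inverse (norm (\<xi> + t *\<^sub>R lattice_pt \<gamma>) ^ m)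
          \<le> \<bar>C\<bar> * weight \<gamma> ^ L * (2 ^ m * inverse (norm \<xi> ^ m))"
        by (intro mult_left_mono) (auto simp: less_imp_le)
      moreover have "C * weight \<gamma> ^ L * inverse (norm (\<xi> + t *\<^sub>R lattice_pt \<gamma>) ^ m)
          \<le> \<bar>C\<bar> * weight \<gamma> ^ L * inverse (norm (\<xi> + t *\<^sub>R lattice_pt \<gamma>) ^ m)"
        by (intro mult_right_mono) (auto simp: less_imp_le)
      ultimately show "cmod ((dir_deriv (lattice_pt \<gamma>) ^^ n) q \<beta> (\<xi> + t *\<^sub>R lattice_pt \<gamma>))
          \<le> \<bar>C\<bar> * weight \<gamma> ^ L * (2 ^ m * inverse (norm \<xi> ^ m))"
        using C[OF inX[OF t], of \<gamma>] by linarith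
    qed
    moreover have "taylor_rest n p q \<gamma> \<beta> \<xi> = q \<beta> (\<xi> + lattice_pt \<gamma>) - (\<Sum>i<n. taylor_term i (lattice_pt \<gamma>) q \<beta> \<xi>)"
      using eq[of "\<xi> + lattice_pt \<gamma>"] far[of 1] \<xi> by (simp add: taylor_rest_def)
    moreover have "\<bar>C\<bar> * weight \<gamma> ^ L * (2 ^ m * inverse (norm \<xi> ^ m))
        \<le> (\<bar>C\<bar> + P + (\<Sum>i<n. \<bar>D i\<bar>)) * weight \<gamma> ^ M * (2 ^ m * inverse (norm \<xi> ^ m))"
    proof (intro mult_right_mono mult_mono)
      show "\<bar>C\<bar> \<le> \<bar>C\<bar> + P + (\<Sum>i<n. \<bar>D i\<bar>)" using P(1) sum_nonneg[of "{..<n}" "\<lambda>i. \<bar>D i\<bar>"] by simp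
      show "weight \<gamma> ^ L \<le> weight \<gamma> ^ M" using weight_ge_1[of \<gamma>] by (intro power_increasing) (auto simp: M_def)
    qed (use P(1) in \<open>auto simp: less_imp_le intro!: add_nonneg_nonneg sum_nonneg\<close>)
    ultimately show ?thesis by (simp add: E_def mult_ac)
  next
    case False
    have \<xi>X: "\<xi> \<in> X" using \<xi> by (simp add: X_def)
    have small: "norm \<xi> \<le> 2 * weight \<gamma>" using False by (simp add: weight_def)
    have "norm \<xi> ^ m \<le> (2 * weight \<gamma>) ^ m" by (rule power_mono[OF small]) simp
    moreover have "norm \<xi> ^ m > 0" using X[OF \<xi>X] by simp
    ultimately have one: "1 \<le> 2 ^ m * weight \<gamma> ^ m * inverse (norm \<xi> ^ m)"
      by (simp add: field_simps power_mult_distrib)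
    have W: "weight \<gamma> ^ K i \<le> weight \<gamma> ^ (\<Sum>i<n. K i)" if "i < n" for i
      using weight_ge_1[of \<gamma>] that by (intro power_increasing member_le_sum) auto
    have T: "cmod (taylor_term i (lattice_pt \<gamma>) q \<beta> \<xi>) \<le> \<bar>D i\<bar> * weight \<gamma> ^ (\<Sum>i<n. K i)" if "i < n" for i
    proof -
      have "norm \<xi> powi (- int k - int i - int (mdeg \<beta>)) \<le> norm \<xi> powi 0"
        using \<xi> by (intro power_int_increasing) auto
      then have "D i * weight \<gamma> ^ K i * norm \<xi> powi (- int k - int i - int (mdeg \<beta>)) \<le> \<bar>D i\<bar> * weight \<gamma> ^ (\<Sum>i<n. K i) * 1"
        using W[OF that] by (intro mult_mono) (auto simp: less_imp_le)
      then show ?thesis using D[OF \<xi>X, where i=i and \<gamma>=\<gamma>] by simp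
    qed
    have "cmod (taylor_rest n p q \<gamma> \<beta> \<xi>) \<le> P + (\<Sum>i<n. \<bar>D i\<bar> * weight \<gamma> ^ (\<Sum>i<n. K i))"
      unfolding taylor_rest_def
      by (rule order_trans[OF norm_triangle_ineq4]) (intro add_mono P(2) sum_norm_le T, simp)
    also have "\<dots> = P * 1 + (\<Sum>i<n. \<bar>D i\<bar>) * weight \<gamma> ^ (\<Sum>i<n. K i)" by (simp add: sum_distrib_right)
    also have "\<dots> \<le> P * weight \<gamma> ^ (\<Sum>i<n. K i) + (\<Sum>i<n. \<bar>D i\<bar>) * weight \<gamma> ^ (\<Sum>i<n. K i)"
      using weight_ge_1[of \<gamma>] P(1) by (intro add_right_mono mult_left_mono one_le_power) auto
    also have "\<dots> = (P + (\<Sum>i<n. \<bar>D i\<bar>)) * weight \<gamma> ^ (\<Sum>i<n. K i) * 1" by (simp add: distrib_right)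
    also have "\<dots> \<le> (\<bar>C\<bar> + P + (\<Sum>i<n. \<bar>D i\<bar>)) * weight \<gamma> ^ (L + (\<Sum>i<n. K i)) * (2 ^ m * weight \<gamma> ^ m * inverse (norm \<xi> ^ m))"
      using one P(1) weight_ge_1[of \<gamma>]
      by (intro mult_mono power_increasing) (auto simp: less_imp_le intro!: add_nonneg_nonneg sum_nonneg mult_nonneg_nonneg)
    also have "\<dots> = E * weight \<gamma> ^ M * inverse (norm \<xi> ^ m)"
      by (simp add: E_def M_def power_add)
    finally show ?thesis .
  qed
  then show "\<exists>K C. \<forall>\<xi>\<in>{\<xi>. norm \<xi> \<ge> 1}. \<forall>\<gamma>.
      cmod (taylor_rest n p q \<gamma> \<beta> \<xi>) \<le> C * weight \<gamma> ^ K * norm \<xi> powi (- int k - int n - int (mdeg \<beta>))"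
    unfolding pw by blast
qed

section \<open>Asymptotic expansions of symbols\<close>

lemma jet_mult_zero_right [simp]: "jet_mult f (\<lambda>_ _. 0) \<beta> \<xi> = 0"
  using jet_mult_scale_right[of f 0 "\<lambda>_ _. 0" \<beta> \<xi>] by simp

lemma jet_mult_sum_right:
  "jet_mult f (\<lambda>\<beta> \<xi>. \<Sum>i\<in>I. g i \<beta> \<xi>) \<beta> \<xi> = (\<Sum>i\<in>I. jet_mult f (g i) \<beta> \<xi>)"
  by (induction I rule: infinite_finite_induct) (simp_all add: jet_mult_add_right)

lemma jet_mult_sum_left:
  "jet_mult (\<lambda>\<beta> \<xi>. \<Sum>i\<in>I. g i \<beta> \<xi>) f \<beta> \<xi> = (\<Sum>i\<in>I. jet_mult (g i) f \<beta> \<xi>)"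
  by (induction I rule: infinite_finite_induct) (simp_all add: jet_mult_add_left)

text \<open>A classical symbol of order at most zero, with \<open>G j\<close> its component of order \<open>- j\<close>. All operators
  below have order at most zero, and a common nominal order lets them be added without bookkeeping.\<close>

definition expansion :: "(nat^2 \<Rightarrow> real^2 \<Rightarrow> nct) \<Rightarrow> (nat \<Rightarrow> nat^2 \<Rightarrow> real^2 \<Rightarrow> nct) \<Rightarrow> bool" where
  "expansion F G \<longleftrightarrow> smooth_derivs UNIV F \<and> (\<forall>j. smooth_derivs (- {0}) (G j)) \<and>
     (\<forall>j t \<xi> \<gamma>. t > 0 \<longrightarrow> \<xi> \<noteq> 0 \<longrightarrow> G j 0 (t *\<^sub>R \<xi>) \<gamma> = of_real (t powi (- int j)) * G j 0 \<xi> \<gamma>) \<and>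
     (\<forall>N. rapid {\<xi>. norm \<xi> \<ge> 1} norm (- int N) (\<lambda>\<gamma> \<beta> \<xi>. F \<beta> \<xi> \<gamma> - (\<Sum>j<N. G j \<beta> \<xi> \<gamma>)))"

text \<open>A component is the difference of two consecutive remainders.\<close>

lemma expansion_component_rapid:
  assumes "expansion F G"
  shows "rapid {\<xi>. norm \<xi> \<ge> 1} norm (- int j) (\<lambda>\<gamma> \<beta> \<xi>. G j \<beta> \<xi> \<gamma>)"
proof -
  have r: "rapid {\<xi>. norm \<xi> \<ge> 1} norm (- int N) (\<lambda>\<gamma> \<beta> \<xi>. F \<beta> \<xi> \<gamma> - (\<Sum>j<N. G j \<beta> \<xi> \<gamma>))" for N
    using assms by (simp add: expansion_def)
  have "rapid {\<xi>. norm \<xi> \<ge> 1} norm (- int j)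
      (\<lambda>\<gamma> \<beta> \<xi>. (F \<beta> \<xi> \<gamma> - (\<Sum>j<j. G j \<beta> \<xi> \<gamma>)) - (F \<beta> \<xi> \<gamma> - (\<Sum>j<Suc j. G j \<beta> \<xi> \<gamma>)))"
    by (rule rapid_diff[OF r rapid_mono[OF r]]) auto
  then show ?thesis by (rule rapid_cong) simp
qed

lemma expansion_bounded:
  assumes "expansion F G"
  shows "\<exists>C. \<forall>\<xi> \<gamma>. cmod (F 0 \<xi> \<gamma>) \<le> C"
proof -
  have outer: "rapid {\<xi>. norm \<xi> \<ge> 1} norm (- int 0) (\<lambda>\<gamma> \<beta> \<xi>. F \<beta> \<xi> \<gamma> - (\<Sum>j<0. G j \<beta> \<xi> \<gamma>))"
    using assms unfolding expansion_def by blast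
  have "\<exists>C. \<forall>\<xi>\<in>{\<xi>. norm \<xi> \<ge> 1}. seminorm_le 0 (F 0 \<xi>) C"
    using spec[OF spec[OF outer[unfolded rapid_def], of 0], of 0] by simp
  then obtain C where C: "\<And>\<xi>. norm \<xi> \<ge> 1 \<Longrightarrow> seminorm_le 0 (F 0 \<xi>) C" by blast
  have inner: "rapid (cball 0 1) (\<lambda>_. 1) 0 (\<lambda>\<gamma> \<beta> \<xi>. F \<beta> \<xi> \<gamma>)"
    using assms by (intro smooth_derivs_rapid) (auto simp: expansion_def)
  have D_ex: "\<exists>C. \<forall>\<xi>\<in>cball 0 1. seminorm_le 0 (F 0 \<xi>) C"
    using spec[OF spec[OF inner[unfolded rapid_def], of 0], of 0] by simp
  then obtain D where D: "\<And>\<xi>. norm \<xi> \<le> 1 \<Longrightarrow> seminorm_le 0 (F 0 \<xi>) D" by (metis mem_cball_0)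
  have "cmod (F 0 \<xi> \<gamma>) \<le> max C D" for \<xi> \<gamma>
    using C[of \<xi>] D[of \<xi>] unfolding seminorm_le_def power_0 mult_1_left
    by (cases "norm \<xi> \<le> 1") (auto simp: le_max_iff_disj)
  then show ?thesis by blast
qed

lemma jet_index_nonzero: "\<beta> + axis a 1 \<noteq> (0 :: nat^2)"
proof
  assume "\<beta> + axis a 1 = 0"
  then have "mdeg (\<beta> + axis a 1) = 0" by (simp only: mdeg_0)
  then show False by simp
qed

lemma smooth_derivs_const:
  assumes "b \<in> nct_smooth" "open S"
  shows "smooth_derivs S (\<lambda>\<beta> _. if \<beta> = 0 then b else (\<lambda>_. 0))"
proof (rule smooth_derivsI[OF assms(2)])
  fix \<gamma>
  show "derivs_on S (\<lambda>\<beta> \<xi>. (if \<beta> = 0 then b else (\<lambda>_. 0)) \<gamma>)"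
    by (simp add: derivs_on_def jet_index_nonzero)
next
  fix K
  show "rapid K (\<lambda>_. 1) 0 (\<lambda>\<gamma> \<beta> \<xi>. (if \<beta> = 0 then b else (\<lambda>_. 0)) \<gamma>)"
    unfolding rapid_def
  proof (intro allI)
    fix \<beta> q
    obtain C where "seminorm_le q b C" using assms by (auto simp: nct_smooth_def)
    then show "\<exists>C. \<forall>\<xi>\<in>K. seminorm_le q (if \<beta> = 0 then b else (\<lambda>_. 0)) (C * 1 powi (0 - int (mdeg \<beta>)))"
      using seminorm_le_nonneg by (intro exI[of _ C]) auto
  qed
qed

lemma expansion_const:
  assumes "b \<in> nct_smooth"
  shows "expansion (\<lambda>\<beta> _. if \<beta> = 0 then b else (\<lambda>_. 0)) (\<lambda>j \<beta> _. if j = 0 \<and> \<beta> = 0 then b else (\<lambda>_. 0))"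
  unfolding expansion_def
proof (intro conjI allI impI)
  show "smooth_derivs UNIV (\<lambda>\<beta> _. if \<beta> = 0 then b else (\<lambda>_. 0))"
    by (rule smooth_derivs_const[OF assms]) simp
  fix j
  show "smooth_derivs (- {0}) (\<lambda>\<beta> _. if j = 0 \<and> \<beta> = 0 then b else (\<lambda>_. 0))"
    using smooth_derivs_const[OF assms, of "-{0}"] smooth_derivs_const[of "\<lambda>_. 0" "-{0}"]
    by (cases "j = 0") (auto simp: open_Compl)
next
  fix N
  show "rapid {\<xi>. 1 \<le> norm \<xi>} norm (- int N) (\<lambda>\<gamma> \<beta> \<xi>. (if \<beta> = 0 then b else (\<lambda>_. 0)) \<gamma> -
           (\<Sum>j<N. (if j = 0 \<and> \<beta> = 0 then b else (\<lambda>_. 0)) \<gamma>))"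
  proof (cases N)
    case 0
    have "rapid {\<xi>. 1 \<le> norm \<xi>} norm 0 (\<lambda>\<gamma> \<beta> \<xi>. (if \<beta> = 0 then b else (\<lambda>_. 0)) \<gamma>)"
      unfolding rapid_def
    proof (intro allI)
      fix \<beta> q
      obtain C where "seminorm_le q b C" using assms by (auto simp: nct_smooth_def)
      then show "\<exists>C. \<forall>\<xi>\<in>{\<xi>. 1 \<le> norm \<xi>}. seminorm_le q (if \<beta> = 0 then b else (\<lambda>_. 0)) (C * norm \<xi> powi (0 - int (mdeg \<beta>)))"
        using seminorm_le_nonneg by (intro exI[of _ C]) auto
    qed
    then show ?thesis using 0 by simp
  next
    case (Suc n)
    have "(\<Sum>j<N. (if j = 0 \<and> \<beta> = 0 then b else (\<lambda>_. 0)) \<gamma>) = (if \<beta> = 0 then b else (\<lambda>_. 0)) \<gamma>" for \<beta> :: "nat^2" and \<gamma>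
      by (simp add: Suc sum.lessThan_Suc_shift del: sum.lessThan_Suc)
    then show ?thesis using rapid_zero by simp
  qed
qed auto

lemma nct_mult_diff:
  assumes "b \<in> nct_smooth" "f \<in> nct_smooth" "g \<in> nct_smooth"
  shows "nct_mult \<theta> b (\<lambda>\<alpha>. f \<alpha> - g \<alpha>) = (\<lambda>\<gamma>. nct_mult \<theta> b f \<gamma> - nct_mult \<theta> b g \<gamma>)"
  using nct_mult_lincomb[OF assms(1) nct_smooth_bounded[OF assms(2)] nct_smooth_bounded[OF assms(3)], of \<theta> 1 "-1"]
  by simp

lemma rapid_left_mult:
  assumes "rapid X w d f" "b \<in> nct_smooth"
  shows "rapid X w d (\<lambda>\<gamma> \<beta> \<xi>. nct_mult \<theta> b (\<lambda>\<gamma>. f \<gamma> \<beta> \<xi>) \<gamma>)"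
  unfolding rapid_def
proof (intro allI)
  fix \<beta> q
  obtain C where C: "\<forall>\<xi>\<in>X. seminorm_le q (\<lambda>\<gamma>. f \<gamma> \<beta> \<xi>) (C * w \<xi> powi (d - int (mdeg \<beta>)))"
    using assms(1) unfolding rapid_def by blast
  obtain B where "\<And>a D. seminorm_le q a D \<Longrightarrow> seminorm_le q (nct_mult \<theta> b a) (B * D)"
    using nct_mult_seminorm[OF assms(2)] by blast
  with C show "\<exists>C. \<forall>\<xi>\<in>X. seminorm_le q (\<lambda>\<gamma>. nct_mult \<theta> b (\<lambda>\<gamma>. f \<gamma> \<beta> \<xi>) \<gamma>) (C * w \<xi> powi (d - int (mdeg \<beta>)))"
    by (intro exI[of _ "B * C"]) (simp add: mult.assoc)
qed

lemma smooth_derivs_left_mult: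
  assumes F: "smooth_derivs S F" and b: "b \<in> nct_smooth"
  shows "smooth_derivs S (\<lambda>\<beta> \<xi>. nct_mult \<theta> b (F \<beta> \<xi>))"
  unfolding smooth_derivs_def
proof (intro allI ballI conjI impI)
  fix \<beta> \<xi> assume \<xi>: "\<xi> \<in> S"
  have sm: "F \<beta> \<xi> \<in> nct_smooth" if "\<xi> \<in> S" for \<beta> \<xi> using F that by (simp add: smooth_derivs_def)
  show "nct_mult \<theta> b (F \<beta> \<xi>) \<in> nct_smooth" by (intro nct_smooth_mult b sm \<xi>)
  fix k and \<epsilon> :: real assume \<epsilon>: "\<epsilon> > 0"
  obtain B where "B \<ge> 0" and B: "\<And>a D. seminorm_le k a D \<Longrightarrow> seminorm_le k (nct_mult \<theta> b a) (B * D)"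
    using nct_mult_seminorm[OF b] by blast
  have e: "\<epsilon> / (B + 1) > 0" using \<epsilon> \<open>B \<ge> 0\<close> by simp
  have ev: "\<forall>\<^sub>F \<eta> in at \<xi>. seminorm_le k
        (\<lambda>\<alpha>. F \<beta> \<eta> \<alpha> - F \<beta> \<xi> \<alpha> - (\<Sum>a\<in>UNIV. of_real ((\<eta> - \<xi>) $ a) * F (\<beta> + axis a 1) \<xi> \<alpha>))
        (\<epsilon> / (B + 1) * norm (\<eta> - \<xi>))"
    using F \<xi> e unfolding smooth_derivs_def by blast
  show "\<forall>\<^sub>F \<eta> in at \<xi>. seminorm_le k
        (\<lambda>\<alpha>. nct_mult \<theta> b (F \<beta> \<eta>) \<alpha> - nct_mult \<theta> b (F \<beta> \<xi>) \<alpha> -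
          (\<Sum>a\<in>UNIV. of_real ((\<eta> - \<xi>) $ a) * nct_mult \<theta> b (F (\<beta> + axis a 1) \<xi>) \<alpha>))
        (\<epsilon> * norm (\<eta> - \<xi>))"
    using ev
  proof (rule eventually_mono)
    fix \<eta>
    let ?r = "\<lambda>\<alpha>. F \<beta> \<eta> \<alpha> - F \<beta> \<xi> \<alpha> - (\<Sum>a\<in>UNIV. of_real ((\<eta> - \<xi>) $ a) * F (\<beta> + axis a 1) \<xi> \<alpha>)"
    let ?l = "\<lambda>\<alpha>. F \<beta> \<xi> \<alpha> + (\<Sum>a\<in>UNIV. of_real ((\<eta> - \<xi>) $ a) * F (\<beta> + axis a 1) \<xi> \<alpha>)"
    assume r: "seminorm_le k ?r (\<epsilon> / (B + 1) * norm (\<eta> - \<xi>))"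
    have r_bounded: "\<exists>C. \<forall>\<alpha>. cmod (?r \<alpha>) \<le> C"
    proof (intro exI allI)
      fix \<alpha>
      have "cmod (?r \<alpha>) \<le> weight \<alpha> ^ k * cmod (?r \<alpha>)"
        using mult_right_mono[OF one_le_power[OF weight_ge_1[of \<alpha>], of k] norm_ge_zero[of "?r \<alpha>"]] by simp
      also have "\<dots> \<le> \<epsilon> / (B + 1) * norm (\<eta> - \<xi>)" using r by (simp add: seminorm_le_weight)
      finally show "cmod (?r \<alpha>) \<le> \<epsilon> / (B + 1) * norm (\<eta> - \<xi>)" .
    qed
    have l: "(\<lambda>\<alpha>. \<Sum>a\<in>UNIV. of_real ((\<eta> - \<xi>) $ a) * F (\<beta> + axis a 1) \<xi> \<alpha>) \<in> nct_smooth"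
      by (intro nct_smooth_sum nct_smooth_scale sm \<xi>)
    have l': "?l \<in> nct_smooth" by (intro nct_smooth_add sm \<xi> l)
    have "nct_mult \<theta> b (\<lambda>\<alpha>. 1 * ?r \<alpha> + 1 * ?l \<alpha>) =
        (\<lambda>\<alpha>. 1 * nct_mult \<theta> b ?r \<alpha> + 1 * nct_mult \<theta> b ?l \<alpha>)"
      by (rule nct_mult_lincomb[OF b r_bounded nct_smooth_bounded[OF l']])
    moreover have "nct_mult \<theta> b (\<lambda>\<alpha>. 1 * F \<beta> \<xi> \<alpha> + 1 * (\<Sum>a\<in>UNIV. of_real ((\<eta> - \<xi>) $ a) * F (\<beta> + axis a 1) \<xi> \<alpha>)) =
        (\<lambda>\<alpha>. 1 * nct_mult \<theta> b (F \<beta> \<xi>) \<alpha> + 1 * nct_mult \<theta> b (\<lambda>\<alpha>. \<Sum>a\<in>UNIV. of_real ((\<eta> - \<xi>) $ a) * F (\<beta> + axis a 1) \<xi> \<alpha>) \<alpha>)"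
      by (intro nct_mult_lincomb b nct_smooth_bounded sm \<xi> l)
    moreover have "nct_mult \<theta> b (\<lambda>\<alpha>. \<Sum>a\<in>UNIV. of_real ((\<eta> - \<xi>) $ a) * F (\<beta> + axis a 1) \<xi> \<alpha>) =
        (\<lambda>\<alpha>. \<Sum>a\<in>UNIV. of_real ((\<eta> - \<xi>) $ a) * nct_mult \<theta> b (F (\<beta> + axis a 1) \<xi>) \<alpha>)"
      by (intro nct_mult_sum b sm \<xi>)
    ultimately have "(\<lambda>\<alpha>. nct_mult \<theta> b (F \<beta> \<eta>) \<alpha> - nct_mult \<theta> b (F \<beta> \<xi>) \<alpha> -
          (\<Sum>a\<in>UNIV. of_real ((\<eta> - \<xi>) $ a) * nct_mult \<theta> b (F (\<beta> + axis a 1) \<xi>) \<alpha>)) = nct_mult \<theta> b ?r"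
      by (simp add: fun_eq_iff)
    moreover have "seminorm_le k (nct_mult \<theta> b ?r) (\<epsilon> * norm (\<eta> - \<xi>))"
    proof (rule seminorm_le_mono[OF B[OF r]])
      have "B * (\<epsilon> / (B + 1)) \<le> \<epsilon>" using \<epsilon> \<open>B \<ge> 0\<close> by (simp add: field_simps)
      then show "B * (\<epsilon> / (B + 1) * norm (\<eta> - \<xi>)) \<le> \<epsilon> * norm (\<eta> - \<xi>)"
        using mult_right_mono[of "B * (\<epsilon> / (B + 1))" \<epsilon> "norm (\<eta> - \<xi>)"] by (simp add: mult.assoc)
    qed
    ultimately show "seminorm_le k
        (\<lambda>\<alpha>. nct_mult \<theta> b (F \<beta> \<eta>) \<alpha> - nct_mult \<theta> b (F \<beta> \<xi>) \<alpha> -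
          (\<Sum>a\<in>UNIV. of_real ((\<eta> - \<xi>) $ a) * nct_mult \<theta> b (F (\<beta> + axis a 1) \<xi>) \<alpha>))
        (\<epsilon> * norm (\<eta> - \<xi>))" by simp
  qed
qed

lemma expansion_smooth:
  assumes "expansion F G"
  shows "F \<beta> \<xi> \<in> nct_smooth" "\<xi> \<noteq> 0 \<Longrightarrow> G j \<beta> \<xi> \<in> nct_smooth"
  using assms by (auto simp: expansion_def smooth_derivs_def)

lemma expansion_left_mult:
  assumes e: "expansion F G" and b: "b \<in> nct_smooth"
  shows "expansion (\<lambda>\<beta> \<xi>. nct_mult \<theta> b (F \<beta> \<xi>)) (\<lambda>j \<beta> \<xi>. nct_mult \<theta> b (G j \<beta> \<xi>))"
  unfolding expansion_def
proof (intro conjI allI impI)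
  show "smooth_derivs UNIV (\<lambda>\<beta> \<xi>. nct_mult \<theta> b (F \<beta> \<xi>))"
    using e by (intro smooth_derivs_left_mult b) (simp add: expansion_def)
  fix j
  show "smooth_derivs (- {0}) (\<lambda>\<beta> \<xi>. nct_mult \<theta> b (G j \<beta> \<xi>))"
    using e by (intro smooth_derivs_left_mult b) (simp add: expansion_def)
  fix t :: real and \<xi> :: "real^2" and \<gamma> assume "t > 0" "\<xi> \<noteq> 0"
  then have "G j 0 (t *\<^sub>R \<xi>) = (\<lambda>\<gamma>. of_real (t powi (- int j)) * G j 0 \<xi> \<gamma>)"
    using e by (simp add: expansion_def fun_eq_iff)
  then show "nct_mult \<theta> b (G j 0 (t *\<^sub>R \<xi>)) \<gamma> = of_real (t powi (- int j)) * nct_mult \<theta> b (G j 0 \<xi>) \<gamma>"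
    by (simp only: nct_mult_scale)
next
  fix N
  have "rapid {\<xi>. norm \<xi> \<ge> 1} norm (- int N)
      (\<lambda>\<gamma> \<beta> \<xi>. nct_mult \<theta> b (\<lambda>\<gamma>. F \<beta> \<xi> \<gamma> - (\<Sum>j<N. G j \<beta> \<xi> \<gamma>)) \<gamma>)"
    using e by (intro rapid_left_mult b) (simp add: expansion_def)
  then show "rapid {\<xi>. norm \<xi> \<ge> 1} norm (- int N)
      (\<lambda>\<gamma> \<beta> \<xi>. nct_mult \<theta> b (F \<beta> \<xi>) \<gamma> - (\<Sum>j<N. nct_mult \<theta> b (G j \<beta> \<xi>) \<gamma>))"
  proof (rule rapid_cong)
    fix \<gamma> \<beta> and \<xi> :: "real^2" assume "\<xi> \<in> {\<xi>. norm \<xi> \<ge> 1}"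
    then have "\<xi> \<noteq> 0" by auto
    then have G: "G j \<beta> \<xi> \<in> nct_smooth" for j by (rule expansion_smooth(2)[OF e])
    show "nct_mult \<theta> b (\<lambda>\<gamma>. F \<beta> \<xi> \<gamma> - (\<Sum>j<N. G j \<beta> \<xi> \<gamma>)) \<gamma> =
        nct_mult \<theta> b (F \<beta> \<xi>) \<gamma> - (\<Sum>j<N. nct_mult \<theta> b (G j \<beta> \<xi>) \<gamma>)"
      using nct_mult_sum[OF b G, where I = "{..<N}" and \<theta> = \<theta> and c = "\<lambda>_. 1"]
      by (simp add: nct_mult_diff b expansion_smooth(1)[OF e] nct_smooth_sum G)
  qed
qed

lemma smooth_derivs_add_scale:
  assumes "smooth_derivs S F" "smooth_derivs S F'" "open S"
  shows "smooth_derivs S (\<lambda>\<beta> \<xi> \<gamma>. F \<beta> \<xi> \<gamma> + c * F' \<beta> \<xi> \<gamma>)"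
proof (rule smooth_derivsI[OF assms(3)])
  show "derivs_on S (\<lambda>\<beta> \<xi>. F \<beta> \<xi> \<gamma> + c * F' \<beta> \<xi> \<gamma>)" for \<gamma>
    by (intro derivs_on_add derivs_on_scale smooth_derivs_derivs_on assms(1,2))
  show "rapid K (\<lambda>_. 1) 0 (\<lambda>\<gamma> \<beta> \<xi>. F \<beta> \<xi> \<gamma> + c * F' \<beta> \<xi> \<gamma>)" if "compact K" "K \<subseteq> S" for K
    by (rule rapid_add[OF smooth_derivs_rapid[OF assms(1) that] rapid_scale[OF smooth_derivs_rapid[OF assms(2) that]]])
qed

lemma expansion_add_scale:
  assumes e: "expansion F G" "expansion F' G'"
  shows "expansion (\<lambda>\<beta> \<xi> \<gamma>. F \<beta> \<xi> \<gamma> + c * F' \<beta> \<xi> \<gamma>) (\<lambda>j \<beta> \<xi> \<gamma>. G j \<beta> \<xi> \<gamma> + c * G' j \<beta> \<xi> \<gamma>)"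
  unfolding expansion_def
proof (intro conjI allI impI)
  show "smooth_derivs UNIV (\<lambda>\<beta> \<xi> \<gamma>. F \<beta> \<xi> \<gamma> + c * F' \<beta> \<xi> \<gamma>)"
    using e by (intro smooth_derivs_add_scale) (auto simp: expansion_def)
  fix j
  show "smooth_derivs (- {0}) (\<lambda>\<beta> \<xi> \<gamma>. G j \<beta> \<xi> \<gamma> + c * G' j \<beta> \<xi> \<gamma>)"
    using e by (intro smooth_derivs_add_scale) (auto simp: expansion_def open_Compl)
  fix t :: real and \<xi> :: "real^2" and \<gamma> assume "t > 0" "\<xi> \<noteq> 0"
  then show "G j 0 (t *\<^sub>R \<xi>) \<gamma> + c * G' j 0 (t *\<^sub>R \<xi>) \<gamma> = of_real (t powi (- int j)) * (G j 0 \<xi> \<gamma> + c * G' j 0 \<xi> \<gamma>)"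
    using e by (simp add: expansion_def distrib_left)
next
  fix N
  have r: "rapid {\<xi>. norm \<xi> \<ge> 1} norm (- int N) (\<lambda>\<gamma> \<beta> \<xi>. (F \<beta> \<xi> \<gamma> - (\<Sum>j<N. G j \<beta> \<xi> \<gamma>))
      + c * (F' \<beta> \<xi> \<gamma> - (\<Sum>j<N. G' j \<beta> \<xi> \<gamma>)))"
    using e by (intro rapid_add rapid_scale) (auto simp: expansion_def)
  have sums: "(\<Sum>j<N. G j \<beta> \<xi> \<gamma> + c * G' j \<beta> \<xi> \<gamma>) = (\<Sum>j<N. G j \<beta> \<xi> \<gamma>) + c * (\<Sum>j<N. G' j \<beta> \<xi> \<gamma>)"
    for \<beta> \<xi> \<gamma> by (simp only: sum.distrib sum_distrib_left)
  have "F \<beta> \<xi> \<gamma> - (\<Sum>j<N. G j \<beta> \<xi> \<gamma>) + c * (F' \<beta> \<xi> \<gamma> - (\<Sum>j<N. G' j \<beta> \<xi> \<gamma>)) =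
      F \<beta> \<xi> \<gamma> + c * F' \<beta> \<xi> \<gamma> - (\<Sum>j<N. G j \<beta> \<xi> \<gamma> + c * G' j \<beta> \<xi> \<gamma>)" for \<beta> \<xi> \<gamma>
    unfolding sums right_diff_distrib by simp
  then show "rapid {\<xi>. norm \<xi> \<ge> 1} norm (- int N) (\<lambda>\<gamma> \<beta> \<xi>. F \<beta> \<xi> \<gamma> + c * F' \<beta> \<xi> \<gamma>
      - (\<Sum>j<N. G j \<beta> \<xi> \<gamma> + c * G' j \<beta> \<xi> \<gamma>))"
    using r by (simp only:)
qed

lemma sum_triangle:
  fixes t :: "nat \<Rightarrow> nat \<Rightarrow> 'a::comm_monoid_add"
  shows "(\<Sum>j<N. \<Sum>l<Suc j - k. t (j - k - l) l) = (\<Sum>l<N - k. \<Sum>i<N - k - l. t i l)"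
proof (induction N)
  case (Suc N)
  show ?case
  proof (cases "k \<le> N")
    case True
    then have eq: "Suc N - k = Suc (N - k)" by simp
    have "(\<Sum>i<Suc (N - k) - l. t i l) = (\<Sum>i<N - k - l. t i l) + t (N - k - l) l" if "l < N - k" for l
      using that by (simp add: Suc_diff_le)
    then have split: "(\<Sum>l<Suc (N - k). \<Sum>i<Suc (N - k) - l. t i l)
        = (\<Sum>l<N - k. (\<Sum>i<N - k - l. t i l) + t (N - k - l) l) + t 0 (N - k)"
      by simp
    show ?thesis
      unfolding eq sum.lessThan_Suc[of _ N] Suc split
      by (simp only: sum.distrib sum.lessThan_Suc diff_self_eq_0 add.assoc)
  qed (use Suc in simp)
qed simp

text \<open>The heart of the symbol calculus. If \<open>P\<close> has symbol \<open>\<sigma>\<close>, then \<open>P\<close> maps the monomial \<open>U^\<alpha>\<close> to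
  \<open>\<sigma>(\<alpha>) U^\<alpha>\<close>, whose coefficient at the mode \<open>\<gamma> + \<alpha>\<close> comes from \<open>\<sigma>(\<alpha>)\<close> at \<open>\<gamma>\<close>. The multiplier \<open>p\<close>
  multiplies it by \<open>p (\<alpha> + \<gamma>)\<close>, so the symbol of the composition is exactly \<open>p (\<xi> + \<gamma>) \<sigma>(\<xi>)\<^sub>\<gamma>\<close>. Its
  expansion is obtained by replacing \<open>\<sigma>\<close> with finitely many components, and in each product with a
  component, \<open>p (\<xi> + \<gamma>)\<close> with as many Taylor terms as that component leaves room for.\<close>

lemma expansion_fourier:
  assumes e: "expansion F G" and pq: "fourier_symbol k p q"
  shows "expansion (\<lambda>\<beta> \<xi> \<gamma>. jet_mult (taylor_rest 0 p q \<gamma>) (\<lambda>\<beta> \<xi>. F \<beta> \<xi> \<gamma>) \<beta> \<xi>)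
    (\<lambda>j \<beta> \<xi> \<gamma>. \<Sum>l<Suc j - k. jet_mult (taylor_term (j - k - l) (lattice_pt \<gamma>) q) (\<lambda>\<beta> \<xi>. G l \<beta> \<xi> \<gamma>) \<beta> \<xi>)"
  unfolding expansion_def
proof (intro conjI allI impI)
  have p: "derivs_on UNIV p" and q: "derivs_on (- {0}) q" and hom: "homogeneous (- int k) q"
    using pq by (auto simp: fourier_symbol_def)
  have F: "smooth_derivs UNIV F" and G: "smooth_derivs (- {0}) (G j)" for j
    using e by (auto simp: expansion_def)
  show "smooth_derivs UNIV (\<lambda>\<beta> \<xi> \<gamma>. jet_mult (taylor_rest 0 p q \<gamma>) (\<lambda>\<beta> \<xi>. F \<beta> \<xi> \<gamma>) \<beta> \<xi>)"
  proof (rule smooth_derivsI)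
    fix \<gamma>
    have "derivs_on UNIV (taylor_rest 0 p q \<gamma>)"
      using derivs_on_translate[OF p] by (simp add: taylor_rest_def)
    then have "derivs_on UNIV (jet_mult (taylor_rest 0 p q \<gamma>) (\<lambda>\<beta> \<xi>. F \<beta> \<xi> \<gamma>))"
      by (rule derivs_on_jet_mult[OF _ smooth_derivs_derivs_on[OF F]])
    then show "derivs_on UNIV (\<lambda>\<beta> \<xi>. jet_mult (taylor_rest 0 p q \<gamma>) (\<lambda>\<beta> \<xi>. F \<beta> \<xi> \<gamma>) \<beta> \<xi>)" by simp
  next
    fix K :: "(real^2) set" assume K: "compact K"
    have "tempered K (\<lambda>_. 1) 0 (taylor_rest 0 p q)"
      unfolding tempered_def
    proof
      fix \<beta>
      obtain C where "\<forall>\<xi>. cmod (p \<beta> \<xi>) \<le> C" using fourier_symbol_bounded[OF pq] by blast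
      then show "\<exists>L C. \<forall>\<xi>\<in>K. \<forall>\<gamma>. cmod (taylor_rest 0 p q \<gamma> \<beta> \<xi>) \<le> C * weight \<gamma> ^ L * 1 powi (0 - int (mdeg \<beta>))"
        by (intro exI[of _ 0] exI[of _ C]) (simp add: taylor_rest_def)
    qed
    from rapid_jet_mult[OF this smooth_derivs_rapid[OF F K, of 0]]
    show "rapid K (\<lambda>_. 1) 0 (\<lambda>\<gamma> \<beta> \<xi>. jet_mult (taylor_rest 0 p q \<gamma>) (\<lambda>\<beta> \<xi>. F \<beta> \<xi> \<gamma>) \<beta> \<xi>)"
      by simp
  qed simp
  fix j
  show "smooth_derivs (- {0}) (\<lambda>\<beta> \<xi> \<gamma>. \<Sum>l<Suc j - k. jet_mult (taylor_term (j - k - l) (lattice_pt \<gamma>) q) (\<lambda>\<beta> \<xi>. G l \<beta> \<xi> \<gamma>) \<beta> \<xi>)"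
  proof (rule smooth_derivsI)
    fix \<gamma>
    show "derivs_on (- {0}) (\<lambda>\<beta> \<xi>. \<Sum>l<Suc j - k. jet_mult (taylor_term (j - k - l) (lattice_pt \<gamma>) q) (\<lambda>\<beta> \<xi>. G l \<beta> \<xi> \<gamma>) \<beta> \<xi>)"
      by (intro derivs_on_sum derivs_on_jet_mult derivs_on_taylor_term q smooth_derivs_derivs_on G)
  next
    fix K :: "(real^2) set" assume K: "compact K" "K \<subseteq> - {0}"
    show "rapid K (\<lambda>_. 1) 0 (\<lambda>\<gamma> \<beta> \<xi>. \<Sum>l<Suc j - k. jet_mult (taylor_term (j - k - l) (lattice_pt \<gamma>) q) (\<lambda>\<beta> \<xi>. G l \<beta> \<xi> \<gamma>) \<beta> \<xi>)"
    proof (rule rapid_sum)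
      fix l
      have "tempered K (\<lambda>_. 1) (int (j - k - l) - int (j - k - l)) (\<lambda>\<gamma>. taylor_term (j - k - l) (lattice_pt \<gamma>) q)"
        by (intro tempered_taylor_term tempered_compact[OF q K]) simp
      from rapid_jet_mult[OF this smooth_derivs_rapid[OF G K, of 0]]
      show "rapid K (\<lambda>_. 1) 0 (\<lambda>\<gamma> \<beta> \<xi>. jet_mult (taylor_term (j - k - l) (lattice_pt \<gamma>) q) (\<lambda>\<beta> \<xi>. G l \<beta> \<xi> \<gamma>) \<beta> \<xi>)"
        by simp
    qed
  qed (simp add: open_Compl)
  fix t :: real and \<xi> :: "real^2" and \<gamma> assume t: "t > 0" "\<xi> \<noteq> 0"
  have "taylor_term (j - k - l) (lattice_pt \<gamma>) q 0 (t *\<^sub>R \<xi>) * G l 0 (t *\<^sub>R \<xi>) \<gamma> =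
      of_real (t powi (- int j)) * (taylor_term (j - k - l) (lattice_pt \<gamma>) q 0 \<xi> * G l 0 \<xi> \<gamma>)"
    if "l < Suc j - k" for l
  proof -
    have "taylor_term (j - k - l) (lattice_pt \<gamma>) q 0 (t *\<^sub>R \<xi>) =
        of_real (t powi (- int k - int (j - k - l))) * taylor_term (j - k - l) (lattice_pt \<gamma>) q 0 \<xi>"
      using homogeneous_taylor_term[OF hom, unfolded homogeneous_def, rule_format, OF t, where \<beta> = 0] by simp
    moreover have "G l 0 (t *\<^sub>R \<xi>) \<gamma> = of_real (t powi (- int l)) * G l 0 \<xi> \<gamma>"
      using e t by (simp add: expansion_def)
    moreover have "t powi (- int j) = t powi (- int k - int (j - k - l)) * t powi (- int l)"
      using t that by (subst power_int_add[symmetric]) (auto simp: of_nat_diff)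
    ultimately show ?thesis by (simp only: of_real_mult mult_ac)
  qed
  then show "(\<Sum>l<Suc j - k. jet_mult (taylor_term (j - k - l) (lattice_pt \<gamma>) q) (\<lambda>\<beta> \<xi>. G l \<beta> \<xi> \<gamma>) 0 (t *\<^sub>R \<xi>)) =
     of_real (t powi (- int j)) * (\<Sum>l<Suc j - k. jet_mult (taylor_term (j - k - l) (lattice_pt \<gamma>) q) (\<lambda>\<beta> \<xi>. G l \<beta> \<xi> \<gamma>) 0 \<xi>)"
    by (simp add: sum_distrib_left)
next
  fix N
  let ?X = "{\<xi>::real^2. norm \<xi> \<ge> 1}" and ?n = "N - k"
  let ?S = "\<lambda>\<gamma> \<beta> \<xi>. F \<beta> \<xi> \<gamma> - (\<Sum>j<?n. G j \<beta> \<xi> \<gamma>)"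
  have pos: "norm \<xi> > 0" if "\<xi> \<in> ?X" for \<xi> using that by auto
  \<comment> \<open>the error of the expansion of \<open>\<sigma>\<close>, plus the Taylor errors in the products with its components\<close>
  have main: "rapid ?X norm (- int N) (\<lambda>\<gamma> \<beta> \<xi>. jet_mult (taylor_rest 0 p q \<gamma>) (?S \<gamma>) \<beta> \<xi>
      + (\<Sum>l<?n. jet_mult (taylor_rest (?n - l) p q \<gamma>) (\<lambda>\<beta> \<xi>. G l \<beta> \<xi> \<gamma>) \<beta> \<xi>))"
  proof (intro rapid_add rapid_sum)
    have "rapid ?X norm (- int k - int 0 + - int ?n) (\<lambda>\<gamma>. jet_mult (taylor_rest 0 p q \<gamma>) (?S \<gamma>))"
      using e by (intro rapid_jet_mult tempered_taylor_rest[OF pq] pos) (auto simp: expansion_def)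
    then show "rapid ?X norm (- int N) (\<lambda>\<gamma> \<beta> \<xi>. jet_mult (taylor_rest 0 p q \<gamma>) (?S \<gamma>) \<beta> \<xi>)"
      by (rule rapid_mono) auto
    fix l assume l: "l \<in> {..<?n}"
    have "rapid ?X norm (- int k - int (?n - l) + - int l) (\<lambda>\<gamma>. jet_mult (taylor_rest (?n - l) p q \<gamma>) (\<lambda>\<beta> \<xi>. G l \<beta> \<xi> \<gamma>))"
      by (intro rapid_jet_mult tempered_taylor_rest[OF pq] pos expansion_component_rapid[OF e])
    then show "rapid ?X norm (- int N) (\<lambda>\<gamma> \<beta> \<xi>. jet_mult (taylor_rest (?n - l) p q \<gamma>) (\<lambda>\<beta> \<xi>. G l \<beta> \<xi> \<gamma>) \<beta> \<xi>)"
      by (rule rapid_mono) (use l in auto)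
  qed
  then show "rapid ?X norm (- int N)
      (\<lambda>\<gamma> \<beta> \<xi>. jet_mult (taylor_rest 0 p q \<gamma>) (\<lambda>\<beta> \<xi>. F \<beta> \<xi> \<gamma>) \<beta> \<xi> -
        (\<Sum>j<N. \<Sum>l<Suc j - k. jet_mult (taylor_term (j - k - l) (lattice_pt \<gamma>) q) (\<lambda>\<beta> \<xi>. G l \<beta> \<xi> \<gamma>) \<beta> \<xi>))"
  proof (rule rapid_cong)
    fix \<gamma> \<beta> \<xi>
    let ?T = "\<lambda>i l. jet_mult (taylor_term i (lattice_pt \<gamma>) q) (\<lambda>\<beta> \<xi>. G l \<beta> \<xi> \<gamma>) \<beta> \<xi>"
    have rest: "taylor_rest 0 p q \<gamma> = (\<lambda>\<beta> \<xi>. taylor_rest n p q \<gamma> \<beta> \<xi> + (\<Sum>i<n. taylor_term i (lattice_pt \<gamma>) q \<beta> \<xi>))" for n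
      by (simp add: taylor_rest_def)
    have split: "jet_mult (taylor_rest 0 p q \<gamma>) g \<beta> \<xi> = jet_mult (taylor_rest n p q \<gamma>) g \<beta> \<xi>
        + (\<Sum>i<n. jet_mult (taylor_term i (lattice_pt \<gamma>) q) g \<beta> \<xi>)" for n g
      by (subst rest[of n]) (simp only: jet_mult_add_left jet_mult_sum_left)
    have "jet_mult (taylor_rest 0 p q \<gamma>) (\<lambda>\<beta> \<xi>. F \<beta> \<xi> \<gamma>) \<beta> \<xi> =
        jet_mult (taylor_rest 0 p q \<gamma>) (\<lambda>\<beta> \<xi>. ?S \<gamma> \<beta> \<xi> + (\<Sum>l<?n. G l \<beta> \<xi> \<gamma>)) \<beta> \<xi>" by simp
    also have "\<dots> = jet_mult (taylor_rest 0 p q \<gamma>) (?S \<gamma>) \<beta> \<xi>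
        + (\<Sum>l<?n. jet_mult (taylor_rest 0 p q \<gamma>) (\<lambda>\<beta> \<xi>. G l \<beta> \<xi> \<gamma>) \<beta> \<xi>)"
      by (simp only: jet_mult_add_right jet_mult_sum_right)
    also have "(\<Sum>l<?n. jet_mult (taylor_rest 0 p q \<gamma>) (\<lambda>\<beta> \<xi>. G l \<beta> \<xi> \<gamma>) \<beta> \<xi>) =
        (\<Sum>l<?n. jet_mult (taylor_rest (?n - l) p q \<gamma>) (\<lambda>\<beta> \<xi>. G l \<beta> \<xi> \<gamma>) \<beta> \<xi> + (\<Sum>i<?n - l. ?T i l))"
      by (intro sum.cong refl split)
    finally show "jet_mult (taylor_rest 0 p q \<gamma>) (?S \<gamma>) \<beta> \<xi>
      + (\<Sum>l<?n. jet_mult (taylor_rest (?n - l) p q \<gamma>) (\<lambda>\<beta> \<xi>. G l \<beta> \<xi> \<gamma>) \<beta> \<xi>) =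
      jet_mult (taylor_rest 0 p q \<gamma>) (\<lambda>\<beta> \<xi>. F \<beta> \<xi> \<gamma>) \<beta> \<xi> - (\<Sum>j<N. \<Sum>l<Suc j - k. ?T (j - k - l) l)"
      by (simp only: sum_triangle[of ?T] sum.distrib add.assoc[symmetric] add_diff_cancel_right')
  qed
qed

section \<open>Uniqueness of homogeneous components\<close>

lemma expansion_classical_symbol:
  assumes e: "expansion F G"
  shows "classical_symbol 0 (F 0) (\<lambda>k \<xi>. if k \<le> 0 then G (nat (- k)) 0 \<xi> else (\<lambda>_. 0))"
proof -
  define H where "H = (\<lambda>k \<beta> \<xi>. if k \<le> 0 then G (nat (- k)) \<beta> \<xi> else (\<lambda>_. 0))"
  have zero: "smooth_derivs (- {0}) (\<lambda>_ _ _. 0)"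
    using smooth_derivs_const[of "\<lambda>_. 0" "-{0}"] by (simp add: open_Compl)
  have sH: "smooth_derivs (- {0}) (H k)" for k :: int
    using e zero by (cases "k \<le> 0") (auto simp: H_def expansion_def)
  have hom: "H k 0 (t *\<^sub>R \<xi>) \<gamma> = of_real (t powi k) * H k 0 \<xi> \<gamma>" if "t > 0" "\<xi> \<noteq> 0" for k t \<xi> \<gamma>
  proof (cases "k \<le> 0")
    case True
    then have k: "- int (nat (- k)) = k" by simp
    from e that have "G (nat (- k)) 0 (t *\<^sub>R \<xi>) \<gamma> = of_real (t powi (- int (nat (- k)))) * G (nat (- k)) 0 \<xi> \<gamma>"
      unfolding expansion_def by blast
    then show ?thesis using True unfolding k by (simp add: H_def)
  qed (simp add: H_def)
  have bd: "\<exists>C. \<forall>\<xi>. norm \<xi> \<ge> 1 \<longrightarrow> seminorm_le q (\<lambda>\<alpha>. F \<beta> \<xi> \<alpha> - (\<Sum>j<N. H (0 - int j) \<beta> \<xi> \<alpha>))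
          (C * norm \<xi> powi (0 - int N - int (\<Sum>a\<in>UNIV. \<beta> $ a)))" for N \<beta> q
  proof -
    have "rapid {\<xi>. norm \<xi> \<ge> 1} norm (- int N) (\<lambda>\<gamma> \<beta> \<xi>. F \<beta> \<xi> \<gamma> - (\<Sum>j<N. G j \<beta> \<xi> \<gamma>))"
      using e by (simp add: expansion_def)
    from spec[OF spec[OF this[unfolded rapid_def], of \<beta>], of q]
    show ?thesis by (simp add: H_def mdeg_def)
  qed
  have "\<exists>F' G'. F' 0 = F 0 \<and> smooth_derivs UNIV F' \<and> (\<forall>k. G' k 0 = H k 0 \<and> smooth_derivs (- {0}) (G' k)) \<and>
     (\<forall>k t \<xi> \<alpha>. t > 0 \<longrightarrow> \<xi> \<noteq> 0 \<longrightarrow> H k 0 (t *\<^sub>R \<xi>) \<alpha> = of_real (t powi k) * H k 0 \<xi> \<alpha>) \<and>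
     (\<forall>k \<xi>. k > 0 \<longrightarrow> \<xi> \<noteq> 0 \<longrightarrow> H k 0 \<xi> = (\<lambda>_. 0)) \<and>
     (\<forall>N \<beta> q. \<exists>C. \<forall>\<xi>. norm \<xi> \<ge> 1 \<longrightarrow>
        seminorm_le q (\<lambda>\<alpha>. F' \<beta> \<xi> \<alpha> - (\<Sum>j<N. G' (0 - int j) \<beta> \<xi> \<alpha>))
          (C * norm \<xi> powi (0 - int N - int (\<Sum>a\<in>UNIV. \<beta> $ a))))"
    using e by (intro exI[of _ F] exI[of _ H] conjI allI impI sH hom bd) (auto simp: expansion_def H_def)
  then show ?thesis unfolding classical_symbol_def by (simp add: H_def)
qed

lemma quantize_U: "quantize \<theta> \<sigma> (nct_U \<alpha>) = nct_mult \<theta> (\<sigma> (lattice_pt \<alpha>)) (nct_U \<alpha>)"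
proof
  fix \<gamma>
  let ?g = "\<lambda>x. nct_U \<alpha> x * nct_mult \<theta> (\<sigma> (lattice_pt x)) (nct_U x) \<gamma>"
  have "quantize \<theta> \<sigma> (nct_U \<alpha>) \<gamma> = infsum ?g {\<alpha>}"
    unfolding quantize_def by (rule infsum_cong_neutral) (auto simp: nct_U_def)
  then show "quantize \<theta> \<sigma> (nct_U \<alpha>) \<gamma> = nct_mult \<theta> (\<sigma> (lattice_pt \<alpha>)) (nct_U \<alpha>) \<gamma>"
    by (simp add: nct_U_def)
qed

lemma nct_mult_U_right_cancel:
  assumes "nct_mult \<theta> a (nct_U \<alpha>) = nct_mult \<theta> b (nct_U \<alpha>)"
  shows "a = b"
proof
  fix \<gamma>
  have "nct_mult \<theta> a (nct_U \<alpha>) (\<gamma> + \<alpha>) = nct_mult \<theta> b (nct_U \<alpha>) (\<gamma> + \<alpha>)" using assms by simp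
  then show "a \<gamma> = b \<gamma>" by (simp add: nct_mult_U_right)
qed

text \<open>The order of a symbol may be raised, since the components above the original order vanish; so two
  symbols of the same operator can be compared at a common order \<open>M\<close>.\<close>

lemma classical_symbol_approx:
  assumes c: "classical_symbol m \<sigma> s" and mM: "m \<le> M"
  shows "\<exists>C. \<forall>\<xi>. norm \<xi> \<ge> 1 \<longrightarrow>
    cmod (\<sigma> \<xi> \<gamma> - (\<Sum>j<n. s (M - int j) \<xi> \<gamma>)) \<le> C * norm \<xi> powi (M - int n)"
proof -
  obtain F G where FG0: "F 0 = \<sigma>" "\<forall>k. G k 0 = s k \<and> smooth_derivs (- {0}) (G k)"
    and van: "\<forall>k \<xi>. k > m \<longrightarrow> \<xi> \<noteq> 0 \<longrightarrow> s k \<xi> = (\<lambda>_. 0)"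
    and rem: "\<forall>N (\<beta> :: nat^2) q. \<exists>C. \<forall>\<xi>. norm \<xi> \<ge> 1 \<longrightarrow> seminorm_le q (\<lambda>\<alpha>. F \<beta> \<xi> \<alpha> - (\<Sum>j<N. G (m - int j) \<beta> \<xi> \<alpha>))
          (C * norm \<xi> powi (m - int N - int (\<Sum>a\<in>UNIV. \<beta> $ a)))"
    using c unfolding classical_symbol_def by blast
  then have FG: "F 0 = \<sigma>" "\<And>k. G k 0 = s k" by auto
  \<comment> \<open>the first \<open>e\<close> components in the numbering from \<open>M\<close> vanish\<close>
  define e where "e = nat (M - m)"
  define N where "N = n - e"
  obtain C where "\<forall>\<xi>. norm \<xi> \<ge> 1 \<longrightarrow> seminorm_le 0 (\<lambda>\<alpha>. F 0 \<xi> \<alpha> - (\<Sum>j<N. G (m - int j) 0 \<xi> \<alpha>))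
          (C * norm \<xi> powi (m - int N - int (\<Sum>a\<in>UNIV. (0::nat^2) $ a)))"
    using rem by blast
  then have C: "\<And>\<xi>. norm \<xi> \<ge> 1 \<Longrightarrow> cmod (\<sigma> \<xi> \<gamma> - (\<Sum>j<N. s (m - int j) \<xi> \<gamma>)) \<le> C * norm \<xi> powi (m - int N)"
    unfolding seminorm_le_def FG by simp
  have "cmod (\<sigma> \<xi> \<gamma> - (\<Sum>j<n. s (M - int j) \<xi> \<gamma>)) \<le> \<bar>C\<bar> * norm \<xi> powi (M - int n)" if \<xi>: "norm \<xi> \<ge> 1" for \<xi>
  proof -
    have \<xi>0: "\<xi> \<noteq> 0" using \<xi> by auto
    have "(\<Sum>j<n. s (M - int j) \<xi> \<gamma>) = (\<Sum>j\<in>{e..<n}. s (M - int j) \<xi> \<gamma>)"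
      by (rule sum.mono_neutral_right) (use van \<xi>0 mM in \<open>auto simp: e_def\<close>)
    also have "\<dots> = (\<Sum>j<N. s (m - int j) \<xi> \<gamma>)"
      by (rule sum.reindex_bij_witness[of _ "\<lambda>j. j + e" "\<lambda>j. j - e"]) (use mM in \<open>auto simp: N_def e_def\<close>)
    finally have eq: "(\<Sum>j<n. s (M - int j) \<xi> \<gamma>) = (\<Sum>j<N. s (m - int j) \<xi> \<gamma>)" .
    have "m - int N \<le> M - int n" using mM by (auto simp: N_def e_def)
    then have "norm \<xi> powi (m - int N) \<le> norm \<xi> powi (M - int n)"
      using \<xi> by (intro power_int_increasing) auto
    then have "C * norm \<xi> powi (m - int N) \<le> \<bar>C\<bar> * norm \<xi> powi (M - int n)"
      by (intro mult_mono) auto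
    then show ?thesis using C[OF \<xi>] eq by simp
  qed
  then show ?thesis by blast
qed

lemma lattice_pt_nat_scale: "lattice_pt (\<chi> a. int t * \<alpha> $ a) = real t *\<^sub>R lattice_pt \<alpha>"
  by (simp add: vec_eq_iff)

lemma classical_symbol_homogeneous:
  "classical_symbol m \<sigma> s \<Longrightarrow> t > 0 \<Longrightarrow> \<xi> \<noteq> 0 \<Longrightarrow> s k (t *\<^sub>R \<xi>) \<gamma> = of_real (t powi k) * s k \<xi> \<gamma>"
  unfolding classical_symbol_def by blast

lemma classical_symbol_vanishing:
  "classical_symbol m \<sigma> s \<Longrightarrow> k > m \<Longrightarrow> \<xi> \<noteq> 0 \<Longrightarrow> s k \<xi> = (\<lambda>_. 0)"
  unfolding classical_symbol_def by blast

lemma classical_symbol_continuous: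
  assumes "classical_symbol m \<sigma> s"
  shows "continuous_on (- {0}) (\<lambda>\<xi>. s k \<xi> \<gamma>)"
proof -
  obtain G where "\<forall>k. G k 0 = s k \<and> smooth_derivs (- {0}) (G k)"
    using assms unfolding classical_symbol_def by blast
  then have G: "G k 0 = s k" "smooth_derivs (- {0}) (G k)" for k by auto
  from derivs_on_continuous[OF smooth_derivs_derivs_on[OF G(2)], where \<beta> = 0]
  show ?thesis by (simp add: G(1))
qed

text \<open>Along the ray through a lattice point \<open>\<alpha>\<close> the integral multiples \<open>t \<alpha>\<close> are lattice points again,
  and there the component of order \<open>k\<close> grows like \<open>t^k\<close>. Comparing both expansions as \<open>t\<close> tends to
  infinity determines the components one after the other, from the top order downwards.\<close>

lemma components_agree_at_lattice_points:
  assumes c: "classical_symbol m \<sigma> s" "classical_symbol m' \<sigma>' s'"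
    and eq: "\<And>\<alpha>. \<sigma> (lattice_pt \<alpha>) = \<sigma>' (lattice_pt \<alpha>)"
    and \<alpha>: "\<alpha> \<noteq> 0"
  shows "s k (lattice_pt \<alpha>) \<gamma> = s' k (lattice_pt \<alpha>) \<gamma>"
proof -
  define M where "M = max m m'"
  define x where "x = lattice_pt \<alpha>"
  have x: "norm x \<ge> 1" "x \<noteq> 0" using norm_lattice_pt_ge_1[OF \<alpha>] by (auto simp: x_def)
  have "s (M - int j) x \<gamma> = s' (M - int j) x \<gamma>" for j
  proof (induction j rule: less_induct)
    case (less j)
    define e where "e = M - int (Suc j)"
    obtain C where C: "\<And>\<xi>. norm \<xi> \<ge> 1 \<Longrightarrow> cmod (\<sigma> \<xi> \<gamma> - (\<Sum>i<Suc j. s (M - int i) \<xi> \<gamma>)) \<le> C * norm \<xi> powi e"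
      using classical_symbol_approx[OF c(1), of M \<gamma> "Suc j"] unfolding M_def e_def by (auto simp del: sum.lessThan_Suc of_nat_Suc)
    obtain D where D: "\<And>\<xi>. norm \<xi> \<ge> 1 \<Longrightarrow> cmod (\<sigma>' \<xi> \<gamma> - (\<Sum>i<Suc j. s' (M - int i) \<xi> \<gamma>)) \<le> D * norm \<xi> powi e"
      using classical_symbol_approx[OF c(2), of M \<gamma> "Suc j"] unfolding M_def e_def by (auto simp del: sum.lessThan_Suc of_nat_Suc)
    let ?d = "s (M - int j) x \<gamma> - s' (M - int j) x \<gamma>"
    define B where "B = (C + D) * norm x powi e"
    have le: "cmod ?d * real t \<le> B" if t: "t \<ge> 1" for t :: nat
    proof -
      have tx: "real t *\<^sub>R x = lattice_pt (\<chi> a. int t * \<alpha> $ a)" by (simp add: lattice_pt_nat_scale x_def)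
      have "1 * 1 \<le> real t * norm x" using t x by (intro mult_mono) auto
      then have n: "norm (real t *\<^sub>R x) \<ge> 1" by simp
      have scale: "s k (real t *\<^sub>R x) \<gamma> = of_real (real t powi k) * s k x \<gamma>"
        "s' k (real t *\<^sub>R x) \<gamma> = of_real (real t powi k) * s' k x \<gamma>" for k
        by (rule classical_symbol_homogeneous[OF c(1)] classical_symbol_homogeneous[OF c(2)]; use t x(2) in simp)+
      have "(\<Sum>i<j. s (M - int i) (real t *\<^sub>R x) \<gamma>) = (\<Sum>i<j. s' (M - int i) (real t *\<^sub>R x) \<gamma>)"
        unfolding scale by (intro sum.cong refl) (simp add: less)
      then have "of_real (real t powi (M - int j)) * ?d =
          (\<sigma>' (real t *\<^sub>R x) \<gamma> - (\<Sum>i<Suc j. s' (M - int i) (real t *\<^sub>R x) \<gamma>)) -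
          (\<sigma> (real t *\<^sub>R x) \<gamma> - (\<Sum>i<Suc j. s (M - int i) (real t *\<^sub>R x) \<gamma>))"
        using eq[of "\<chi> a. int t * \<alpha> $ a"] by (simp add: tx[symmetric] scale algebra_simps)
      then have "cmod (of_real (real t powi (M - int j)) * ?d) \<le>
          D * norm (real t *\<^sub>R x) powi e + C * norm (real t *\<^sub>R x) powi e"
        using order_trans[OF norm_triangle_ineq4 add_mono[OF D[OF n] C[OF n]]] by (simp only:)
      also have "\<dots> = (C + D) * (real t powi e * norm x powi e)"
        by (simp add: power_int_mult_distrib algebra_simps)
      finally have "real t powi (M - int j) * cmod ?d \<le> real t powi e * B"
        unfolding norm_mult norm_of_real B_def by (simp add: mult_ac)
      moreover have "real t powi (M - int j) = real t powi e * real t"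
        using t by (subst power_int_add_1[symmetric]) (auto simp: e_def)
      ultimately have "real t powi e * (cmod ?d * real t) \<le> real t powi e * B" by (simp add: mult_ac)
      then show ?thesis using t by simp
    qed
    have "cmod ?d = 0"
    proof (rule ccontr)
      assume "cmod ?d \<noteq> 0"
      then have pos: "cmod ?d > 0" by simp
      obtain t :: nat where t: "real t > B / cmod ?d" using reals_Archimedean2 by blast
      have "B < cmod ?d * real t" using t pos by (simp add: pos_divide_less_eq mult.commute)
      also have "\<dots> \<le> cmod ?d * real (Suc t)" using pos by simp
      also have "\<dots> \<le> B" by (rule le) simp
      finally show False by simp
    qed
    then show ?case by simp
  qed
  note below = this
  show ?thesis
  proof (cases "k \<le> M")
    case True
    then have "k = M - int (nat (M - k))" by simp
    then show ?thesis using below[of "nat (M - k)"] by (simp add: x_def)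
  next
    case False
    then show ?thesis
      using classical_symbol_vanishing[OF c(1) _ x(2)] classical_symbol_vanishing[OF c(2) _ x(2)]
      by (simp add: M_def x_def)
  qed
qed

lemma rational_directions_dense:
  fixes \<xi> :: "real^2"
  shows "(\<lambda>n. (1 / real (Suc n)) *\<^sub>R lattice_pt (\<chi> a. \<lfloor>real (Suc n) * \<xi> $ a\<rfloor>)) \<longlonglongrightarrow> \<xi>"
proof (rule vec_tendstoI)
  fix a
  let ?f = "\<lambda>n. of_int \<lfloor>real (Suc n) * \<xi> $ a\<rfloor> / real (Suc n)"
  have "?f \<longlonglongrightarrow> \<xi> $ a"
  proof (rule tendsto_sandwich)
    show "\<forall>\<^sub>F n in sequentially. \<xi> $ a - inverse (real (Suc n)) \<le> ?f n"
    proof (intro always_eventually allI)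
      fix n
      have "real (Suc n) * \<xi> $ a - 1 \<le> of_int \<lfloor>real (Suc n) * \<xi> $ a\<rfloor>" by linarith
      then have "(real (Suc n) * \<xi> $ a - 1) / real (Suc n) \<le> ?f n" by (intro divide_right_mono) auto
      then show "\<xi> $ a - inverse (real (Suc n)) \<le> ?f n"
        by (simp add: diff_divide_distrib inverse_eq_divide del: of_nat_Suc)
    qed
    show "\<forall>\<^sub>F n in sequentially. ?f n \<le> \<xi> $ a"
    proof (intro always_eventually allI)
      fix n
      have "?f n \<le> (real (Suc n) * \<xi> $ a) / real (Suc n)" by (intro divide_right_mono) auto
      then show "?f n \<le> \<xi> $ a" by (simp del: of_nat_Suc)
    qed
    show "(\<lambda>n. \<xi> $ a - inverse (real (Suc n))) \<longlonglongrightarrow> \<xi> $ a"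
      using tendsto_diff[OF tendsto_const LIMSEQ_inverse_real_of_nat, of "\<xi> $ a"] by simp
  qed simp
  then show "(\<lambda>n. ((1 / real (Suc n)) *\<^sub>R lattice_pt (\<chi> a. \<lfloor>real (Suc n) * \<xi> $ a\<rfloor>)) $ a) \<longlonglongrightarrow> \<xi> $ a"
    by simp
qed

text \<open>By homogeneity the components agree in all rational directions; these are dense, and the components
  are continuous away from the origin. Hence the component chosen in the definition of the residue
  can be computed from any symbol of the operator.\<close>

lemma homogeneous_components_unique:
  assumes "has_homogeneous_components \<theta> P s" "has_homogeneous_components \<theta> P s'" and \<xi>: "\<xi> \<noteq> 0"
  shows "s k \<xi> = s' k \<xi>"
proof
  fix \<gamma>
  obtain m \<sigma> where c: "classical_symbol m \<sigma> s" and P: "\<And>a. a \<in> nct_smooth \<Longrightarrow> P a = Some (quantize \<theta> \<sigma> a)"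
    using assms(1) unfolding has_homogeneous_components_def by blast
  obtain m' \<sigma>' where c': "classical_symbol m' \<sigma>' s'" and P': "\<And>a. a \<in> nct_smooth \<Longrightarrow> P a = Some (quantize \<theta> \<sigma>' a)"
    using assms(2) unfolding has_homogeneous_components_def by blast
  have "\<sigma> (lattice_pt \<alpha>) = \<sigma>' (lattice_pt \<alpha>)" for \<alpha>
  proof (rule nct_mult_U_right_cancel)
    show "nct_mult \<theta> (\<sigma> (lattice_pt \<alpha>)) (nct_U \<alpha>) = nct_mult \<theta> (\<sigma>' (lattice_pt \<alpha>)) (nct_U \<alpha>)"
      using P[of "nct_U \<alpha>"] P'[of "nct_U \<alpha>"] by (simp add: quantize_U)
  qed
  note lattice = components_agree_at_lattice_points[OF c c' this]
  let ?x = "\<lambda>n. (1 / real (Suc n)) *\<^sub>R lattice_pt (\<chi> a. \<lfloor>real (Suc n) * \<xi> $ a\<rfloor>)"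
  have ev: "\<forall>\<^sub>F n in sequentially. ?x n \<noteq> 0"
    by (rule tendsto_imp_eventually_ne[OF rational_directions_dense \<xi>])
  have agree: "\<forall>\<^sub>F n in sequentially. s k (?x n) \<gamma> = s' k (?x n) \<gamma>"
    using ev
  proof (rule eventually_mono)
    fix n assume "?x n \<noteq> 0"
    then have n: "lattice_pt (\<chi> a. \<lfloor>real (Suc n) * \<xi> $ a\<rfloor>) \<noteq> 0" by auto
    then have n': "(\<chi> a. \<lfloor>real (Suc n) * \<xi> $ a\<rfloor>) \<noteq> 0" using lattice_pt_zero by force
    show "s k (?x n) \<gamma> = s' k (?x n) \<gamma>"
      using classical_symbol_homogeneous[OF c _ n, of "1 / real (Suc n)" k \<gamma>]
        classical_symbol_homogeneous[OF c' _ n, of "1 / real (Suc n)" k \<gamma>] lattice[OF n', of k \<gamma>]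
      by (simp del: of_nat_Suc)
  qed
  have lim: "(\<lambda>n. u k (?x n) \<gamma>) \<longlonglongrightarrow> u k \<xi> \<gamma>" if "classical_symbol m \<tau> u" for m \<tau> u
  proof (rule continuous_on_tendsto_compose[OF classical_symbol_continuous[OF that] rational_directions_dense])
    show "\<xi> \<in> - {0}" using \<xi> by simp
    show "\<forall>\<^sub>F n in sequentially. ?x n \<in> - {0}" using ev by (rule eventually_mono) simp
  qed
  have "(\<lambda>n. s' k (?x n) \<gamma>) \<longlonglongrightarrow> s k \<xi> \<gamma>"
    by (rule tendsto_cong[OF agree, THEN iffD1, OF lim[OF c]])
  then show "s k \<xi> \<gamma> = s' k \<xi> \<gamma>"
    by (rule LIMSEQ_unique[OF _ lim[OF c']])
qed

section \<open>Symbol calculus\<close>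

text \<open>The operator \<open>T\<close>, on smooth elements, has a classical symbol whose component of order \<open>- j\<close> is \<open>s j\<close>.
  The rules below follow the components through left multiplications, linear combinations and
  Fourier multipliers.\<close>

definition pdo :: "real \<Rightarrow> (nct \<Rightarrow> nct) \<Rightarrow> (nat \<Rightarrow> real^2 \<Rightarrow> nct) \<Rightarrow> bool" where
  "pdo \<theta> T s \<longleftrightarrow> (\<exists>F G. expansion F G \<and> (\<forall>j. G j 0 = s j) \<and> (\<forall>a\<in>nct_smooth. T a = quantize \<theta> (F 0) a))"

lemma homogeneous_component_pdo:
  assumes T: "pdo \<theta> T s" and P: "\<And>a. a \<in> nct_smooth \<Longrightarrow> P a = Some (T a)" and \<xi>: "\<xi> \<noteq> 0"
  shows "homogeneous_component \<theta> P (- int j) \<xi> = s j \<xi>"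
proof -
  obtain F G where e: "expansion F G" "\<And>j. G j 0 = s j" "\<And>a. a \<in> nct_smooth \<Longrightarrow> T a = quantize \<theta> (F 0) a"
    using T unfolding pdo_def by blast
  let ?s = "\<lambda>k \<xi>. if k \<le> 0 then G (nat (- k)) 0 \<xi> else (\<lambda>_. 0)"
  have has: "has_homogeneous_components \<theta> P ?s"
    unfolding has_homogeneous_components_def using expansion_classical_symbol[OF e(1)] e(3) P
    by (intro exI[of _ 0] exI[of _ "F 0"]) simp
  then have "has_homogeneous_components \<theta> P (homogeneous_component \<theta> P)"
    unfolding homogeneous_component_def by (rule someI[where P = "has_homogeneous_components \<theta> P"])
  from homogeneous_components_unique[OF this has \<xi>, of "- int j"] show ?thesis by (simp add: e(2))
qed

lemma quantize_abs_summable: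
  assumes "a \<in> nct_smooth" "\<And>\<xi> \<gamma>. cmod (\<sigma> \<xi> \<gamma>) \<le> C"
  shows "(\<lambda>\<alpha>. norm (a \<alpha> * nct_mult \<theta> (\<sigma> (lattice_pt \<alpha>)) (nct_U \<alpha>) \<gamma>)) summable_on UNIV"
proof -
  have "(\<lambda>\<alpha>. C * cmod (a \<alpha>)) summable_on UNIV"
    by (intro summable_on_cmult_right nct_smooth_abs_summable assms)
  then show ?thesis
  proof (rule summable_on_comparison_test)
    fix \<alpha>
    show "norm (a \<alpha> * nct_mult \<theta> (\<sigma> (lattice_pt \<alpha>)) (nct_U \<alpha>) \<gamma>) \<le> C * cmod (a \<alpha>)"
      unfolding nct_mult_U_right norm_mult norm_cis mult_1_right mult.commute[of C]
      by (intro mult_left_mono assms(2)) simp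
  qed simp
qed

lemma quantize_one: "quantize \<theta> (\<lambda>_. nct_U 0) a = a"
proof
  fix \<gamma>
  have unit: "nct_mult \<theta> (nct_U 0) (nct_U \<alpha>) = nct_U \<alpha>" for \<alpha>
    by (simp add: nct_mult_U)
  have "quantize \<theta> (\<lambda>_. nct_U 0) a \<gamma> = infsum (\<lambda>\<alpha>. a \<alpha> * nct_U \<alpha> \<gamma>) {\<gamma>}"
    unfolding quantize_def unit by (rule infsum_cong_neutral) (auto simp: nct_U_def)
  then show "quantize \<theta> (\<lambda>_. nct_U 0) a \<gamma> = a \<gamma>" by (simp add: nct_U_def)
qed

lemma pdoI:
  assumes "expansion F G" "\<And>j. G j 0 = s j" "\<And>a. a \<in> nct_smooth \<Longrightarrow> T a = quantize \<theta> (F 0) a"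
  shows "pdo \<theta> T s"
  using assms unfolding pdo_def by blast

lemma pdo_id: "pdo \<theta> (\<lambda>a. a) (\<lambda>j _. if j = 0 then nct_U 0 else (\<lambda>_. 0))"
  by (rule pdoI[OF expansion_const[OF nct_smooth_U[of 0]]]) (auto simp: quantize_one fun_eq_iff)

text \<open>Left multiplication of an operator is left multiplication of its symbol. The double series converges
  absolutely because the coefficients of the symbol are bounded while those of \<open>a\<close> and \<open>b\<close> are summable.\<close>

lemma quantize_left_mult:
  assumes b: "b \<in> nct_smooth" and a: "a \<in> nct_smooth" and C: "\<And>\<xi> \<gamma>. cmod (\<sigma> \<xi> \<gamma>) \<le> C"
  shows "nct_mult \<theta> b (quantize \<theta> \<sigma> a) = quantize \<theta> (\<lambda>\<xi>. nct_mult \<theta> b (\<sigma> \<xi>)) a"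
proof
  fix \<gamma> :: "int^2"
  let ?c = "\<lambda>\<beta>. cis (- 2 * pi * \<theta> * real_of_int (\<beta> $ 2) * real_of_int ((\<gamma> - \<beta>) $ 1))"
  let ?x = "\<lambda>\<alpha>. nct_mult \<theta> (\<sigma> (lattice_pt \<alpha>)) (nct_U \<alpha>)"
  let ?t = "\<lambda>\<beta> \<alpha>. b \<beta> * (a \<alpha> * ?x \<alpha> (\<gamma> - \<beta>)) * ?c \<beta>"
  have x: "cmod (?x \<alpha> \<delta>) \<le> C" for \<alpha> \<delta> by (simp add: nct_mult_U_right norm_mult C)
  have C0: "C \<ge> 0" using order_trans[OF norm_ge_zero C] .
  have "(\<lambda>z. norm (case z of (\<beta>, \<alpha>) \<Rightarrow> ?t \<beta> \<alpha>)) summable_on UNIV \<times> UNIV"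
  proof (rule Infinite_Sum.abs_summable_on_comparison_test')
    show "(\<lambda>(\<beta>, \<alpha>). (C * cmod (b \<beta>)) * cmod (a \<alpha>)) summable_on UNIV \<times> UNIV"
    proof (rule summable_on_SigmaI)
      show "((\<lambda>\<alpha>. case (\<beta>, \<alpha>) of (\<beta>, \<alpha>) \<Rightarrow> (C * cmod (b \<beta>)) * cmod (a \<alpha>)) has_sum
          (C * cmod (b \<beta>)) * infsum (\<lambda>\<alpha>. cmod (a \<alpha>)) UNIV) UNIV" for \<beta>
        unfolding prod.case by (intro has_sum_cmult_right has_sum_infsum nct_smooth_abs_summable a)
      show "(\<lambda>\<beta>. (C * cmod (b \<beta>)) * infsum (\<lambda>\<alpha>. cmod (a \<alpha>)) UNIV) summable_on UNIV"
        by (intro summable_on_cmult_left summable_on_cmult_right nct_smooth_abs_summable b)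
    qed (use C0 in auto)
    fix z :: "(int^2) \<times> (int^2)"
    obtain \<beta> \<alpha> where z: "z = (\<beta>, \<alpha>)" by (cases z)
    have "cmod (b \<beta>) * cmod (a \<alpha>) * cmod (?x \<alpha> (\<gamma> - \<beta>)) \<le> cmod (b \<beta>) * cmod (a \<alpha>) * C"
      by (intro mult_left_mono x) auto
    then show "norm (case z of (\<beta>, \<alpha>) \<Rightarrow> ?t \<beta> \<alpha>) \<le> (case z of (\<beta>, \<alpha>) \<Rightarrow> (C * cmod (b \<beta>)) * cmod (a \<alpha>))"
      unfolding z prod.case norm_mult norm_cis by (simp add: mult_ac)
  qed
  then have s: "(\<lambda>(\<beta>, \<alpha>). ?t \<beta> \<alpha>) summable_on UNIV \<times> UNIV" by (rule abs_summable_summable)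
  have "nct_mult \<theta> b (quantize \<theta> \<sigma> a) \<gamma> = (\<Sum>\<^sub>\<infinity>\<beta>. \<Sum>\<^sub>\<infinity>\<alpha>. ?t \<beta> \<alpha>)"
    unfolding nct_mult_def[of \<theta> b] quantize_def
    by (simp only: infsum_cmult_right' infsum_cmult_left')
  also have "\<dots> = (\<Sum>\<^sub>\<infinity>\<alpha>. \<Sum>\<^sub>\<infinity>\<beta>. ?t \<beta> \<alpha>)" by (rule infsum_swap_banach[OF s])
  also have "\<dots> = (\<Sum>\<^sub>\<infinity>\<alpha>. a \<alpha> * nct_mult \<theta> b (?x \<alpha>) \<gamma>)"
    unfolding nct_mult_def[of \<theta> b] infsum_cmult_right'[symmetric] by (simp add: mult_ac)
  also have "\<dots> = quantize \<theta> (\<lambda>\<xi>. nct_mult \<theta> b (\<sigma> \<xi>)) a \<gamma>"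
    unfolding nct_mult_assoc_U quantize_def ..
  finally show "nct_mult \<theta> b (quantize \<theta> \<sigma> a) \<gamma> = quantize \<theta> (\<lambda>\<xi>. nct_mult \<theta> b (\<sigma> \<xi>)) a \<gamma>" .
qed

lemma pdo_left_mult:
  assumes T: "pdo \<theta> T s" and b: "b \<in> nct_smooth"
  shows "pdo \<theta> (\<lambda>a. nct_mult \<theta> b (T a)) (\<lambda>j \<xi>. nct_mult \<theta> b (s j \<xi>))"
proof -
  obtain F G where e: "expansion F G" "\<And>j. G j 0 = s j" "\<And>a. a \<in> nct_smooth \<Longrightarrow> T a = quantize \<theta> (F 0) a"
    using T unfolding pdo_def by blast
  obtain C where C: "\<And>\<xi> \<gamma>. cmod (F 0 \<xi> \<gamma>) \<le> C" using expansion_bounded[OF e(1)] by blast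
  show ?thesis
    by (rule pdoI[OF expansion_left_mult[OF e(1) b]]) (simp_all add: e(2,3) quantize_left_mult[OF b _ C])
qed

lemma pdo_add_scale:
  assumes "pdo \<theta> T s" "pdo \<theta> T' s'"
  shows "pdo \<theta> (\<lambda>a \<gamma>. T a \<gamma> + c * T' a \<gamma>) (\<lambda>j \<xi> \<gamma>. s j \<xi> \<gamma> + c * s' j \<xi> \<gamma>)"
proof -
  obtain F G where e: "expansion F G" "\<And>j. G j 0 = s j" "\<And>a. a \<in> nct_smooth \<Longrightarrow> T a = quantize \<theta> (F 0) a"
    using assms(1) unfolding pdo_def by blast
  obtain F' G' where e': "expansion F' G'" "\<And>j. G' j 0 = s' j" "\<And>a. a \<in> nct_smooth \<Longrightarrow> T' a = quantize \<theta> (F' 0) a"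
    using assms(2) unfolding pdo_def by blast
  obtain C where C: "\<And>\<xi> \<gamma>. cmod (F 0 \<xi> \<gamma>) \<le> C" using expansion_bounded[OF e(1)] by blast
  obtain D where D: "\<And>\<xi> \<gamma>. cmod (F' 0 \<xi> \<gamma>) \<le> D" using expansion_bounded[OF e'(1)] by blast
  have "T a \<gamma> + c * T' a \<gamma> = quantize \<theta> (\<lambda>\<xi> \<gamma>. F 0 \<xi> \<gamma> + c * F' 0 \<xi> \<gamma>) a \<gamma>" if a: "a \<in> nct_smooth" for a \<gamma>
  proof -
    let ?u = "\<lambda>\<alpha>. a \<alpha> * nct_mult \<theta> (F 0 (lattice_pt \<alpha>)) (nct_U \<alpha>) \<gamma>"
    let ?v = "\<lambda>\<alpha>. a \<alpha> * nct_mult \<theta> (F' 0 (lattice_pt \<alpha>)) (nct_U \<alpha>) \<gamma>"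
    have uv: "?u summable_on UNIV" "?v summable_on UNIV"
      using abs_summable_summable[OF quantize_abs_summable[OF a, of "F 0" C \<theta> \<gamma>, OF C]]
        abs_summable_summable[OF quantize_abs_summable[OF a, of "F' 0" D \<theta> \<gamma>, OF D]] by auto
    have "T a \<gamma> + c * T' a \<gamma> = infsum ?u UNIV + c * infsum ?v UNIV"
      using a by (simp add: e e' quantize_def)
    also have "\<dots> = (\<Sum>\<^sub>\<infinity>\<alpha>. ?u \<alpha> + c * ?v \<alpha>)"
      unfolding infsum_cmult_right'[symmetric]
      by (rule infsum_add[symmetric, OF uv(1) summable_on_cmult_right[OF uv(2)]])
    also have "\<dots> = quantize \<theta> (\<lambda>\<xi> \<gamma>. F 0 \<xi> \<gamma> + c * F' 0 \<xi> \<gamma>) a \<gamma>"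
      unfolding quantize_def nct_mult_U_right by (simp add: algebra_simps)
    finally show ?thesis .
  qed
  then show ?thesis
    by (intro pdoI[OF expansion_add_scale[OF e(1) e'(1), of c]] ext) (simp_all add: e(2) e'(2))
qed

lemma quantize_fourier:
  "quantize \<theta> (\<lambda>\<xi> \<gamma>. p (\<xi> + lattice_pt \<gamma>) * \<sigma> \<xi> \<gamma>) a \<gamma> = p (lattice_pt \<gamma>) * quantize \<theta> \<sigma> a \<gamma>"
proof -
  have "lattice_pt \<alpha> + lattice_pt (\<gamma> - \<alpha>) = lattice_pt \<gamma>" for \<alpha>
    by (simp add: lattice_pt_add[symmetric])
  then show ?thesis
    unfolding quantize_def nct_mult_U_right infsum_cmult_right'[symmetric] by (simp add: mult_ac)
qed

lemma pdo_fourier: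
  assumes T: "pdo \<theta> T s" and pq: "fourier_symbol k p q"
  shows "pdo \<theta> (\<lambda>a \<gamma>. p 0 (lattice_pt \<gamma>) * T a \<gamma>)
    (\<lambda>j \<xi> \<gamma>. \<Sum>l<Suc j - k. taylor_term (j - k - l) (lattice_pt \<gamma>) q 0 \<xi> * s l \<xi> \<gamma>)"
proof -
  obtain F G where e: "expansion F G" "\<And>j. G j 0 = s j" "\<And>a. a \<in> nct_smooth \<Longrightarrow> T a = quantize \<theta> (F 0) a"
    using T unfolding pdo_def by blast
  show ?thesis
  proof (rule pdoI[OF expansion_fourier[OF e(1) pq]])
    show "(\<lambda>\<xi> \<gamma>. \<Sum>l<Suc j - k. jet_mult (taylor_term (j - k - l) (lattice_pt \<gamma>) q) (\<lambda>\<beta> \<xi>. G l \<beta> \<xi> \<gamma>) 0 \<xi>) =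
      (\<lambda>\<xi> \<gamma>. \<Sum>l<Suc j - k. taylor_term (j - k - l) (lattice_pt \<gamma>) q 0 \<xi> * s l \<xi> \<gamma>)" for j
      by (simp only: jet_mult_0 e(2))
    show "(\<lambda>\<gamma>. p 0 (lattice_pt \<gamma>) * T a \<gamma>) =
      quantize \<theta> (\<lambda>\<xi> \<gamma>. jet_mult (taylor_rest 0 p q \<gamma>) (\<lambda>\<beta> \<xi>. F \<beta> \<xi> \<gamma>) 0 \<xi>) a" if "a \<in> nct_smooth" for a
      by (rule ext) (simp add: e(3)[OF that] taylor_rest_def quantize_fourier)
  qed
qed

section \<open>The cutoff and the symbol of the inverse Laplacian\<close>

text \<open>The functions \<open>x^(- n) exp (- 1 / x)\<close>, extended by zero, are flat at the origin. Their derivatives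
  are linear combinations of functions of the same kind, so all derivatives can be tracked through the
  index \<open>n\<close> alone.\<close>

definition flat :: "nat \<Rightarrow> real \<Rightarrow> real" where
  "flat n x = (if x \<le> 0 then 0 else inverse x ^ n * exp (- inverse x))"

lemma power_le_fact_exp:
  assumes "t \<ge> (0::real)"
  shows "t ^ k \<le> fact k * exp t"
proof -
  have "(\<Sum>n\<in>{k}. t ^ n /\<^sub>R fact n) \<le> (\<Sum>n. t ^ n /\<^sub>R fact n)"
    by (rule sum_le_suminf[OF summable_exp_generic]) (use assms in auto)
  then show ?thesis by (simp add: exp_def field_simps)
qed

lemma flat_le:
  assumes "x > 0"
  shows "\<bar>flat n x\<bar> \<le> fact (n + 2) * x\<^sup>2"
proof -
  have "inverse x ^ (n + 2) \<le> fact (n + 2) * exp (inverse x)"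
    by (rule power_le_fact_exp) (use assms in simp)
  then have "inverse x ^ (n + 2) * exp (- inverse x) \<le> fact (n + 2)"
    using mult_right_mono[of _ _ "exp (- inverse x)"] exp_minus_inverse[of "inverse x"]
    by (metis (no_types, lifting) exp_ge_zero mult.assoc mult.right_neutral)
  then have "(inverse x ^ (n + 2) * exp (- inverse x)) * x\<^sup>2 \<le> fact (n + 2) * x\<^sup>2"
    by (rule mult_right_mono) simp
  moreover have "(inverse x ^ (n + 2) * exp (- inverse x)) * x\<^sup>2 = flat n x"
    using assms by (simp add: flat_def power_add power2_eq_square field_simps)
  moreover have "flat n x \<ge> 0" using assms by (simp add: flat_def)
  ultimately show ?thesis by simp
qed

lemma flat_derivative: "(flat n has_real_derivative flat (n + 2) x - real n * flat (n + 1) x) (at x)"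
proof (cases x "0 :: real" rule: linorder_cases)
  case less
  have "((\<lambda>_. 0) has_real_derivative 0) (at x)" by simp
  then have "(flat n has_real_derivative 0) (at x)"
    by (rule has_field_derivative_transform_within_open[where S = "{..<0}"]) (use less in \<open>auto simp: flat_def\<close>)
  then show ?thesis using less by (simp add: flat_def)
next
  case greater
  have "((\<lambda>x. inverse x ^ n * exp (- inverse x)) has_real_derivative
      (real n * inverse x ^ (n - 1) * (- (inverse x ^ 2))) * exp (- inverse x)
      + inverse x ^ n * (exp (- inverse x) * inverse x ^ 2)) (at x)"
    using greater by (auto intro!: derivative_eq_intros simp: power2_eq_square One_nat_def)
  also have "(real n * inverse x ^ (n - 1) * (- (inverse x ^ 2))) * exp (- inverse x)
      + inverse x ^ n * (exp (- inverse x) * inverse x ^ 2) = flat (n + 2) x - real n * flat (n + 1) x"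
    using greater by (cases n) (simp_all add: flat_def power2_eq_square algebra_simps One_nat_def)
  finally show ?thesis
    by (rule has_field_derivative_transform_within_open[where S = "{0<..}"]) (use greater in \<open>auto simp: flat_def\<close>)
next
  case equal
  have le: "\<bar>flat n y\<bar> \<le> fact (n + 2) * y\<^sup>2" for y
    using flat_le[of y n] by (cases "y > 0") (auto simp: flat_def)
  have "((\<lambda>h. flat n h / h) \<longlongrightarrow> 0) (at 0)"
  proof (rule Lim_null_comparison)
    show "\<forall>\<^sub>F h in at 0. norm (flat n h / h) \<le> fact (n + 2) * \<bar>h\<bar>"
    proof (rule eventually_at_filter[THEN iffD2], rule always_eventually, intro allI impI)
      fix h :: real assume "h \<noteq> 0"
      then show "norm (flat n h / h) \<le> fact (n + 2) * \<bar>h\<bar>"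
        using le[of h] by (simp add: abs_divide pos_divide_le_eq power2_eq_square mult.assoc del: fact_Suc)
    qed
    show "((\<lambda>h. fact (n + 2) * \<bar>h\<bar>) \<longlongrightarrow> (0::real)) (at 0)"
      by (intro tendsto_mult_right_zero tendsto_rabs_zero tendsto_ident_at)
  qed
  then show ?thesis using equal by (simp add: has_field_derivative_iff flat_def)
qed

fun flat_jet :: "nat \<Rightarrow> nat \<Rightarrow> real \<Rightarrow> real" where
  "flat_jet 0 n x = flat n x"
| "flat_jet (Suc k) n x = flat_jet k (n + 2) x - real n * flat_jet k (n + 1) x"

lemma flat_jet_derivative: "(flat_jet k n has_real_derivative flat_jet (Suc k) n x) (at x)"
proof (induction k arbitrary: n)
  case 0
  have "flat_jet 0 n = flat n" by (rule ext) simp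
  then show ?case using flat_derivative[of n x] by simp
next
  case (Suc k)
  have eq: "flat_jet (Suc k) n = (\<lambda>x. flat_jet k (n + 2) x - real n * flat_jet k (n + 1) x)"
    by (rule ext) simp
  show ?case unfolding eq flat_jet.simps(2)[of "Suc k" n x]
    by (rule DERIV_diff[OF Suc DERIV_cmult[OF Suc]])
qed

lemma flat_jet_nonpos: "x \<le> 0 \<Longrightarrow> flat_jet k n x = 0"
  by (induction k arbitrary: n) (simp_all add: flat_def)

text \<open>The one-dimensional analogue of the Leibniz recursion for jets.\<close>

fun leib1 :: "nat \<Rightarrow> (nat \<Rightarrow> real \<Rightarrow> real) \<Rightarrow> (nat \<Rightarrow> real \<Rightarrow> real) \<Rightarrow> real \<Rightarrow> real" where
  "leib1 0 f g x = f 0 x * g 0 x"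
| "leib1 (Suc k) f g x = leib1 k (\<lambda>j. f (Suc j)) g x + leib1 k f (\<lambda>j. g (Suc j)) x"

lemma leib1_derivative:
  assumes "\<And>j x. (f j has_real_derivative f (Suc j) x) (at x)"
    and "\<And>j x. (g j has_real_derivative g (Suc j) x) (at x)"
  shows "(leib1 k f g has_real_derivative leib1 (Suc k) f g x) (at x)"
  using assms
proof (induction k arbitrary: f g)
  case 0
  have eq: "leib1 0 f g = (\<lambda>x. f 0 x * g 0 x)" by (rule ext) simp
  show ?case unfolding eq leib1.simps
    using DERIV_mult[OF 0(1)[of 0 x] 0(2)[of 0 x]] by (simp add: mult.commute add.commute)
next
  case (Suc k)
  have eq: "leib1 (Suc k) f g = (\<lambda>x. leib1 k (\<lambda>j. f (Suc j)) g x + leib1 k f (\<lambda>j. g (Suc j)) x)"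
    by (rule ext) simp
  show ?case unfolding eq leib1.simps(2)[of "Suc k" f g x]
    by (intro DERIV_add Suc)
qed

lemma leib1_zero:
  "(\<forall>j. f j x = 0) \<or> (\<forall>j. g j x = 0) \<Longrightarrow> leib1 k f g x = 0"
  by (induction k arbitrary: f g) auto

text \<open>The normalised primitive of a bump on the unit interval, the bump being the product of a flat
  function and its mirror image.\<close>

lemma exists_smooth_step:
  "\<exists>s :: nat \<Rightarrow> real \<Rightarrow> real. (\<forall>k x. (s k has_real_derivative s (Suc k) x) (at x)) \<and>
     (\<forall>k x. x \<le> 0 \<longrightarrow> s k x = 0) \<and> (\<forall>k x. x \<ge> 1 \<longrightarrow> s k x = (if k = 0 then 1 else 0))"
proof -
  define f :: "nat \<Rightarrow> real \<Rightarrow> real" where "f = (\<lambda>j. flat_jet j 0)"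
  define g :: "nat \<Rightarrow> real \<Rightarrow> real" where "g = (\<lambda>j x. (- 1) ^ j * flat_jet j 0 (1 - x))"
  define B where "B = (\<lambda>k. leib1 k f g)"
  have df: "(f j has_real_derivative f (Suc j) x) (at x)" for j x
    unfolding f_def by (rule flat_jet_derivative)
  have dg: "(g j has_real_derivative g (Suc j) x) (at x)" for j x
  proof -
    have "((\<lambda>x. flat_jet j 0 (1 - x)) has_real_derivative flat_jet (Suc j) 0 (1 - x) * (- 1)) (at x)"
      by (rule DERIV_chain2[OF flat_jet_derivative]) (auto intro!: derivative_eq_intros)
    from DERIV_cmult[OF this, of "(- 1) ^ j"] show ?thesis
      unfolding g_def by (simp add: mult_ac del: flat_jet.simps)
  qed
  have dB: "(B k has_real_derivative B (Suc k) x) (at x)" for k x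
    unfolding B_def by (rule leib1_derivative) (rule df, rule dg)
  have B0: "B k x = 0" if "x \<le> 0 \<or> x \<ge> 1" for k x
    unfolding B_def by (rule leib1_zero) (use that in \<open>auto simp: f_def g_def flat_jet_nonpos\<close>)
  have Bpos: "B 0 x > 0" if "0 < x" "x < 1" for x
    using that by (simp add: B_def f_def g_def flat_def)
  have "isCont (B 0) x" for x using dB DERIV_isCont by blast
  then have "\<exists>F. \<forall>x. -\<infinity> < ereal x \<longrightarrow> ereal x < \<infinity> \<longrightarrow> (F has_vector_derivative B 0 x) (at x)"
    by (intro einterval_antiderivative) auto
  then obtain F where F: "\<And>x. (F has_real_derivative B 0 x) (at x)"
    by (auto simp: has_real_derivative_iff_has_vector_derivative)
  have F0: "F x = F 0" if "x \<le> 0" for x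
  proof (cases "x = 0")
    case False
    then have "\<exists>z>x. z < 0 \<and> F 0 - F x = (0 - x) * B 0 z" using that F by (intro MVT2) auto
    then show ?thesis using B0 by force
  qed simp
  have F1: "F x = F 1" if "x \<ge> 1" for x
  proof (cases "x = 1")
    case False
    then have "\<exists>z>1. z < x \<and> F x - F 1 = (x - 1) * B 0 z" using that F by (intro MVT2) auto
    then show ?thesis using B0 by force
  qed simp
  have "\<exists>z>0. z < 1 \<and> F 1 - F 0 = (1 - 0) * B 0 z" using F by (intro MVT2) auto
  then obtain z where "0 < z" "z < 1" "F 1 - F 0 = B 0 z" by auto
  then have pos: "F 1 - F 0 > 0" using Bpos[of z] by simp
  \<comment> \<open>the step followed by its derivatives, which are those of the bump\<close>
  define s where "s = (\<lambda>k x. (case k of 0 \<Rightarrow> F x - F 0 | Suc j \<Rightarrow> B j x) / (F 1 - F 0))"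
  have "(s k has_real_derivative s (Suc k) x) (at x)" for k x
  proof (cases k)
    case 0
    have "((\<lambda>x. (F x - F 0) / (F 1 - F 0)) has_real_derivative B 0 x / (F 1 - F 0)) (at x)"
      by (rule DERIV_cdivide) (use DERIV_diff[OF F[of x] DERIV_const[of "F 0"]] in simp)
    then show ?thesis by (simp add: s_def 0)
  next
    case (Suc j)
    have "((\<lambda>x. B j x / (F 1 - F 0)) has_real_derivative B (Suc j) x / (F 1 - F 0)) (at x)"
      by (rule DERIV_cdivide) (rule dB)
    then show ?thesis by (simp add: s_def Suc)
  qed
  moreover have "s k x = 0" if "x \<le> 0" for k x
    using F0[OF that] B0 that by (simp add: s_def split: nat.split)
  moreover have "s k x = (if k = 0 then 1 else 0)" if "x \<ge> 1" for k x
    using F1[OF that] B0 that pos by (simp add: s_def split: nat.split)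
  ultimately show ?thesis by (intro exI[of _ s]) blast
qed

text \<open>One minus a step on the right and its mirror image on the left, both between \<open>1/8\<close> and \<open>1/4\<close>.\<close>

lemma exists_cutoff_1d:
  "\<exists>c :: nat \<Rightarrow> real \<Rightarrow> real. (\<forall>k x. (c k has_real_derivative c (Suc k) x) (at x)) \<and>
     (\<forall>k x. \<bar>x\<bar> \<le> 1/8 \<longrightarrow> c k x = (if k = 0 then 1 else 0)) \<and> (\<forall>k x. \<bar>x\<bar> \<ge> 1/4 \<longrightarrow> c k x = 0)"
proof -
  obtain s :: "nat \<Rightarrow> real \<Rightarrow> real" where ds: "\<And>k x. (s k has_real_derivative s (Suc k) x) (at x)"
    and s0: "\<And>k x. x \<le> 0 \<Longrightarrow> s k x = 0" and s1: "\<And>k x. x \<ge> 1 \<Longrightarrow> s k x = (if k = 0 then 1 else 0)"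
    using exists_smooth_step by blast
  \<comment> \<open>the steps are rescaled to run from \<open>1/8\<close> to \<open>1/4\<close>\<close>
  define c where "c = (\<lambda>k x. (if k = 0 then 1 else 0) - (8 ^ k * s k (8 * x - 1) + (- 8) ^ k * s k (- 8 * x - 1)))"
  have "(c k has_real_derivative c (Suc k) x) (at x)" for k x
  proof -
    have "((\<lambda>x. s k (8 * x - 1)) has_real_derivative s (Suc k) (8 * x - 1) * 8) (at x)"
      "((\<lambda>x. s k (- 8 * x - 1)) has_real_derivative s (Suc k) (- 8 * x - 1) * (- 8)) (at x)"
      by (rule DERIV_chain2[OF ds]; auto intro!: derivative_eq_intros)+
    from DERIV_diff[OF DERIV_const[of "if k = 0 then 1 else 0"]
        DERIV_add[OF DERIV_cmult[OF this(1), of "8 ^ k"] DERIV_cmult[OF this(2), of "(- 8) ^ k"]]]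
    show ?thesis by (simp add: c_def mult_ac)
  qed
  moreover have "c k x = (if k = 0 then 1 else 0)" if "\<bar>x\<bar> \<le> 1/8" for k x
  proof -
    have "8 * x - 1 \<le> 0" "- 8 * x - 1 \<le> 0" using that by linarith+
    then show ?thesis by (simp add: c_def s0)
  qed
  moreover have "c k x = 0" if "\<bar>x\<bar> \<ge> 1/4" for k x
  proof (cases "x \<ge> 0")
    case True
    then have "8 * x - 1 \<ge> 1" "- 8 * x - 1 \<le> 0" using that by linarith+
    then show ?thesis by (simp add: c_def s0 s1)
  next
    case False
    then have "8 * x - 1 \<le> 0" "- 8 * x - 1 \<ge> 1" using that by linarith+
    then show ?thesis by (simp add: c_def s0 s1)
  qed
  ultimately show ?thesis by (intro exI[of _ c]) blast
qed

text \<open>The product of two one-dimensional cutoffs. Its support lies in a square of side one half and hence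
  in the disc of radius one half.\<close>

lemma exists_cutoff:
  "\<exists>\<psi>. derivs_on UNIV \<psi> \<and> (\<forall>\<beta> \<xi>. norm \<xi> \<ge> 1/2 \<longrightarrow> \<psi> \<beta> \<xi> = 0) \<and>
     (\<forall>\<beta> \<xi>. norm \<xi> \<le> 1/8 \<longrightarrow> \<psi> \<beta> \<xi> = (if \<beta> = 0 then 1 else 0))"
proof -
  obtain c :: "nat \<Rightarrow> real \<Rightarrow> real" where dc: "\<And>k x. (c k has_real_derivative c (Suc k) x) (at x)"
    and c1: "\<And>k x. \<bar>x\<bar> \<le> 1/8 \<Longrightarrow> c k x = (if k = 0 then 1 else 0)" and c0: "\<And>k x. \<bar>x\<bar> \<ge> 1/4 \<Longrightarrow> c k x = 0"
    using exists_cutoff_1d by blast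
  define \<psi> :: jet where "\<psi> = (\<lambda>\<beta> \<xi>. of_real (c (\<beta> $ 1) (\<xi> $ 1) * c (\<beta> $ 2) (\<xi> $ 2)))"
  have "derivs_on UNIV \<psi>"
    unfolding derivs_on_def
  proof (intro allI ballI)
    fix \<beta> :: "nat^2" and \<xi> :: "real^2"
    have part: "((\<lambda>\<xi>::real^2. c k (\<xi> $ a)) has_derivative (\<lambda>v. c (Suc k) (\<xi> $ a) * v $ a)) (at \<xi>)" for k a
      by (rule has_derivative_compose[OF _ dc[unfolded has_field_derivative_def], where f = "\<lambda>\<xi>. \<xi> $ a"])
         (intro bounded_linear.has_derivative[OF bounded_linear_vec_nth] has_derivative_ident)
    show "(\<psi> \<beta> has_derivative (\<lambda>v. \<Sum>a\<in>UNIV. of_real (v $ a) * \<psi> (\<beta> + axis a 1) \<xi>)) (at \<xi>)"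
      unfolding \<psi>_def
      by (rule has_derivative_eq_rhs[OF has_derivative_of_real[OF has_derivative_mult[OF part part]]])
         (simp add: fun_eq_iff sum_2 axis_def algebra_simps Suc_eq_plus1_left)
  qed
  moreover have "\<psi> \<beta> \<xi> = 0" if "norm \<xi> \<ge> 1/2" for \<beta> \<xi>
  proof -
    have "norm \<xi> \<le> \<bar>\<xi> $ 1\<bar> + \<bar>\<xi> $ 2\<bar>" using norm_le_l1_cart[of \<xi>] by (simp add: sum_2)
    then have "\<bar>\<xi> $ 1\<bar> \<ge> 1/4 \<or> \<bar>\<xi> $ 2\<bar> \<ge> 1/4" using that by linarith
    then show ?thesis by (auto simp: \<psi>_def c0)
  qed
  moreover have "\<psi> \<beta> \<xi> = (if \<beta> = 0 then 1 else 0)" if "norm \<xi> \<le> 1/8" for \<beta> \<xi>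
  proof -
    have "\<bar>\<xi> $ a\<bar> \<le> 1/8" for a using component_le_norm_cart[of \<xi> a] that by linarith
    then show ?thesis by (auto simp: \<psi>_def c1 vec_eq_iff forall_2)
  qed
  ultimately show ?thesis by blast
qed

definition cpx :: "real^2 \<Rightarrow> complex" where
  "cpx \<xi> = Complex (\<xi> $ 1) (\<xi> $ 2)"

text \<open>The jet of \<open>1 / z\<close>, where \<open>z = \<xi>\<^sub>1 + \<i> \<xi>\<^sub>2\<close>: each derivative lowers the exponent by one, and the
  second direction contributes a factor \<open>\<i>\<close>.\<close>

definition inv_cpx :: jet where
  "inv_cpx \<beta> \<xi> = (- 1) ^ mdeg \<beta> * fact (mdeg \<beta>) * \<i> ^ (\<beta> $ 2) * inverse (cpx \<xi>) ^ Suc (mdeg \<beta>)"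

lemma cpx_nonzero: "cpx \<xi> = 0 \<longleftrightarrow> \<xi> = 0"
  by (simp add: cpx_def complex_eq_iff vec_eq_iff forall_2)

lemma cpx_scale: "cpx (t *\<^sub>R \<xi>) = of_real t * cpx \<xi>"
  by (simp add: cpx_def complex_eq_iff)

lemma derivs_on_inv_cpx: "derivs_on (- {0}) inv_cpx"
  unfolding derivs_on_def
proof (intro allI ballI)
  fix \<beta> :: "nat^2" and \<xi> :: "real^2" assume "\<xi> \<in> - {0}"
  then have z: "cpx \<xi> \<noteq> 0" by (simp add: cpx_nonzero)
  let ?n = "mdeg \<beta>"
  let ?c = "(- 1) ^ ?n * fact ?n * \<i> ^ (\<beta> $ 2) :: complex"
  have lin: "(cpx has_derivative cpx) (at \<xi>)"
  proof -
    have "((\<lambda>\<xi>::real^2. of_real (\<xi> $ 1) + \<i> * of_real (\<xi> $ 2)) has_derivative (\<lambda>v. of_real (v $ 1) + \<i> * of_real (v $ 2))) (at \<xi>)"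
      by (intro has_derivative_add has_derivative_mult_right has_derivative_of_real
          bounded_linear.has_derivative[OF bounded_linear_vec_nth] has_derivative_ident)
    then show ?thesis by (simp add: cpx_def[abs_def] Complex_eq)
  qed
  have "((\<lambda>z. ?c * inverse z ^ Suc ?n) has_field_derivative
      ?c * (of_nat (Suc ?n) * (inverse (cpx \<xi>) ^ ?n * (- (inverse (cpx \<xi>) ^ 2))))) (at (cpx \<xi>))"
    using z by (auto intro!: derivative_eq_intros simp: power2_eq_square simp del: of_nat_Suc power_Suc)
  then have "((\<lambda>\<xi>. ?c * inverse (cpx \<xi>) ^ Suc ?n) has_derivative
      (\<lambda>v. (?c * (of_nat (Suc ?n) * (inverse (cpx \<xi>) ^ ?n * (- (inverse (cpx \<xi>) ^ 2))))) * cpx v)) (at \<xi>)"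
    unfolding has_field_derivative_def by (rule has_derivative_compose[OF lin])
  then show "(inv_cpx \<beta> has_derivative (\<lambda>v. \<Sum>a\<in>UNIV. of_real (v $ a) * inv_cpx (\<beta> + axis a 1) \<xi>)) (at \<xi>)"
    unfolding inv_cpx_def[abs_def]
  proof (rule has_derivative_eq_rhs, intro ext)
    fix v
    define w where "w = inverse (cpx \<xi>)"
    have v: "cpx v = of_real (v $ 1) + \<i> * of_real (v $ 2)" by (simp add: cpx_def Complex_eq)
    show "?c * (of_nat (Suc ?n) * (inverse (cpx \<xi>) ^ ?n * - (inverse (cpx \<xi>) ^ 2))) * cpx v =
      (\<Sum>a\<in>UNIV. of_real (v $ a) * ((- 1) ^ mdeg (\<beta> + axis a 1) * fact (mdeg (\<beta> + axis a 1)) *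
         \<i> ^ ((\<beta> + axis a 1) $ 2) * inverse (cpx \<xi>) ^ Suc (mdeg (\<beta> + axis a 1))))"
      unfolding w_def[symmetric] v mdeg_add_axis
      by (simp add: sum_2 axis_def power2_eq_square power_add algebra_simps)
  qed
qed

lemma homogeneous_inv_cpx: "homogeneous (- 1) inv_cpx"
  unfolding homogeneous_def
proof (intro allI impI)
  fix \<beta> :: "nat^2" and t :: real and \<xi> :: "real^2"
  have "- 1 - int (mdeg \<beta>) = - int (Suc (mdeg \<beta>))" by simp
  then have "t powi (- 1 - int (mdeg \<beta>)) = inverse t ^ Suc (mdeg \<beta>)"
    by (simp only: power_int_minus power_int_of_nat power_inverse)
  then show "inv_cpx \<beta> (t *\<^sub>R \<xi>) = of_real (t powi (- 1 - int (mdeg \<beta>))) * inv_cpx \<beta> \<xi>"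
    by (simp add: inv_cpx_def cpx_scale power_mult_distrib mult_ac)
qed

text \<open>The square of the norm factors as \<open>z\<close> times its conjugate, so the derivatives of its reciprocal
  follow from the explicit ones of \<open>1 / z\<close>.\<close>

definition inv_norm_sq :: jet where
  "inv_norm_sq = jet_mult inv_cpx (\<lambda>\<beta> \<xi>. cnj (inv_cpx \<beta> \<xi>))"

lemma derivs_on_inv_norm_sq: "derivs_on (- {0}) inv_norm_sq"
proof -
  have "derivs_on (- {0}) (\<lambda>\<beta> \<xi>. cnj (inv_cpx \<beta> \<xi>))"
    unfolding derivs_on_def
  proof (intro allI ballI)
    fix \<beta> \<xi> assume "\<xi> \<in> - {0 :: real^2}"
    from has_derivative_eq_rhs[OF bounded_linear.has_derivative[OF bounded_linear_cnj derivs_onD[OF derivs_on_inv_cpx this]]]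
    show "((\<lambda>\<xi>. cnj (inv_cpx \<beta> \<xi>)) has_derivative (\<lambda>v. \<Sum>a\<in>UNIV. of_real (v $ a) * cnj (inv_cpx (\<beta> + axis a 1) \<xi>))) (at \<xi>)"
      by (simp add: cnj_sum)
  qed
  then show ?thesis unfolding inv_norm_sq_def by (intro derivs_on_jet_mult derivs_on_inv_cpx)
qed

lemma homogeneous_inv_norm_sq: "homogeneous (- 2) inv_norm_sq"
proof -
  have "homogeneous (- 1) (\<lambda>\<beta> \<xi>. cnj (inv_cpx \<beta> \<xi>))"
    using homogeneous_inv_cpx by (simp add: homogeneous_def)
  from homogeneous_jet_mult[OF homogeneous_inv_cpx this] show ?thesis by (simp add: inv_norm_sq_def)
qed

lemma inv_norm_sq_0: "inv_norm_sq 0 \<xi> = of_real (inverse ((norm \<xi>)\<^sup>2))"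
proof -
  have "cpx \<xi> * cnj (cpx \<xi>) = of_real ((norm \<xi>)\<^sup>2)"
    by (simp add: complex_mult_cnj cpx_def norm_vec_def L2_set_def sum_2)
  then show ?thesis
    by (simp add: inv_norm_sq_def inv_cpx_def inverse_mult_distrib[symmetric] del: inverse_mult_distrib)
qed

lemma jet_mult_one_left: "jet_mult (\<lambda>\<beta> \<xi>. if \<beta> = 0 then 1 else 0) g \<beta> \<xi> = g \<beta> \<xi>"
proof (induction \<beta> arbitrary: g rule: jet_induct)
  case (axis \<beta> a)
  from axis[of "shift a g"] show ?case by (simp add: jet_mult_add_axis shift_def jet_index_nonzero)
qed simp

text \<open>Multiplying the reciprocal of the squared norm with one minus the cutoff makes it vanish near the
  origin, hence smooth, and leaves it unchanged outside the disc of radius one half.\<close>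

lemma exists_inverse_laplace_symbol:
  assumes \<psi>: "derivs_on UNIV \<psi>" "\<And>\<beta> \<xi>. norm \<xi> \<ge> 1/2 \<Longrightarrow> \<psi> \<beta> \<xi> = 0"
    "\<And>\<beta> \<xi>. norm \<xi> \<le> 1/8 \<Longrightarrow> \<psi> \<beta> \<xi> = (if \<beta> = 0 then 1 else 0)"
  shows "\<exists>n. fourier_symbol 2 n inv_norm_sq"
proof -
  define e :: jet where "e = (\<lambda>\<beta> \<xi>. (if \<beta> = 0 then 1 else 0) - \<psi> \<beta> \<xi>)"
  define n where "n = jet_mult e inv_norm_sq"
  have "derivs_on UNIV (\<lambda>\<beta> \<xi>. if \<beta> = 0 then 1 else 0)"
    by (simp add: derivs_on_def jet_index_nonzero)
  then have "derivs_on (- {0}) e"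
    unfolding e_def by (rule derivs_on_subset[OF derivs_on_diff[OF _ \<psi>(1)]]) simp
  then have off: "derivs_on (- {0}) n"
    unfolding n_def by (rule derivs_on_jet_mult[OF _ derivs_on_inv_norm_sq])
  have near: "n \<beta> \<xi> = 0" if "norm \<xi> \<le> 1/8" for \<beta> \<xi>
  proof -
    have "n \<beta> \<xi> = jet_mult (\<lambda>_ _. 0) inv_norm_sq \<beta> \<xi>"
      unfolding n_def by (rule jet_mult_cong) (simp_all add: e_def \<psi>(3)[OF that])
    then show ?thesis by simp
  qed
  have far: "n \<beta> \<xi> = inv_norm_sq \<beta> \<xi>" if "norm \<xi> \<ge> 1/2" for \<beta> \<xi>
  proof -
    have "n \<beta> \<xi> = jet_mult (\<lambda>\<beta> \<xi>. if \<beta> = 0 then 1 else 0) inv_norm_sq \<beta> \<xi>"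
      unfolding n_def by (rule jet_mult_cong) (simp_all add: e_def \<psi>(2)[OF that])
    then show ?thesis by (simp add: jet_mult_one_left)
  qed
  have "derivs_on UNIV n"
    unfolding derivs_on_def
  proof (intro allI ballI)
    fix \<beta> and \<xi> :: "real^2"
    show "(n \<beta> has_derivative (\<lambda>v. \<Sum>a\<in>UNIV. of_real (v $ a) * n (\<beta> + axis a 1) \<xi>)) (at \<xi>)"
    proof (cases "\<xi> = 0")
      case True
      have "((\<lambda>_. 0) has_derivative (\<lambda>v. \<Sum>a\<in>UNIV. of_real (v $ a) * n (\<beta> + axis a 1) \<xi>)) (at \<xi>)"
        by (simp add: True near)
      then show ?thesis
        by (rule has_derivative_transform_within_open[where s = "ball 0 (1/8)"]) (auto simp: True near)
    qed (use derivs_onD[OF off] in auto)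
  qed
  then show ?thesis
    using far derivs_on_inv_norm_sq homogeneous_inv_norm_sq
    by (intro exI[of _ n]) (simp add: fourier_symbol_def)
qed

text \<open>The cutoff has vanishing homogeneous components of every order, so as an operator it is invisible to
  the residue.\<close>

lemma fourier_symbol_cutoff:
  assumes "derivs_on UNIV \<psi>" "\<And>\<beta> \<xi>. norm \<xi> \<ge> 1/2 \<Longrightarrow> \<psi> \<beta> \<xi> = 0"
  shows "fourier_symbol k \<psi> (\<lambda>_ _. 0)"
  using assms by (simp add: fourier_symbol_def derivs_on_zero homogeneous_def)

definition linear_jet :: "complex^2 \<Rightarrow> jet" where
  "linear_jet V \<beta> \<xi> = (if \<beta> = 0 then \<Sum>a\<in>UNIV. V $ a * of_real (\<xi> $ a)
     else \<Sum>a\<in>UNIV. if \<beta> = axis a 1 then V $ a else 0)"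

lemma linear_jet_add_axis: "linear_jet V (\<beta> + axis a 1) \<xi> = (if \<beta> = 0 then V $ a else 0)"
proof (cases "\<beta> = 0")
  case False
  have "\<beta> + axis a 1 \<noteq> axis b 1" for b
  proof
    assume "\<beta> + axis a 1 = axis b 1"
    then have "mdeg (\<beta> + axis a 1) = mdeg (0 + axis b 1)" by simp
    then have "mdeg \<beta> = 0" unfolding mdeg_add_axis by simp
    then show False using False by (simp add: mdeg_def vec_eq_iff)
  qed
  then show ?thesis using False by (simp add: linear_jet_def jet_index_nonzero)
next
  case True
  have "axis a (1::nat) = axis b 1 \<longleftrightarrow> b = a" for b by (auto simp: axis_eq_axis)
  then show ?thesis using True jet_index_nonzero[of 0 a] by (simp add: linear_jet_def)
qed

lemma derivs_on_linear_jet: "derivs_on S (linear_jet V)"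
  unfolding derivs_on_def
proof (intro allI ballI)
  fix \<beta> \<xi>
  show "(linear_jet V \<beta> has_derivative (\<lambda>v. \<Sum>a\<in>UNIV. of_real (v $ a) * linear_jet V (\<beta> + axis a 1) \<xi>)) (at \<xi>)"
  proof (cases "\<beta> = 0")
    case True
    have "((\<lambda>\<xi>::real^2. \<Sum>a\<in>UNIV. V $ a * of_real (\<xi> $ a)) has_derivative (\<lambda>v. \<Sum>a\<in>UNIV. V $ a * of_real (v $ a))) (at \<xi>)"
      by (intro has_derivative_sum has_derivative_mult_right has_derivative_of_real
          bounded_linear.has_derivative[OF bounded_linear_vec_nth] has_derivative_ident)
    then show ?thesis unfolding linear_jet_add_axis by (simp add: linear_jet_def[abs_def] True mult.commute)
  next
    case False
    then show ?thesis unfolding linear_jet_add_axis by (simp add: linear_jet_def[abs_def])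
  qed
qed

lemma homogeneous_linear_jet: "homogeneous 1 (linear_jet V)"
  unfolding homogeneous_def
proof (intro allI impI)
  fix \<beta> :: "nat^2" and t :: real and \<xi> :: "real^2" assume "t > 0" "\<xi> \<noteq> 0"
  show "linear_jet V \<beta> (t *\<^sub>R \<xi>) = of_real (t powi (1 - int (mdeg \<beta>))) * linear_jet V \<beta> \<xi>"
  proof (cases "\<exists>a. \<beta> = axis a 1")
    case True
    then obtain a where a: "\<beta> = 0 + axis a 1" by auto
    have "mdeg \<beta> = Suc 0" unfolding a mdeg_add_axis by simp
    then have "1 - int (mdeg \<beta>) = 0" by simp
    then have "of_real (t powi (1 - int (mdeg \<beta>))) = (1 :: complex)" by simp
    then show ?thesis unfolding a linear_jet_add_axis by simp
  next
    case False
    then show ?thesis by (auto simp: linear_jet_def sum_distrib_left mult_ac)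
  qed
qed

lemma fourier_symbol_quadratic:
  assumes "fourier_symbol 2 n q"
  shows "fourier_symbol 0 (jet_mult (linear_jet V) (jet_mult (linear_jet W) n))
    (jet_mult (linear_jet V) (jet_mult (linear_jet W) q))"
  unfolding fourier_symbol_def
proof (intro conjI allI impI)
  have n: "derivs_on UNIV n" "derivs_on (- {0}) q" "homogeneous (- 2) q" "\<And>\<beta> \<xi>. norm \<xi> \<ge> 1/2 \<Longrightarrow> n \<beta> \<xi> = q \<beta> \<xi>"
    using assms by (auto simp: fourier_symbol_def)
  show "derivs_on UNIV (jet_mult (linear_jet V) (jet_mult (linear_jet W) n))"
    "derivs_on (- {0}) (jet_mult (linear_jet V) (jet_mult (linear_jet W) q))"
    by (intro derivs_on_jet_mult derivs_on_linear_jet n)+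
  have "homogeneous (1 + (1 + - 2)) (jet_mult (linear_jet V) (jet_mult (linear_jet W) q))"
    by (intro homogeneous_jet_mult homogeneous_linear_jet n)
  then show "homogeneous (- int 0) (jet_mult (linear_jet V) (jet_mult (linear_jet W) q))" by simp
  show "jet_mult (linear_jet V) (jet_mult (linear_jet W) n) \<beta> \<xi> = jet_mult (linear_jet V) (jet_mult (linear_jet W) q) \<beta> \<xi>"
    if "norm \<xi> \<ge> 1/2" for \<beta> \<xi>
    by (intro jet_mult_cong refl n(4) that)
qed

section \<open>The rescaled Laplacian and the vector fields\<close>

lemma nct_mult_zero [simp]: "nct_mult \<theta> b (\<lambda>_. 0) = (\<lambda>_. 0)"
  by (simp add: nct_mult_def)

lemma l2_U [simp]: "nct_U \<alpha> \<in> l2"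
  by (simp add: nct_smooth_l2)

lemma l2_inner_two_modes:
  assumes "\<alpha> \<noteq> 0"
  shows "l2_inner (\<lambda>\<gamma>. nct_U 0 \<gamma> + z * nct_U \<alpha> \<gamma>) g = g 0 + cnj z * g \<alpha>"
proof -
  have "l2_inner (\<lambda>\<gamma>. nct_U 0 \<gamma> + z * nct_U \<alpha> \<gamma>) g =
      infsum (\<lambda>\<gamma>. cnj (nct_U 0 \<gamma> + z * nct_U \<alpha> \<gamma>) * g \<gamma>) {0, \<alpha>}"
    unfolding l2_inner_def by (rule infsum_cong_neutral) (auto simp: nct_U_def)
  then show ?thesis using assms by (simp add: nct_U_def)
qed

lemma op_delta_SomeD:
  "op_delta a f = Some g \<Longrightarrow> f \<in> l2 \<and> g \<in> l2 \<and> g = (\<lambda>\<alpha>. of_int (\<alpha> $ a) * f \<alpha>)"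
  by (auto simp: op_delta_def Let_def split: if_splits)

lemma nct_smooth_delta:
  assumes "f \<in> nct_smooth"
  shows "(\<lambda>\<alpha>. of_int (\<alpha> $ a) * f \<alpha>) \<in> nct_smooth"
proof (rule nct_smooth_pointwise_mult[OF assms, where C = 1 and n = 1])
  fix \<alpha>
  show "cmod (of_int (\<alpha> $ a)) \<le> 1 * weight \<alpha> ^ 1"
    using component_le_norm_cart[of "lattice_pt \<alpha>" a] by (simp add: weight_def)
qed

lemma op_delta_smooth: "f \<in> nct_smooth \<Longrightarrow> op_delta a f = Some (\<lambda>\<alpha>. of_int (\<alpha> $ a) * f \<alpha>)"
  using nct_smooth_delta[of f a] by (simp add: op_delta_def Let_def nct_smooth_l2)

lemma norm_lattice_pt_sq: "(norm (lattice_pt \<alpha>))\<^sup>2 = (\<Sum>a\<in>UNIV. (real_of_int (\<alpha> $ a))\<^sup>2)"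
  by (simp add: norm_vec_def L2_set_def sum_nonneg)

text \<open>On its domain the Laplacian is the Fourier multiplier by the squared norm.\<close>

lemma laplacian_SomeD:
  assumes "laplacian f = Some g"
  shows "f \<in> l2 \<and> g = (\<lambda>\<alpha>. of_real ((norm (lattice_pt \<alpha>))\<^sup>2) * f \<alpha>)"
proof -
  have dom: "\<forall>a. f \<in> dom (op_delta a \<circ>\<^sub>m op_delta a)"
    and g: "g = (\<lambda>\<alpha>. \<Sum>a\<in>UNIV. 1 * the ((op_delta a \<circ>\<^sub>m op_delta a) f) \<alpha>)"
    using assms unfolding laplacian_def op_lincomb_def by (auto split: if_splits)
  have dd: "(op_delta a \<circ>\<^sub>m op_delta a) f = Some (\<lambda>\<alpha>. of_int (\<alpha> $ a) * (of_int (\<alpha> $ a) * f \<alpha>)) \<and> f \<in> l2" for a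
  proof -
    from dom obtain k where "(op_delta a \<circ>\<^sub>m op_delta a) f = Some k" by blast
    then obtain k' where k: "op_delta a f = Some k'" "op_delta a k' = Some k" "(op_delta a \<circ>\<^sub>m op_delta a) f = Some k"
      by (auto simp: map_comp_Some_iff)
    then show ?thesis using op_delta_SomeD[OF k(1)] op_delta_SomeD[OF k(2)] by simp
  qed
  have "(\<Sum>a\<in>UNIV. of_int (\<alpha> $ a) * (of_int (\<alpha> $ a) * f \<alpha>)) = of_real ((norm (lattice_pt \<alpha>))\<^sup>2) * f \<alpha>" for \<alpha>
    unfolding norm_lattice_pt_sq by (simp add: sum_distrib_right power2_eq_square mult.assoc)
  then show ?thesis using dd by (simp add: g del: of_real_power)
qed

lemma laplacian_smooth:
  assumes "f \<in> nct_smooth"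
  shows "laplacian f = Some (\<lambda>\<alpha>. of_real ((norm (lattice_pt \<alpha>))\<^sup>2) * f \<alpha>)"
proof -
  have "(op_delta a \<circ>\<^sub>m op_delta a) f = Some (\<lambda>\<alpha>. of_int (\<alpha> $ a) * (of_int (\<alpha> $ a) * f \<alpha>))" for a
    by (simp add: op_delta_smooth nct_smooth_delta assms)
  then have "f \<in> dom (op_delta a \<circ>\<^sub>m op_delta a)" for a by blast
  then obtain g where "laplacian f = Some g" by (simp add: laplacian_def op_lincomb_def)
  then show ?thesis using laplacian_SomeD by blast
qed

locale conformal_factor =
  fixes \<theta> :: real and h :: nct
  assumes smooth: "h \<in> nct_smooth"
    and positive: "nct_positive \<theta> h"
    and invertible: "nct_boundedly_invertible \<theta> h"
begin

abbreviation lmult :: "nct \<Rightarrow> nct" where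
  "lmult \<equiv> nct_mult \<theta> h"

lemma lmult_smooth: "f \<in> nct_smooth \<Longrightarrow> lmult f \<in> nct_smooth"
  by (rule nct_smooth_mult[OF smooth])

text \<open>A positive operator is symmetric. The matrix coefficients of \<open>h\<close> between the modes \<open>0\<close> and \<open>\<alpha>\<close>
  are compared by polarisation: the quadratic form is real on \<open>U\<^sub>0 + z U\<^sub>\<alpha>\<close> for \<open>z = 1\<close> and \<open>z = \<i>\<close>.\<close>

lemma adjoint_coefficient:
  "cnj (h \<alpha>) = h (- \<alpha>) * cis (2 * pi * \<theta> * real_of_int (\<alpha> $ 2) * real_of_int (\<alpha> $ 1))"
proof -
  have real: "Im (l2_inner f (lmult f)) = 0" if "f \<in> l2" for f
    using positive that unfolding nct_positive_def by (auto simp: complex_nonneg_Reals_iff)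
  have h0: "Im (h 0) = 0"
  proof -
    have "l2_inner (nct_U 0) (lmult (nct_U 0)) = infsum (\<lambda>\<gamma>. cnj (nct_U 0 \<gamma>) * h \<gamma>) {0}"
      unfolding l2_inner_def nct_mult_one_right by (rule infsum_cong_neutral) (auto simp: nct_U_def)
    also have "\<dots> = h 0" by (simp add: nct_U_def)
    finally show ?thesis using real[OF l2_U[of 0]] by simp
  qed
  show ?thesis
  proof (cases "\<alpha> = 0")
    case True
    then show ?thesis using h0 by (simp add: complex_eq_iff)
  next
    case False
    let ?e = "h (- \<alpha>) * cis (2 * pi * \<theta> * real_of_int (\<alpha> $ 2) * real_of_int (\<alpha> $ 1))"
    have "Im (h 0 + z * ?e + cnj z * (h \<alpha> + z * h 0)) = 0" for z
    proof -
      let ?f = "\<lambda>\<gamma>. nct_U 0 \<gamma> + z * nct_U \<alpha> \<gamma>"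
      have "?f \<in> nct_smooth" by (intro nct_smooth_add nct_smooth_scale nct_smooth_U)
      then have "Im (l2_inner ?f (lmult ?f)) = 0" by (intro real nct_smooth_l2)
      moreover have "lmult ?f = (\<lambda>\<gamma>. h \<gamma> + z * lmult (nct_U \<alpha>) \<gamma>)"
        using nct_mult_lincomb[OF smooth nct_smooth_bounded[OF nct_smooth_U[of 0]] nct_smooth_bounded[OF nct_smooth_U[of \<alpha>]], of \<theta> 1 z]
        by simp
      ultimately show ?thesis
        by (simp add: l2_inner_two_modes[OF False] nct_mult_U_right)
    qed
    \<comment> \<open>the imaginary parts for \<open>z = 1\<close> and \<open>z = \<i>\<close> give the two real equations\<close>
    from this[of 1] this[of \<i>] h0 show ?thesis by (simp add: complex_eq_iff)
  qed
qed

text \<open>Since \<open>h\<close> is selfadjoint, orthogonality to \<open>h\<close> is a condition on the zero mode of \<open>h f\<close>.\<close>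

lemma inner_h: "l2_inner h f = lmult f 0"
proof -
  have "l2_inner h f = (\<Sum>\<^sub>\<infinity>\<alpha>. h (- \<alpha>) * cis (2 * pi * \<theta> * real_of_int (\<alpha> $ 2) * real_of_int (\<alpha> $ 1)) * f \<alpha>)"
    unfolding l2_inner_def adjoint_coefficient ..
  also have "\<dots> = lmult f 0"
    unfolding nct_mult_def
    by (rule infsum_reindex_bij_witness[of UNIV uminus uminus]) auto
  finally show ?thesis .
qed

text \<open>The trace of \<open>h\<^sup>2\<close>, which is the squared norm of \<open>h\<close>.\<close>

definition tau_h_sq :: complex where
  "tau_h_sq = lmult h 0"

lemma tau_h_sq_nonzero: "tau_h_sq \<noteq> 0"
proof
  assume "tau_h_sq = 0"
  then have "l2_inner h h = 0" by (simp add: inner_h tau_h_sq_def)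
  moreover have s: "(\<lambda>\<alpha>. (cmod (h \<alpha>))\<^sup>2) summable_on UNIV"
    using nct_smooth_l2[OF smooth] by (simp add: l2_def)
  moreover have "l2_inner h h = of_real (\<Sum>\<^sub>\<infinity>\<alpha>. (cmod (h \<alpha>))\<^sup>2)"
  proof -
    have "l2_inner h h = (\<Sum>\<^sub>\<infinity>\<alpha>. of_real ((cmod (h \<alpha>))\<^sup>2))"
      unfolding l2_inner_def by (intro infsum_cong) (simp only: complex_norm_square mult.commute)
    also have "\<dots> = of_real (\<Sum>\<^sub>\<infinity>\<alpha>. (cmod (h \<alpha>))\<^sup>2)"
      by (rule infsumI) (simp add: has_sum_of_real_iff has_sum_infsum s del: of_real_power)
    finally show ?thesis .
  qed
  ultimately have "(\<Sum>\<^sub>\<infinity>\<alpha>. (cmod (h \<alpha>))\<^sup>2) = 0" by (simp only: of_real_eq_0_iff)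
  then have "(cmod (h \<alpha>))\<^sup>2 = 0" for \<alpha>
    by (intro nonneg_infsum_le_0D[of "\<lambda>\<alpha>. (cmod (h \<alpha>))\<^sup>2" UNIV]) (use s in auto)
  then have h0: "h = (\<lambda>_. 0)" by (simp add: fun_eq_iff)
  obtain T where "\<forall>f\<in>l2. lmult (T f) = f" using invertible unfolding nct_boundedly_invertible_def by blast
  then have "lmult (T (nct_U 0)) = nct_U 0" by simp
  moreover have "lmult (T (nct_U 0)) = (\<lambda>_. 0)" by (simp add: h0 nct_mult_def)
  ultimately have "nct_U 0 (0::int^2) = 0" by metis
  then show False by (simp add: nct_U_def)
qed

lemma op_mult_inv_eq:
  assumes "g \<in> l2" "lmult g \<in> l2"
  shows "op_mult_inv \<theta> h (lmult g) = Some g"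
proof -
  obtain T where T: "\<forall>f\<in>l2. T (lmult f) = f" using invertible unfolding nct_boundedly_invertible_def by blast
  have "(THE g'. g' \<in> l2 \<and> lmult g' = lmult g) = g"
    by (rule the_equality) (use T assms in metis)+
  then show ?thesis using assms(2) by (simp add: op_mult_inv_def)
qed

lemma op_mult_inv_SomeD:
  assumes "op_mult_inv \<theta> h f = Some g"
  shows "g \<in> l2 \<and> lmult g = f"
proof -
  have f: "f \<in> l2" using assms by (auto simp: op_mult_inv_def split: if_splits)
  obtain T where T: "T f \<in> l2" "lmult (T f) = f" using f invertible unfolding nct_boundedly_invertible_def by blast
  then show ?thesis using op_mult_inv_eq[of "T f"] f assms by auto
qed

lemma conformal_laplacian_SomeD:
  assumes "conformal_laplacian \<theta> h x = Some p"
  shows "\<exists>g\<in>l2. lmult g = x \<and> p \<in> l2 \<and> lmult p = (\<lambda>\<alpha>. of_real ((norm (lattice_pt \<alpha>))\<^sup>2) * g \<alpha>)"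
proof -
  obtain g w where "op_mult_inv \<theta> h x = Some g" "laplacian g = Some w" "op_mult_inv \<theta> h w = Some p"
    using assms unfolding conformal_laplacian_def by (auto simp: map_comp_Some_iff)
  then show ?thesis using op_mult_inv_SomeD[of x g] op_mult_inv_SomeD[of w p] laplacian_SomeD[of g w] by blast
qed

lemma conformal_laplacian_smooth:
  assumes u: "u \<in> nct_smooth" and v: "v \<in> nct_smooth"
    and eq: "(\<lambda>\<alpha>. of_real ((norm (lattice_pt \<alpha>))\<^sup>2) * u \<alpha>) = lmult v"
  shows "conformal_laplacian \<theta> h (lmult u) = Some v"
proof -
  have "op_mult_inv \<theta> h (lmult u) = Some u" "op_mult_inv \<theta> h (lmult v) = Some v"
    using u v by (auto intro!: op_mult_inv_eq nct_smooth_l2 lmult_smooth)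
  then show ?thesis unfolding conformal_laplacian_def by (simp add: laplacian_smooth[OF u] eq del: of_real_power)
qed

lemma lmult_scale_U: "lmult (\<lambda>\<alpha>. c * nct_U 0 \<alpha>) = (\<lambda>\<alpha>. c * h \<alpha>)"
  by (simp add: nct_mult_scale)

text \<open>If \<open>\<Delta> (h\<inverse> f)\<close> vanishes, then \<open>h\<inverse> f\<close> is a constant multiple of the unit.\<close>

lemma op_ker_conformal_laplacian: "op_ker (conformal_laplacian \<theta> h) = range (\<lambda>c \<alpha>. c * h \<alpha>)"
proof (intro set_eqI iffI)
  fix f assume "f \<in> op_ker (conformal_laplacian \<theta> h)"
  then obtain g where g: "lmult g = f" "lmult (\<lambda>_. 0) = (\<lambda>\<alpha>. of_real ((norm (lattice_pt \<alpha>))\<^sup>2) * g \<alpha>)"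
    using conformal_laplacian_SomeD unfolding op_ker_def by blast
  have "g \<alpha> = g 0 * nct_U 0 \<alpha>" for \<alpha>
  proof (cases "\<alpha> = 0")
    case False
    then have "(norm (lattice_pt \<alpha>))\<^sup>2 \<noteq> 0" using norm_lattice_pt_ge_1[of \<alpha>] by auto
    then have "g \<alpha> = 0" using fun_cong[OF g(2), of \<alpha>] by simp
    then show ?thesis using False by (simp add: nct_U_def)
  qed (simp add: nct_U_def)
  then have "g = (\<lambda>\<alpha>. g 0 * nct_U 0 \<alpha>)" by blast
  then have "f = (\<lambda>\<alpha>. g 0 * h \<alpha>)" using g(1) lmult_scale_U by metis
  then show "f \<in> range (\<lambda>c \<alpha>. c * h \<alpha>)" by blast
next
  fix f assume "f \<in> range (\<lambda>c \<alpha>. c * h \<alpha>)"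
  then obtain c where "f = lmult (\<lambda>\<alpha>. c * nct_U 0 \<alpha>)" by (auto simp: lmult_scale_U)
  moreover have "conformal_laplacian \<theta> h (lmult (\<lambda>\<alpha>. c * nct_U 0 \<alpha>)) = Some (\<lambda>_. 0)"
  proof (rule conformal_laplacian_smooth)
    show "(\<lambda>\<alpha>. c * nct_U 0 \<alpha>) \<in> nct_smooth" by (intro nct_smooth_scale nct_smooth_U)
    show "(\<lambda>\<alpha>. of_real ((norm (lattice_pt \<alpha>))\<^sup>2) * (c * nct_U 0 \<alpha>)) = lmult (\<lambda>_. 0)"
      by (rule ext) (simp add: nct_U_def)
  qed simp
  ultimately show "f \<in> op_ker (conformal_laplacian \<theta> h)" by (simp add: op_ker_def)
qed

text \<open>To invert \<open>h\<inverse> \<Delta> h\<inverse>\<close> modulo its kernel at \<open>y\<close>, one subtracts from \<open>y\<close> its multiple of \<open>h\<close> that makes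
  \<open>h (y - c h)\<close> have mean zero, solves \<open>\<Delta> u = h (y - c h)\<close>, and adjusts the free constant of \<open>u\<close> so that
  \<open>h u\<close> is orthogonal to \<open>h\<close>. Such a solution is unique: the constant \<open>c\<close> is forced by the zero mode of
  the equation, then \<open>u\<close> is determined up to a constant, and the orthogonality forces that constant too.\<close>

lemma op_inverse_eq:
  assumes y: "y \<in> nct_smooth" and u: "u \<in> nct_smooth"
    and eq: "(\<lambda>\<alpha>. of_real ((norm (lattice_pt \<alpha>))\<^sup>2) * u \<alpha>) = lmult (\<lambda>\<alpha>. y \<alpha> - c * h \<alpha>)"
    and orth: "lmult (lmult u) 0 = 0"
  shows "op_inverse_mod_kernel (conformal_laplacian \<theta> h) y = Some (lmult u)"
proof -
  let ?L = "conformal_laplacian \<theta> h"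
  \<comment> \<open>the property that characterises the value of the inverse at \<open>y\<close>\<close>
  define Q where "Q = (\<lambda>x. x \<in> dom ?L \<and> (\<forall>z\<in>op_ker ?L. l2_inner z x = 0) \<and>
      (\<lambda>\<alpha>. y \<alpha> - the (?L x) \<alpha>) \<in> op_ker ?L)"
  have inner: "l2_inner (\<lambda>\<alpha>. d * h \<alpha>) x = cnj d * l2_inner h x" for d x
    unfolding l2_inner_def infsum_cmult_right'[symmetric] by (simp add: mult.assoc)
  have bounded: "\<exists>C. \<forall>\<alpha>. cmod (f \<alpha>) \<le> C" if "f \<in> l2" for f using l2_bounded[OF that] .
  have L: "?L (lmult u) = Some (\<lambda>\<alpha>. y \<alpha> - c * h \<alpha>)"
    by (rule conformal_laplacian_smooth[OF u _ eq]) (intro nct_smooth_diff nct_smooth_scale smooth y)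
  have Qu: "Q (lmult u)"
    unfolding Q_def op_ker_conformal_laplacian using L orth by (auto simp: inner inner_h)
  have data: "\<exists>g\<in>l2. \<exists>d. lmult g = x \<and> lmult (\<lambda>\<alpha>. y \<alpha> - d * h \<alpha>) = (\<lambda>\<alpha>. of_real ((norm (lattice_pt \<alpha>))\<^sup>2) * g \<alpha>)
      \<and> d = lmult y 0 / tau_h_sq \<and> lmult x 0 = 0 \<and> x \<in> l2" if "Q x" for x
  proof -
    from that obtain p where p: "?L x = Some p" unfolding Q_def by blast
    have "(\<lambda>\<alpha>. y \<alpha> - p \<alpha>) \<in> range (\<lambda>c \<alpha>. c * h \<alpha>)"
      using that p unfolding Q_def op_ker_conformal_laplacian by simp
    then obtain d where d: "(\<lambda>\<alpha>. y \<alpha> - p \<alpha>) = (\<lambda>\<alpha>. d * h \<alpha>)" by (elim rangeE)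
    have pd: "p = (\<lambda>\<alpha>. y \<alpha> - d * h \<alpha>)"
    proof
      fix \<alpha> show "p \<alpha> = y \<alpha> - d * h \<alpha>" using fun_cong[OF d, of \<alpha>] by (simp add: algebra_simps)
    qed
    obtain g where g: "g \<in> l2" "lmult g = x" "lmult p = (\<lambda>\<alpha>. of_real ((norm (lattice_pt \<alpha>))\<^sup>2) * g \<alpha>)"
      using conformal_laplacian_SomeD[OF p] by blast
    have "lmult (\<lambda>\<alpha>. 1 * y \<alpha> + (- d) * h \<alpha>) = (\<lambda>\<gamma>. 1 * lmult y \<gamma> + (- d) * lmult h \<gamma>)"
      by (intro nct_mult_lincomb smooth nct_smooth_bounded y)
    then have "lmult p 0 = lmult y 0 - d * tau_h_sq" by (simp add: pd tau_h_sq_def)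
    moreover have "lmult p 0 = 0" using fun_cong[OF g(3), of 0] by simp
    ultimately have "d = lmult y 0 / tau_h_sq" using tau_h_sq_nonzero by (simp add: field_simps)
    moreover have "l2_inner (\<lambda>\<alpha>. 1 * h \<alpha>) x = 0" using that unfolding Q_def op_ker_conformal_laplacian by blast
    moreover have "x \<in> l2" using p unfolding conformal_laplacian_def op_mult_inv_def
      by (auto simp: map_comp_Some_iff split: if_splits)
    ultimately show ?thesis using g pd by (auto simp: inner_h)
  qed
  have "x = lmult u" if x: "Q x" for x
  proof -
    obtain g d where g: "g \<in> l2" "lmult g = x" "lmult (\<lambda>\<alpha>. y \<alpha> - d * h \<alpha>) = (\<lambda>\<alpha>. of_real ((norm (lattice_pt \<alpha>))\<^sup>2) * g \<alpha>)"
      "d = lmult y 0 / tau_h_sq" "lmult x 0 = 0" using data[OF x] by blast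
    obtain g' d' where g': "g' \<in> l2" "lmult g' = lmult u" "lmult (\<lambda>\<alpha>. y \<alpha> - d' * h \<alpha>) = (\<lambda>\<alpha>. of_real ((norm (lattice_pt \<alpha>))\<^sup>2) * g' \<alpha>)"
      "d' = lmult y 0 / tau_h_sq" "lmult (lmult u) 0 = 0" "lmult u \<in> l2" using data[OF Qu] by blast
    define k where "k = g 0 - g' 0"
    have "g \<alpha> = 1 * g' \<alpha> + k * nct_U 0 \<alpha>" for \<alpha>
    proof (cases "\<alpha> = 0")
      case False
      then have "(norm (lattice_pt \<alpha>))\<^sup>2 \<noteq> 0" using norm_lattice_pt_ge_1[of \<alpha>] by auto
      moreover have "of_real ((norm (lattice_pt \<alpha>))\<^sup>2) * g \<alpha> = of_real ((norm (lattice_pt \<alpha>))\<^sup>2) * g' \<alpha>"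
        using fun_cong[OF g(3), of \<alpha>] fun_cong[OF g'(3), of \<alpha>] g(4) g'(4) by simp
      ultimately show ?thesis using False by (simp add: nct_U_def)
    qed (simp add: k_def nct_U_def)
    then have "g = (\<lambda>\<alpha>. 1 * g' \<alpha> + k * nct_U 0 \<alpha>)" by blast
    then have "x = lmult (\<lambda>\<alpha>. 1 * g' \<alpha> + k * nct_U 0 \<alpha>)" using g(2) by simp
    also have "\<dots> = (\<lambda>\<gamma>. 1 * lmult g' \<gamma> + k * lmult (nct_U 0) \<gamma>)"
      by (intro nct_mult_lincomb smooth bounded g'(1) l2_U)
    finally have xk: "x = (\<lambda>\<gamma>. 1 * lmult u \<gamma> + k * h \<gamma>)" using g'(2) by simp
    have "lmult (\<lambda>\<gamma>. 1 * lmult u \<gamma> + k * h \<gamma>) = (\<lambda>\<gamma>. 1 * lmult (lmult u) \<gamma> + k * lmult h \<gamma>)"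
      by (intro nct_mult_lincomb smooth bounded g'(6) nct_smooth_l2)
    then have "lmult x 0 = k * tau_h_sq" using xk g'(5) by (simp add: tau_h_sq_def)
    then have "k = 0" using g(5) tau_h_sq_nonzero by simp
    then show ?thesis using xk by simp
  qed
  then have "(THE x. Q x) = lmult u" using Qu by (intro the_equality)
  then show ?thesis unfolding op_inverse_mod_kernel_def Let_def Q_def[symmetric] using Qu by auto
qed

text \<open>The factor \<open>h\<inverse>\<close> of the vector field cancels the \<open>h\<close> in front of \<open>u\<close>, so on elements of the form
  \<open>h u\<close> the field acts as \<open>h\<close> times a derivation with constant coefficients.\<close>

lemma conformal_field_smooth:
  assumes u: "u \<in> nct_smooth"
  shows "conformal_field \<theta> h V (lmult u) = Some (lmult (\<lambda>\<gamma>. \<Sum>a\<in>UNIV. V $ a * (of_int (\<gamma> $ a) * u \<gamma>)))"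
proof -
  have *: "(op_mult \<theta> h \<circ>\<^sub>m op_delta a \<circ>\<^sub>m op_mult_inv \<theta> h) (lmult u) = Some (lmult (\<lambda>\<gamma>. of_int (\<gamma> $ a) * u \<gamma>))" for a
  proof -
    have "op_mult_inv \<theta> h (lmult u) = Some u"
      by (intro op_mult_inv_eq nct_smooth_l2 lmult_smooth u)
    then show ?thesis by (simp add: op_delta_smooth[OF u] op_mult_def nct_smooth_l2 nct_smooth_delta[OF u])
  qed
  then have "\<forall>a. lmult u \<in> dom (op_mult \<theta> h \<circ>\<^sub>m op_delta a \<circ>\<^sub>m op_mult_inv \<theta> h)" by blast
  then have "conformal_field \<theta> h V (lmult u) = Some (\<lambda>\<alpha>. \<Sum>a\<in>UNIV. V $ a * lmult (\<lambda>\<gamma>. of_int (\<gamma> $ a) * u \<gamma>) \<alpha>)"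
    unfolding conformal_field_def op_lincomb_def * by simp
  also have "(\<lambda>\<alpha>. \<Sum>a\<in>UNIV. V $ a * lmult (\<lambda>\<gamma>. of_int (\<gamma> $ a) * u \<gamma>) \<alpha>) =
      lmult (\<lambda>\<gamma>. \<Sum>a\<in>UNIV. V $ a * (of_int (\<gamma> $ a) * u \<gamma>))"
    by (rule nct_mult_sum[OF smooth nct_smooth_delta[OF u], symmetric])
  finally show ?thesis .
qed

end

section \<open>The operators as words in multiplications and multipliers\<close>

lemma fourier_multiplier_smooth:
  assumes "fourier_symbol k p q" "f \<in> nct_smooth"
  shows "(\<lambda>\<gamma>. p 0 (lattice_pt \<gamma>) * f \<gamma>) \<in> nct_smooth"
proof -
  obtain C where "\<And>\<xi>. cmod (p 0 \<xi>) \<le> C" using fourier_symbol_bounded[OF assms(1)] by blast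
  then show ?thesis by (intro nct_smooth_pointwise_mult[OF assms(2), where C = C and n = 0]) simp
qed

lemma fourier_symbol_lattice:
  assumes "fourier_symbol k p q" "\<alpha> \<noteq> 0"
  shows "p 0 (lattice_pt \<alpha>) = q 0 (lattice_pt \<alpha>)"
  using assms norm_lattice_pt_ge_1[OF assms(2)] by (simp add: fourier_symbol_def)

lemma taylor_term_zero_jet [simp]: "taylor_term i v (\<lambda>_ _. 0) \<beta> \<xi> = 0"
proof -
  have "(dir_deriv v ^^ i) (\<lambda>_ _. 0) = (\<lambda>_ _. 0)"
    by (induction i) (simp_all add: dir_deriv_def)
  then show ?thesis by (simp add: taylor_term_def)
qed

lemma taylor_term_0 [simp]: "taylor_term 0 v f = f"
  by (simp add: taylor_term_def)

text \<open>Here \<open>\<psi>\<close> is the symbol of the projection onto the zero mode, and \<open>n\<close> that of \<open>\<Delta>\<inverse>\<close> on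
  the other modes.\<close>

locale conformal_calculus = conformal_factor +
  fixes \<psi> n :: jet
  assumes cutoff: "fourier_symbol 0 \<psi> (\<lambda>_ _. 0)" and cutoff_0: "\<psi> 0 0 = 1"
    and inverse_laplace: "fourier_symbol 2 n inv_norm_sq"
begin

text \<open>The projection onto the zero mode, written as a Fourier multiplier in order to stay within the
  symbol calculus.\<close>

definition mean :: "nct \<Rightarrow> nct" where
  "mean f = (\<lambda>\<gamma>. \<psi> 0 (lattice_pt \<gamma>) * f \<gamma>)"

definition inv_lap :: "nct \<Rightarrow> nct" where
  "inv_lap f = (\<lambda>\<gamma>. n 0 (lattice_pt \<gamma>) * f \<gamma>)"

text \<open>The element \<open>h (y - c h)\<close> of mean zero, with the constant \<open>c = \<tau>(h y) / \<tau>(h\<^sup>2)\<close> expressed through the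
  projection onto the zero mode (lemma \<open>source_eq\<close>).\<close>

definition source :: "nct \<Rightarrow> nct" where
  "source y = (\<lambda>\<gamma>. lmult y \<gamma> + (- 1 / tau_h_sq) * lmult (lmult (mean (lmult y))) \<gamma>)"

text \<open>The inverse of the rescaled Laplacian: \<open>h\<close> times the solution \<open>u\<close> of \<open>\<Delta> u = h (y - c h)\<close>, where the second
  summand is the constant that makes \<open>h u\<close> orthogonal to \<open>h\<close>.\<close>

definition inverse_op :: "nct \<Rightarrow> nct" where
  "inverse_op y = lmult (\<lambda>\<gamma>. inv_lap (source y) \<gamma>
     + (- 1 / tau_h_sq) * mean (lmult (lmult (inv_lap (source y)))) \<gamma>)"

definition quad :: "complex^2 \<Rightarrow> complex^2 \<Rightarrow> jet \<Rightarrow> jet" where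
  "quad V W q = jet_mult (linear_jet V) (jet_mult (linear_jet W) q)"

text \<open>The operator \<open>V\<^sub>h W\<^sub>h \<Delta>\<^sub>h\<inverse>\<close>. Outside the disc of radius one half
  its multiplier is \<open>(V \<bullet> \<xi>) (W \<bullet> \<xi>) / \<parallel>\<xi>\<parallel>\<^sup>2\<close>, of degree zero.\<close>

definition second_order_op :: "complex^2 \<Rightarrow> complex^2 \<Rightarrow> nct \<Rightarrow> nct" where
  "second_order_op V W y = lmult (\<lambda>\<gamma>. quad V W n 0 (lattice_pt \<gamma>) * source y \<gamma>)"

lemma mean_eq: "mean f = (\<lambda>\<gamma>. f 0 * nct_U 0 \<gamma>)"
proof
  fix \<gamma>
  show "mean f \<gamma> = f 0 * nct_U 0 \<gamma>"
    using fourier_symbol_lattice[OF cutoff, of \<gamma>]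
    by (cases "\<gamma> = 0") (simp_all add: mean_def cutoff_0 nct_U_def)
qed

lemma lmult_mean: "lmult (mean f) = (\<lambda>\<gamma>. f 0 * h \<gamma>)"
  by (simp only: mean_eq lmult_scale_U)

lemma mean_smooth [simp]: "mean f \<in> nct_smooth"
  unfolding mean_eq by (intro nct_smooth_scale nct_smooth_U)

lemma inv_lap_smooth: "f \<in> nct_smooth \<Longrightarrow> inv_lap f \<in> nct_smooth"
  unfolding inv_lap_def by (rule fourier_multiplier_smooth[OF inverse_laplace])

lemma source_smooth: "y \<in> nct_smooth \<Longrightarrow> source y \<in> nct_smooth"
  unfolding source_def by (intro nct_smooth_add nct_smooth_scale lmult_smooth mean_smooth)

lemma inverse_op_smooth: "y \<in> nct_smooth \<Longrightarrow> inverse_op y \<in> nct_smooth"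
  unfolding inverse_op_def by (intro lmult_smooth nct_smooth_add nct_smooth_scale inv_lap_smooth source_smooth mean_smooth)

lemma source_eq:
  assumes "y \<in> nct_smooth"
  shows "source y = lmult (\<lambda>\<alpha>. y \<alpha> - lmult y 0 / tau_h_sq * h \<alpha>)"
proof -
  have "lmult (\<lambda>\<alpha>. 1 * y \<alpha> + (- (lmult y 0 / tau_h_sq)) * h \<alpha>)
      = (\<lambda>\<gamma>. 1 * lmult y \<gamma> + (- (lmult y 0 / tau_h_sq)) * lmult h \<gamma>)"
    by (intro nct_mult_lincomb smooth nct_smooth_bounded assms)
  then show ?thesis by (simp add: source_def mean_eq lmult_scale_U nct_mult_scale)
qed

lemma source_mean_zero: "source y 0 = 0"
  using tau_h_sq_nonzero by (simp add: source_def mean_eq lmult_scale_U nct_mult_scale tau_h_sq_def)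

lemma inverse_laplace_lattice:
  assumes "\<alpha> \<noteq> 0"
  shows "of_real ((norm (lattice_pt \<alpha>))\<^sup>2) * n 0 (lattice_pt \<alpha>) = 1"
proof -
  have "(norm (lattice_pt \<alpha>))\<^sup>2 \<noteq> 0" using norm_lattice_pt_ge_1[OF assms] by auto
  then show ?thesis
    by (simp add: fourier_symbol_lattice[OF inverse_laplace assms] inv_norm_sq_0 flip: of_real_mult of_real_power)
qed

lemma op_inverse_smooth:
  assumes y: "y \<in> nct_smooth"
  shows "op_inverse_mod_kernel (conformal_laplacian \<theta> h) y = Some (inverse_op y)"
  unfolding inverse_op_def
proof (rule op_inverse_eq[OF y, where c = "lmult y 0 / tau_h_sq"])
  let ?v = "inv_lap (source y)"
  let ?u = "\<lambda>\<gamma>. ?v \<gamma> + (- 1 / tau_h_sq) * mean (lmult (lmult ?v)) \<gamma>"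
  have v: "?v \<in> nct_smooth" by (intro inv_lap_smooth source_smooth y)
  show "?u \<in> nct_smooth" by (intro nct_smooth_add nct_smooth_scale v mean_smooth)
  show "(\<lambda>\<alpha>. of_real ((norm (lattice_pt \<alpha>))\<^sup>2) * ?u \<alpha>) = lmult (\<lambda>\<alpha>. y \<alpha> - lmult y 0 / tau_h_sq * h \<alpha>)"
    unfolding source_eq[OF y, symmetric]
  proof
    fix \<alpha>
    show "of_real ((norm (lattice_pt \<alpha>))\<^sup>2) * ?u \<alpha> = source y \<alpha>"
    proof (cases "\<alpha> = 0")
      case True
      then show ?thesis by (simp add: source_mean_zero)
    next
      case False
      then have "?u \<alpha> = n 0 (lattice_pt \<alpha>) * source y \<alpha>" by (simp add: mean_eq nct_U_def inv_lap_def)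
      then have "of_real ((norm (lattice_pt \<alpha>))\<^sup>2) * ?u \<alpha> =
          (of_real ((norm (lattice_pt \<alpha>))\<^sup>2) * n 0 (lattice_pt \<alpha>)) * source y \<alpha>" by (simp only: mult.assoc)
      then show ?thesis unfolding inverse_laplace_lattice[OF False] by (simp only: mult_1_left)
    qed
  qed
  have "lmult (\<lambda>\<gamma>. 1 * ?v \<gamma> + (- 1 / tau_h_sq) * mean (lmult (lmult ?v)) \<gamma>) =
      (\<lambda>\<gamma>. 1 * lmult ?v \<gamma> + (- 1 / tau_h_sq) * lmult (mean (lmult (lmult ?v))) \<gamma>)"
    by (intro nct_mult_lincomb smooth nct_smooth_bounded v mean_smooth)
  then have once: "lmult ?u = (\<lambda>\<gamma>. 1 * lmult ?v \<gamma> + (- 1 / tau_h_sq * lmult (lmult ?v) 0) * h \<gamma>)"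
    by (simp only: lmult_mean mult_1_left mult.assoc)
  have "lmult (\<lambda>\<gamma>. 1 * lmult ?v \<gamma> + (- 1 / tau_h_sq * lmult (lmult ?v) 0) * h \<gamma>) = (\<lambda>\<gamma>. 1 * lmult (lmult ?v) \<gamma> + (- 1 / tau_h_sq * lmult (lmult ?v) 0) * lmult h \<gamma>)"
    by (intro nct_mult_lincomb smooth nct_smooth_bounded v lmult_smooth)
  then have "lmult (lmult ?u) 0 = 1 * lmult (lmult ?v) 0 + (- 1 / tau_h_sq * lmult (lmult ?v) 0) * lmult h 0"
    unfolding once by (rule fun_cong)
  also have "\<dots> = 0" unfolding tau_h_sq_def[symmetric] using tau_h_sq_nonzero by simp
  finally show "lmult (lmult ?u) 0 = 0" .
qed

text \<open>The two factors \<open>h\<inverse> h\<close> that arise between the fields and the inverse cancel, and the constant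
  summand of the solution is killed by the derivations. What remains is a single multiplier between
  two multiplications by \<open>h\<close>.\<close>

lemma fields_after_inverse:
  assumes y: "y \<in> nct_smooth"
  shows "(conformal_field \<theta> h V \<circ>\<^sub>m conformal_field \<theta> h W \<circ>\<^sub>m op_inverse_mod_kernel (conformal_laplacian \<theta> h)) y
    = Some (second_order_op V W y)"
proof -
  let ?v = "inv_lap (source y)"
  let ?u = "\<lambda>\<gamma>. ?v \<gamma> + (- 1 / tau_h_sq) * mean (lmult (lmult ?v)) \<gamma>"
  let ?D = "\<lambda>V u \<gamma>. \<Sum>a\<in>UNIV. V $ a * (of_int (\<gamma> $ a) * u \<gamma>)"
  have u: "?u \<in> nct_smooth" by (intro nct_smooth_add nct_smooth_scale inv_lap_smooth source_smooth y mean_smooth)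
  have Du: "?D W ?u \<in> nct_smooth"
    by (intro nct_smooth_sum nct_smooth_scale nct_smooth_delta u)
  have "?D V (?D W ?u) = (\<lambda>\<gamma>. quad V W n 0 (lattice_pt \<gamma>) * source y \<gamma>)"
  proof
    fix \<gamma>
    show "?D V (?D W ?u) \<gamma> = quad V W n 0 (lattice_pt \<gamma>) * source y \<gamma>"
    proof (cases "\<gamma> = 0")
      case True
      then show ?thesis by (simp add: source_mean_zero)
    next
      case False
      then have "?u \<gamma> = n 0 (lattice_pt \<gamma>) * source y \<gamma>" by (simp add: mean_eq nct_U_def inv_lap_def)
      moreover have "quad V W n 0 (lattice_pt \<gamma>) =
          (\<Sum>a\<in>UNIV. V $ a * of_int (\<gamma> $ a)) * ((\<Sum>a\<in>UNIV. W $ a * of_int (\<gamma> $ a)) * n 0 (lattice_pt \<gamma>))"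
        by (simp add: quad_def linear_jet_def)
      ultimately show ?thesis by (simp only: sum_2) (simp add: algebra_simps)
    qed
  qed
  then have last: "conformal_field \<theta> h V (lmult (?D W ?u)) = Some (second_order_op V W y)"
    using conformal_field_smooth[OF Du, of V] unfolding second_order_op_def by (simp only:)
  have inv: "op_inverse_mod_kernel (conformal_laplacian \<theta> h) y = Some (lmult ?u)"
    using op_inverse_smooth[OF y] unfolding inverse_op_def .
  have first: "(conformal_field \<theta> h V \<circ>\<^sub>m conformal_field \<theta> h W \<circ>\<^sub>m op_inverse_mod_kernel (conformal_laplacian \<theta> h)) y
      = (conformal_field \<theta> h V \<circ>\<^sub>m conformal_field \<theta> h W) (lmult ?u)"
    by (rule map_comp_simps(2)) (rule inv)
  have second: "(conformal_field \<theta> h V \<circ>\<^sub>m conformal_field \<theta> h W) (lmult ?u) = conformal_field \<theta> h V (lmult (?D W ?u))"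
    by (rule map_comp_simps(2)) (rule conformal_field_smooth[OF u])
  show ?thesis unfolding first second by (rule last)
qed

text \<open>The correction by the zero mode has a symbol without homogeneous components.\<close>

lemma pdo_source:
  assumes "pdo \<theta> T s"
  shows "pdo \<theta> (\<lambda>y. source (T y)) (\<lambda>j \<xi>. lmult (s j \<xi>))"
proof -
  have 1: "pdo \<theta> (\<lambda>y. lmult (T y)) (\<lambda>j \<xi>. lmult (s j \<xi>))"
    by (rule pdo_left_mult[OF assms smooth])
  have "pdo \<theta> (\<lambda>y. mean (lmult (T y))) (\<lambda>j \<xi> \<gamma>. 0)"
    using pdo_fourier[OF 1 cutoff] by (simp add: mean_def)
  from pdo_add_scale[OF 1 pdo_left_mult[OF pdo_left_mult[OF this smooth] smooth], of "- 1 / tau_h_sq"]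
  show ?thesis by (simp add: source_def)
qed

lemma pdo_second_order_op:
  assumes "pdo \<theta> T s"
  shows "pdo \<theta> (\<lambda>y. second_order_op V W (T y)) (\<lambda>j \<xi>. lmult (\<lambda>\<gamma>. \<Sum>l<Suc j.
    taylor_term (j - l) (lattice_pt \<gamma>) (quad V W inv_norm_sq) 0 \<xi> * lmult (s l \<xi>) \<gamma>))"
proof -
  have "fourier_symbol 0 (quad V W n) (quad V W inv_norm_sq)"
    unfolding quad_def by (rule fourier_symbol_quadratic[OF inverse_laplace])
  from pdo_left_mult[OF pdo_fourier[OF pdo_source[OF assms] this] smooth]
  show ?thesis unfolding second_order_op_def by (simp only: diff_zero)
qed

text \<open>The inverse has order \<open>- 2\<close>, with leading part \<open>h\<^sup>2 / \<parallel>\<xi>\<parallel>\<^sup>2\<close>.\<close>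

lemma pdo_inverse_op:
  "\<exists>s. pdo \<theta> inverse_op s \<and> s 0 = (\<lambda>_ _. 0) \<and> s 1 = (\<lambda>_ _. 0) \<and>
     (\<forall>\<xi>. s 2 \<xi> = (\<lambda>\<gamma>. inv_norm_sq 0 \<xi> * lmult h \<gamma>))"
proof -
  let ?s = "\<lambda>(j::nat) (\<xi>::real^2). if j = 0 then nct_U 0 else (\<lambda>_. 0)"
  define s1 where "s1 = (\<lambda>j \<xi> \<gamma>. \<Sum>l<Suc j - 2. taylor_term (j - 2 - l) (lattice_pt \<gamma>) inv_norm_sq 0 \<xi> * lmult (?s l \<xi>) \<gamma>)"
  have 1: "pdo \<theta> (\<lambda>y. inv_lap (source y)) s1"
    using pdo_fourier[OF pdo_source[OF pdo_id] inverse_laplace] unfolding inv_lap_def s1_def .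
  have "pdo \<theta> (\<lambda>y. mean (lmult (lmult (inv_lap (source y))))) (\<lambda>j \<xi> \<gamma>. 0)"
    using pdo_fourier[OF pdo_left_mult[OF pdo_left_mult[OF 1 smooth] smooth] cutoff] by (simp add: mean_def)
  from pdo_left_mult[OF pdo_add_scale[OF 1 this, of "- 1 / tau_h_sq"] smooth]
  have "pdo \<theta> inverse_op (\<lambda>j \<xi>. lmult (s1 j \<xi>))"
    by (simp add: inverse_op_def[abs_def])
  moreover have "s1 0 = (\<lambda>_ _. 0)" "s1 1 = (\<lambda>_ _. 0)" by (simp_all add: s1_def One_nat_def)
  moreover have "s1 2 \<xi> = (\<lambda>\<gamma>. inv_norm_sq 0 \<xi> * h \<gamma>)" for \<xi>
    by (simp add: s1_def numeral_2_eq_2)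
  ultimately show ?thesis
    by (intro exI[of _ "\<lambda>j \<xi>. lmult (s1 j \<xi>)"]) (simp add: nct_mult_scale)
qed

end

section \<open>The residue and the two functionals\<close>

definition circle_pt :: "real \<Rightarrow> real^2" where
  "circle_pt t = vector [cos t, sin t]"

lemma circle_pt_nth [simp]: "circle_pt t $ 1 = cos t" "circle_pt t $ 2 = sin t"
  by (simp_all add: circle_pt_def)

lemma norm_circle_pt [simp]: "norm (circle_pt t) = 1"
  by (simp add: norm_vec_def L2_set_def sum_2)

lemma circle_pt_nonzero [simp]: "circle_pt t \<noteq> 0"
  using norm_circle_pt[of t] by (metis norm_zero zero_neq_one)

lemma has_derivative_circle_pt: "(circle_pt has_derivative (\<lambda>s. s *\<^sub>R vector [- sin t, cos t])) (at t within T)"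
proof -
  have eq: "circle_pt = (\<lambda>t. cos t *\<^sub>R axis 1 1 + sin t *\<^sub>R axis 2 1)"
    by (simp add: fun_eq_iff vec_eq_iff forall_2 axis_def)
  show ?thesis unfolding eq
    by (auto intro!: derivative_eq_intros simp: fun_eq_iff vec_eq_iff forall_2 axis_def)
qed

text \<open>Euler's relation for degree \<open>- 1\<close>, from differentiating \<open>f (t \<xi>) = f \<xi> / t\<close> at \<open>t = 1\<close>.\<close>

lemma euler_identity:
  assumes f: "derivs_on (- {0}) f" and hom: "homogeneous d f" and deg: "d - int (mdeg \<beta>) = - 1" and \<xi>: "\<xi> \<noteq> 0"
  shows "(\<Sum>a\<in>UNIV. of_real (\<xi> $ a) * f (\<beta> + axis a 1) \<xi>) = - f \<beta> \<xi>"
proof -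
  have 1: "((\<lambda>t. f \<beta> (\<xi> + t *\<^sub>R \<xi>)) has_vector_derivative dir_deriv \<xi> f \<beta> (\<xi> + 0 *\<^sub>R \<xi>)) (at 0)"
    by (rule has_vector_derivative_ray[OF f]) (use \<xi> in simp)
  have "((\<lambda>t. inverse (1 + t)) has_field_derivative - 1) (at (0::real))"
    by (auto intro!: derivative_eq_intros)
  then have "((\<lambda>t. inverse (1 + t) *\<^sub>R f \<beta> \<xi>) has_vector_derivative - f \<beta> \<xi>) (at 0)"
    using has_vector_derivative_scaleR[OF _ has_vector_derivative_const] by fastforce
  then have 2: "((\<lambda>t. f \<beta> (\<xi> + t *\<^sub>R \<xi>)) has_vector_derivative - f \<beta> \<xi>) (at 0)"
  proof (rule has_vector_derivative_transform_within_open[where S = "{-1<..}"])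
    fix t :: real assume "t \<in> {-1<..}"
    then have "f \<beta> ((1 + t) *\<^sub>R \<xi>) = of_real ((1 + t) powi (- 1)) * f \<beta> \<xi>"
      using hom[unfolded homogeneous_def, rule_format, of "1 + t" \<xi> \<beta>] \<xi> deg by simp
    then show "inverse (1 + t) *\<^sub>R f \<beta> \<xi> = f \<beta> (\<xi> + t *\<^sub>R \<xi>)"
      by (simp add: scaleR_conv_of_real[where 'a = complex] algebra_simps power_int_minus)
  qed auto
  from vector_derivative_unique_at[OF 1 2] show ?thesis by (simp add: dir_deriv_def)
qed

text \<open>Why the Einstein functional vanishes. A partial derivative of a function \<open>g\<close> of degree \<open>- 1\<close> on the
  plane has integral zero over the unit circle: by Euler's relation its restriction to the circle is
  the derivative of \<open>- sin t g\<close> in the first direction and of \<open>cos t g\<close> in the second. This is special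
  to the degree \<open>1 - n\<close> in dimension \<open>n = 2\<close>.\<close>

lemma circle_integral_derivative:
  assumes f: "derivs_on (- {0}) f" and hom: "homogeneous d f" and deg: "d - int (mdeg \<beta>) = - 1"
  shows "((\<lambda>t. f (\<beta> + axis a 1) (circle_pt t)) has_integral 0) {0..2 * pi}"
proof -
  let ?g = "\<lambda>t. f \<beta> (circle_pt t)" and ?f = "\<lambda>a t. f (\<beta> + axis a 1) (circle_pt t)"
  let ?g' = "\<lambda>t. - of_real (sin t) * ?f 1 t + of_real (cos t) * ?f 2 t"
  have g': "(?g has_vector_derivative ?g' t) (at t within {0..2*pi})" for t
    unfolding has_vector_derivative_def
    by (rule has_derivative_eq_rhs[OF has_derivative_compose[OF has_derivative_circle_pt derivs_onD[OF f]]])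
       (auto simp: sum_2 scaleR_conv_of_real[where 'a = complex] algebra_simps)
  have euler: "?g t = - (of_real (cos t) * ?f 1 t + of_real (sin t) * ?f 2 t)" for t
    using euler_identity[OF f hom deg, of "circle_pt t"] by (simp add: sum_2 equation_minus_iff)
  have sc: "of_real (sin t) * of_real (sin t) + of_real (cos t) * of_real (cos t) = (1 :: complex)" for t
  proof -
    have "sin t * sin t + cos t * cos t = 1" by (simp add: power2_eq_square[symmetric])
    then have "of_real (sin t * sin t + cos t * cos t) = (1 :: complex)" by (simp only: of_real_1)
    then show ?thesis by (simp only: of_real_mult of_real_add)
  qed
  have period: "?g (2 * pi) = ?g 0" by (simp add: circle_pt_def)
  consider "a = 1" | "a = 2" using exhaust_2 by blast
  then show ?thesis
  proof cases
    case 1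
    have d: "((\<lambda>t. of_real (- sin t) * ?g t) has_vector_derivative ?f 1 t) (at t within {0..2*pi})" for t
    proof -
      have "((\<lambda>t. of_real (- sin t) * ?g t) has_vector_derivative of_real (- sin t) * ?g' t + of_real (- cos t) * ?g t) (at t within {0..2*pi})"
        by (intro has_vector_derivative_mult has_vector_derivative_of_real g') (auto intro!: derivative_eq_intros)
      moreover have "of_real (- sin t) * ?g' t + of_real (- cos t) * ?g t =
          (of_real (sin t) * of_real (sin t) + of_real (cos t) * of_real (cos t)) * ?f 1 t"
        unfolding euler by (simp add: algebra_simps)
      ultimately show ?thesis unfolding sc by simp
    qed
    have "(?f 1 has_integral of_real (- sin (2 * pi)) * ?g (2 * pi) - of_real (- sin 0) * ?g 0) {0..2*pi}"
      by (rule fundamental_theorem_of_calculus[OF _ d]) simp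
    then show ?thesis using 1 by simp
  next
    case 2
    have d: "((\<lambda>t. of_real (cos t) * ?g t) has_vector_derivative ?f 2 t) (at t within {0..2*pi})" for t
    proof -
      have "((\<lambda>t. of_real (cos t) * ?g t) has_vector_derivative of_real (cos t) * ?g' t + of_real (- sin t) * ?g t) (at t within {0..2*pi})"
        by (intro has_vector_derivative_mult has_vector_derivative_of_real g') (auto intro!: derivative_eq_intros)
      moreover have "of_real (cos t) * ?g' t + of_real (- sin t) * ?g t =
          (of_real (sin t) * of_real (sin t) + of_real (cos t) * of_real (cos t)) * ?f 2 t"
        unfolding euler by (simp add: algebra_simps)
      ultimately show ?thesis unfolding sc by simp
    qed
    have "(?f 2 has_integral of_real (cos (2 * pi)) * ?g (2 * pi) - of_real (cos 0) * ?g 0) {0..2*pi}"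
      by (rule fundamental_theorem_of_calculus[OF _ d]) simp
    then show ?thesis using 2 period by simp
  qed
qed

lemma circle_integral_quadratic:
  fixes V W :: "complex^2"
  shows "((\<lambda>t. (\<Sum>a\<in>UNIV. V $ a * of_real (circle_pt t $ a)) * (\<Sum>a\<in>UNIV. W $ a * of_real (circle_pt t $ a)))
    has_integral of_real pi * (\<Sum>a\<in>UNIV. V $ a * W $ a)) {0..2 * pi}"
proof -
  \<comment> \<open>a primitive of the integrand\<close>
  let ?F = "\<lambda>t. (V $ 1 * W $ 1) * of_real ((t + sin t * cos t) / 2) + (V $ 2 * W $ 2) * of_real ((t - sin t * cos t) / 2)
    + (V $ 1 * W $ 2 + V $ 2 * W $ 1) * of_real ((sin t)\<^sup>2 / 2)"
  let ?f = "\<lambda>t. (V $ 1 * W $ 1) * of_real ((cos t)\<^sup>2) + (V $ 2 * W $ 2) * of_real ((sin t)\<^sup>2)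
    + (V $ 1 * W $ 2 + V $ 2 * W $ 1) * of_real (sin t * cos t)"
  have "(?F has_vector_derivative ?f t) (at t within {0..2*pi})" for t
  proof (intro has_vector_derivative_add has_vector_derivative_mult_right has_vector_derivative_of_real)
    have s: "(sin t)\<^sup>2 + (cos t)\<^sup>2 = 1" by simp
    show "((\<lambda>t. (t + sin t * cos t) / 2) has_field_derivative (cos t)\<^sup>2) (at t within {0..2*pi})"
      using s by (auto intro!: derivative_eq_intros simp: power2_eq_square)
    show "((\<lambda>t. (t - sin t * cos t) / 2) has_field_derivative (sin t)\<^sup>2) (at t within {0..2*pi})"
      using s by (auto intro!: derivative_eq_intros simp: power2_eq_square)
    show "((\<lambda>t. (sin t)\<^sup>2 / 2) has_field_derivative sin t * cos t) (at t within {0..2*pi})"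
      by (auto intro!: derivative_eq_intros)
  qed
  then have "(?f has_integral ?F (2 * pi) - ?F 0) {0..2*pi}"
    by (intro fundamental_theorem_of_calculus) auto
  moreover have "?F (2 * pi) - ?F 0 = of_real pi * (\<Sum>a\<in>UNIV. V $ a * W $ a)"
    by (simp add: sum_2 algebra_simps)
  moreover have "?f = (\<lambda>t. (\<Sum>a\<in>UNIV. V $ a * of_real (circle_pt t $ a)) * (\<Sum>a\<in>UNIV. W $ a * of_real (circle_pt t $ a)))"
    by (rule ext) (simp add: sum_2 power2_eq_square algebra_simps)
  ultimately show ?thesis by simp
qed

lemma residue_density_pdo:
  assumes "pdo \<theta> T s" "\<And>a. a \<in> nct_smooth \<Longrightarrow> P a = Some (T a)"
  shows "residue_density \<theta> P = (\<lambda>\<alpha>. integral {0..2 * pi} (\<lambda>t. s 2 (circle_pt t) \<alpha>))"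
proof -
  have "homogeneous_component \<theta> P (- 2) (circle_pt t) = s 2 (circle_pt t)" for t
    using homogeneous_component_pdo[OF assms circle_pt_nonzero, where j = 2] by simp
  then show ?thesis by (simp add: residue_density_def circle_pt_def)
qed

context conformal_calculus
begin

text \<open>The component of order \<open>- 2\<close> is that of \<open>h m(D) h\<close>, where \<open>m\<close> has degree zero: \<open>h\<close> times the second
  Taylor term of \<open>m\<close> acting on \<open>h\<close>. So its coefficients are second derivatives of \<open>m\<close>, that is, first
  derivatives of functions of degree \<open>- 1\<close>.\<close>

lemma einstein_density_zero:
  "einstein_density \<theta> (conformal_laplacian \<theta> h) (conformal_field \<theta> h V) (conformal_field \<theta> h W) = (\<lambda>_. 0)"
proof
  fix \<alpha>
  let ?q = "quad V W inv_norm_sq"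
  have q: "derivs_on (- {0}) ?q" "homogeneous 0 ?q"
    using fourier_symbol_quadratic[OF inverse_laplace, of V W] by (auto simp: fourier_symbol_def quad_def)
  let ?D = "\<lambda>a b \<gamma>. of_int (\<gamma> $ a) * (of_int (\<gamma> $ b) * h \<gamma>)"
  have D: "?D a b \<in> nct_smooth" for a b by (intro nct_smooth_delta smooth)
  have t2: "taylor_term 2 (lattice_pt \<gamma>) ?q 0 \<xi> * h \<gamma> =
      (\<Sum>a\<in>UNIV. \<Sum>b\<in>UNIV. (?q (0 + axis a 1 + axis b 1) \<xi> / 2) * ?D a b \<gamma>)" for \<gamma> \<xi>
    by (simp add: taylor_term_def numeral_2_eq_2 dir_deriv_def sum_2 algebra_simps add.assoc)
  have comp: "lmult (\<lambda>\<gamma>. \<Sum>l<Suc 2. taylor_term (2 - l) (lattice_pt \<gamma>) ?q 0 \<xi> *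
        lmult (if l = 0 then nct_U 0 else (\<lambda>_. 0)) \<gamma>) \<alpha> =
      (\<Sum>a\<in>UNIV. \<Sum>b\<in>UNIV. (?q (0 + axis a 1 + axis b 1) \<xi> / 2) * lmult (?D a b) \<alpha>)" for \<xi>
  proof -
    have "lmult (\<lambda>\<gamma>. \<Sum>l<Suc 2. taylor_term (2 - l) (lattice_pt \<gamma>) ?q 0 \<xi> * lmult (if l = 0 then nct_U 0 else (\<lambda>_. 0)) \<gamma>)
        = lmult (\<lambda>\<gamma>. \<Sum>a\<in>UNIV. 1 * (\<Sum>b\<in>UNIV. (?q (0 + axis a 1 + axis b 1) \<xi> / 2) * ?D a b \<gamma>))"
      unfolding sum.lessThan_Suc_shift by (simp add: t2)
    also have "\<dots> = (\<lambda>\<gamma>. \<Sum>a\<in>UNIV. 1 * lmult (\<lambda>\<gamma>. \<Sum>b\<in>UNIV. (?q (0 + axis a 1 + axis b 1) \<xi> / 2) * ?D a b \<gamma>) \<gamma>)"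
      by (rule nct_mult_sum[OF smooth]) (intro nct_smooth_sum nct_smooth_scale D)
    also have "\<dots> = (\<lambda>\<gamma>. \<Sum>a\<in>UNIV. \<Sum>b\<in>UNIV. (?q (0 + axis a 1 + axis b 1) \<xi> / 2) * lmult (?D a b) \<gamma>)"
      by (simp only: nct_mult_sum[OF smooth D] mult_1_left)
    finally show ?thesis by simp
  qed
  have density: "residue_density \<theta> (conformal_field \<theta> h V \<circ>\<^sub>m conformal_field \<theta> h W
        \<circ>\<^sub>m op_inverse_mod_kernel (conformal_laplacian \<theta> h)) =
      (\<lambda>\<alpha>. integral {0..2 * pi} (\<lambda>t. lmult (\<lambda>\<gamma>. \<Sum>l<Suc 2. taylor_term (2 - l) (lattice_pt \<gamma>) ?q 0 (circle_pt t) *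
        lmult (if l = 0 then nct_U 0 else (\<lambda>_. 0)) \<gamma>) \<alpha>))"
    by (rule residue_density_pdo[OF pdo_second_order_op[OF pdo_id]]) (rule fields_after_inverse)
  have "((\<lambda>t. ?q (0 + axis a 1 + axis b 1) (circle_pt t)) has_integral 0) {0..2 * pi}" for a b
    by (rule circle_integral_derivative[OF q]) (subst mdeg_add_axis, simp)
  then have "((\<lambda>t. ?q (0 + axis a 1 + axis b 1) (circle_pt t) * (lmult (?D a b) \<alpha> / 2)) has_integral 0 * (lmult (?D a b) \<alpha> / 2)) {0..2 * pi}" for a b
    by (intro has_integral_mult_left)
  then have "((\<lambda>t. (?q (0 + axis a 1 + axis b 1) (circle_pt t) / 2) * lmult (?D a b) \<alpha>) has_integral 0) {0..2 * pi}" for a b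
    by simp
  then have "((\<lambda>t. \<Sum>a\<in>UNIV. \<Sum>b\<in>UNIV. (?q (0 + axis a 1 + axis b 1) (circle_pt t) / 2) * lmult (?D a b) \<alpha>) has_integral
      (\<Sum>a\<in>(UNIV::2 set). \<Sum>b\<in>(UNIV::2 set). 0)) {0..2 * pi}"
    by (intro has_integral_sum) auto
  then show "einstein_density \<theta> (conformal_laplacian \<theta> h) (conformal_field \<theta> h V) (conformal_field \<theta> h W) \<alpha> = 0"
    unfolding einstein_density_def density comp by (simp only: integral_unique sum.neutral_const)
qed

text \<open>The operator has order \<open>- 2\<close>, so its component of that order is the product of the leading parts of
  its factors, \<open>m(\<xi>) h\<^sup>4 / \<parallel>\<xi>\<parallel>\<^sup>2\<close>.\<close>

lemma metric_functional_eq: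
  "metric_functional \<theta> (conformal_laplacian \<theta> h) (conformal_field \<theta> h V) (conformal_field \<theta> h W) =
     of_real pi * nct_tau (lmult (lmult (lmult h))) * (\<Sum>a\<in>UNIV. V $ a * W $ a)"
proof -
  let ?L = "conformal_laplacian \<theta> h" and ?q = "quad V W inv_norm_sq"
  obtain s where s: "pdo \<theta> inverse_op s" "s 0 = (\<lambda>_ _. 0)" "s 1 = (\<lambda>_ _. 0)"
    "\<And>\<xi>. s 2 \<xi> = (\<lambda>\<gamma>. inv_norm_sq 0 \<xi> * lmult h \<gamma>)"
    using pdo_inverse_op by blast
  have P: "(conformal_field \<theta> h V \<circ>\<^sub>m conformal_field \<theta> h W \<circ>\<^sub>m op_inverse_mod_kernel ?L \<circ>\<^sub>m op_inverse_mod_kernel ?L) a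
      = Some (second_order_op V W (inverse_op a))" if a: "a \<in> nct_smooth" for a
    using fields_after_inverse[OF inverse_op_smooth[OF a], of V W] by (simp add: op_inverse_smooth[OF a])
  have comp: "lmult (\<lambda>\<gamma>. \<Sum>l<Suc 2. taylor_term (2 - l) (lattice_pt \<gamma>) ?q 0 (circle_pt t) * lmult (s l (circle_pt t)) \<gamma>) 0
      = ((\<Sum>a\<in>UNIV. V $ a * of_real (circle_pt t $ a)) * (\<Sum>a\<in>UNIV. W $ a * of_real (circle_pt t $ a)))
        * nct_tau (lmult (lmult (lmult h)))" for t
  proof -
    have inv: "inv_norm_sq 0 (circle_pt t) = 1" by (simp add: inv_norm_sq_0)
    have "?q 0 (circle_pt t) = (\<Sum>a\<in>UNIV. V $ a * of_real (circle_pt t $ a)) * (\<Sum>a\<in>UNIV. W $ a * of_real (circle_pt t $ a))"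
      unfolding quad_def jet_mult_0 inv by (simp add: linear_jet_def)
    moreover have "(\<lambda>\<gamma>. \<Sum>l<Suc 2. taylor_term (2 - l) (lattice_pt \<gamma>) ?q 0 (circle_pt t) * lmult (s l (circle_pt t)) \<gamma>)
        = (\<lambda>\<gamma>. ?q 0 (circle_pt t) * lmult (lmult h) \<gamma>)"
      using s(2-4) by (simp add: numeral_2_eq_2 One_nat_def inv[unfolded One_nat_def])
    ultimately show ?thesis by (simp only: nct_mult_scale nct_tau_def)
  qed
  have density: "residue_density \<theta> (conformal_field \<theta> h V \<circ>\<^sub>m conformal_field \<theta> h W
        \<circ>\<^sub>m op_inverse_mod_kernel ?L \<circ>\<^sub>m op_inverse_mod_kernel ?L) =
      (\<lambda>\<alpha>. integral {0..2 * pi} (\<lambda>t. lmult (\<lambda>\<gamma>. \<Sum>l<Suc 2.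
        taylor_term (2 - l) (lattice_pt \<gamma>) ?q 0 (circle_pt t) * lmult (s l (circle_pt t)) \<gamma>) \<alpha>))"
    by (rule residue_density_pdo[OF pdo_second_order_op[OF s(1)]]) (rule P)
  have "metric_functional \<theta> ?L (conformal_field \<theta> h V) (conformal_field \<theta> h W) =
      integral {0..2 * pi} (\<lambda>t. ((\<Sum>a\<in>UNIV. V $ a * of_real (circle_pt t $ a)) * (\<Sum>a\<in>UNIV. W $ a * of_real (circle_pt t $ a)))
        * nct_tau (lmult (lmult (lmult h))))"
    unfolding metric_functional_def wodzicki_residue_def density by (subst nct_tau_def) (simp only: comp)
  also have "\<dots> = of_real pi * (\<Sum>a\<in>UNIV. V $ a * W $ a) * nct_tau (lmult (lmult (lmult h)))"
    by (rule integral_unique[OF has_integral_mult_left[OF circle_integral_quadratic]])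
  finally show ?thesis by (simp only: mult_ac)
qed

end

theorem proposition5p2:
  fixes \<theta> :: real and h :: nct and V W :: "complex^2"
  assumes "h \<in> nct_smooth"
    and "nct_positive \<theta> h"
    and "nct_boundedly_invertible \<theta> h"
  shows "metric_functional \<theta> (conformal_laplacian \<theta> h)
           (conformal_field \<theta> h V) (conformal_field \<theta> h W) =
         of_real pi * nct_tau (nct_mult \<theta> h (nct_mult \<theta> h (nct_mult \<theta> h h))) *
           (\<Sum>a\<in>UNIV. V $ a * W $ a) \<and>
         einstein_functional \<theta> (conformal_laplacian \<theta> h)
           (conformal_field \<theta> h V) (conformal_field \<theta> h W) = 0 \<and>
         einstein_density \<theta> (conformal_laplacian \<theta> h)
           (conformal_field \<theta> h V) (conformal_field \<theta> h W) = (\<lambda>_. 0)"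
proof -
  obtain \<psi> where \<psi>: "derivs_on UNIV \<psi>" "\<And>\<beta> \<xi>. norm \<xi> \<ge> 1/2 \<Longrightarrow> \<psi> \<beta> \<xi> = 0"
    "\<And>\<beta> \<xi>. norm \<xi> \<le> 1/8 \<Longrightarrow> \<psi> \<beta> \<xi> = (if \<beta> = 0 then 1 else 0)"
    using exists_cutoff by blast
  obtain n where n: "fourier_symbol 2 n inv_norm_sq"
    using exists_inverse_laplace_symbol[OF \<psi>] by blast
  interpret conformal_calculus \<theta> h \<psi> n
    using assms fourier_symbol_cutoff[OF \<psi>(1,2)] n \<psi>(3)[of 0 0] by unfold_locales auto
  have "einstein_functional \<theta> (conformal_laplacian \<theta> h) (conformal_field \<theta> h V) (conformal_field \<theta> h W) = 0"
    using fun_cong[OF einstein_density_zero[of V W], of 0]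
    by (simp add: einstein_functional_def wodzicki_residue_def nct_tau_def einstein_density_def)
  then show ?thesis using metric_functional_eq einstein_density_zero by blast
qed

end
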